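(* Let $X,Y$ be smooth vector fields on the orbit $\mathbb{B}$, let $\beta\in\mathbb{B}$, and let $X_\beta$, $Y_\beta$, $V_\beta:\mathbb{V}\to\mathfrak{g}$, $U_0^\beta\in\mathfrak{g}$ and the linear map $\phi_\beta:\mathfrak{g}\to T_\beta\mathbb{B}$ be as defined in the context. (i) The Levi-Civita connection $\nabla^{\mathbb{B}}$ of $(\mathbb{B},g^{\mathbb{B}})$ satisfies $$\left(\nabla^{\mathbb{B}}_XY\right)_\beta=\left(d_{b_0}(\phi_\beta\circ V_\beta)\right)\left(X_\beta(b_0)\right)-\frac12\,\phi_\beta\left(U_0^\beta\right)=\left(\left.\frac{d}{dt}\right|_{t=0}(\phi_\beta\circ V_\beta)(\gamma(t))\right)-\frac12\,\phi_\beta\left(U_0^\beta\right),$$ where $\gamma$ is the geodesic of $(\mathbb{B},g^{\mathbb{B}})$ through $b_0$ in the direction $X_\beta(b_0)$, i.e. $\gamma(t)=\pi_0\left(\exp_{\mathfrak{g}}\left(t\,X_\beta(b_0)^\sharp_e\right)\right)$, with $\exp_{\mathfrak{g}}:\mathfrak{g}\to\mathbb{G}$ the Lie group exponential. (ii) If $[\![\mathfrak{m},\mathfrak{m}]\!]\subset\mathfrak{k}$, then $U_0^\beta\in\ker(d_e\pi_0)$, i.e. the second term $-\frac12\phi_\beta(U_0^\beta)$ in (i) vanishes.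
   Context: Setting. $\mathbb{G}$ is a compact connected Lie group with neutral element $e$, Lie algebra $\mathfrak{g}=T_e\mathbb{G}$ with bracket $[\![\cdot,\cdot]\!]$ (defined through left-invariant vector fields), and a bi-invariant Riemannian metric $g^{\mathbb{G}}$; $\langle\cdot,\cdot\rangle=g^{\mathbb{G}}_e$. $\mathbb{G}$ acts smoothly (on the left) on a smooth manifold $\mathbb{M}$. Fix $b_0\in\mathbb{M}$, let $\mathbb{B}=\mathbb{G}\cdot b_0$ be its orbit (an embedded submanifold), $\mathbb{K}$ the isotropy group of $b_0$, and $\pi_0:\mathbb{G}\to\mathbb{B}$, $\pi_0(Q)=Q\cdot b_0$. $\mathbb{B}$ carries the metric $g^{\mathbb{B}}$ for which the induced diffeomorphism $\mathbb{G}/\mathbb{K}\to\mathbb{B}$ is an isometry, $\mathbb{G}/\mathbb{K}$ having the quotient metric of $g^{\mathbb{G}}$; so $\pi_0$ is a Riemannian submersion. $\mathfrak{k}=\ker(d_e\pi_0)$ is the Lie algebra of $\mathbb{K}$ and $\mathfrak{m}=\mathfrak{k}^\perp$ in $(\mathfrak{g},\langle\cdot,\cdot\rangle)$. Notation. For $Q\in\mathbb{G}$: $H_Q=(\ker d_Q\pi_0)^\perp\subset T_Q\mathbb{G}$; for $\Delta\in T_b\mathbb{B}$ and $\pi_0(Q)=b$, the horizontal lift is $\Delta^\sharp_Q=((d_Q\pi_0)|_{H_Q})^{-1}(\Delta)$. $\mathcal{R}_Q[\cdot]$ denotes the differential of right multiplication by $Q$ in $\mathbb{G}$. For $\Delta\in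 T_b\mathbb{B}$, $Q\cdot[\Delta]\in T_{Q\cdot b}\mathbb{B}$ is the image of $\Delta$ under the differential at $b$ of $b'\mapsto Q\cdot b'$. For $b\in\mathbb{B}$: $\pi_b:\mathbb{G}\to\mathbb{B}$, $\pi_b(Q)=Q\cdot b$, $\mathfrak{k}_b=\ker(d_e\pi_b)$, $\mathfrak{m}_b=\mathfrak{k}_b^\perp$. Neighborhood $\mathbb{V}$. $\mathbb{U}=\{b\in\mathbb{B}:\mathfrak{k}_b\cap\mathfrak{m}=\{0\}\}$; $\mathcal{V}_{b_0}=\mathbb{B}\setminus\mathrm{Cut}(b_0)$ (complement of the cut locus); $\mathbb{V}=\mathbb{U}\cap\mathcal{V}_{b_0}$, an open neighborhood of $b_0$. For each $b\in\mathbb{B}$, $Q_b\in\mathbb{G}$ denotes an element with $Q_b\cdot b_0=b$, with $Q_b=\sigma_0(b)$ for $b\in\mathcal{V}_{b_0}$, where $\sigma_0(b)=\mathrm{Exp}^{\mathbb{G}}_e\left((\mathrm{Log}^{\mathbb{B}}_{b_0}(b))^\sharp_e\right)$ (Riemannian exponential and logarithm); $\sigma_0:\mathcal{V}_{b_0}\to\mathbb{G}$ is a smooth section of $\pi_0$ with $\sigma_0(b_0)=e$. $\mathfrak{m}$-lift function. For $b\in\mathbb{U}$, $(d_e\pi_b)|_{\mathfrak{m}}:\mathfrak{m}\to T_b\mathbb{B}$ is an isomorphism. The $\mathfrak{m}$-lift function of a vector field $Z$ is $\overline{Z}(b)=((d_e\pi_b)|_{\mathfrak{m}})^{-1}(Z(b))\in\mathfrak{m}$.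 Objects in the claim. For $b\in\mathbb{V}$: $X_\beta(b)=Q_\beta^{-1}\cdot[X(Q_\beta\cdot b)]$, $Y_\beta(b)=Q_\beta^{-1}\cdot[Y(Q_\beta\cdot b)]$ (vector fields on $\mathbb{V}$); $V_\beta(b)=\mathcal{R}_{Q_b^{-1}}\left[(Y_\beta(b))^\sharp_{Q_b}\right]\in\mathfrak{m}_b\subset\mathfrak{g}$; $U_0^\beta=[\![\overline{X_\beta}(b_0),\overline{Y_\beta}(b_0)]\!]$; $\phi_\beta(u)=Q_\beta\cdot[(d_e\pi_0)(u)]$ for $u\in\mathfrak{g}$. *)

theory Defs
  imports "HOL-Analysis.Analysis" "HOL-Algebra.Group_Action" "HOL-Algebra.Left_Coset"
begin

section \<open>Smooth manifolds\<close>

text \<open>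
  Model spaces are finite-dimensional real inner product spaces.  The class
  \<^class>\<open>euclidean_space\<close> is avoided because it excludes dimension 0, which occurs here when the
  base point is a fixed point of the action.
\<close>

definition finite_dimensional :: "'e::real_vector itself \<Rightarrow> bool" where
  "finite_dimensional _ \<longleftrightarrow> (\<exists>A::'e set. finite A \<and> span A = UNIV)"

text \<open>Meaningful for open sets \<open>S\<close> in finite-dimensional spaces.\<close>

primrec Ck_on :: "nat \<Rightarrow> 'e::real_normed_vector set \<Rightarrow> ('e \<Rightarrow> 'f::real_normed_vector) \<Rightarrow> bool" where
  "Ck_on 0 S f \<longleftrightarrow> continuous_on S f"
| "Ck_on (Suc k) S f \<longleftrightarrow>
     (\<forall>x\<in>S. f differentiable (at x)) \<and> (\<forall>v. Ck_on k S (\<lambda>x. frechet_derivative f (at x) v))"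

definition smooth_on :: "'e::real_normed_vector set \<Rightarrow> ('e \<Rightarrow> 'f::real_normed_vector) \<Rightarrow> bool" where
  "smooth_on S f \<longleftrightarrow> (\<forall>k. Ck_on k S f)"

type_synonym ('a, 'e) chart = "'a set \<times> ('a \<Rightarrow> 'e)"

abbreviation chart_inv :: "('a, 'e) chart \<Rightarrow> 'e \<Rightarrow> 'a" where
  "chart_inv c \<equiv> inv_into (fst c) (snd c)"

record ('a, 'e) manifold =
  mtop :: "'a topology"
  charts :: "('a, 'e) chart set"

abbreviation points :: "('a, 'e) manifold \<Rightarrow> 'a set" where
  "points M \<equiv> topspace (mtop M)"

definition chart_of :: "'a topology \<Rightarrow> ('a, 'e::real_normed_vector) chart \<Rightarrow> bool" where
  "chart_of T c \<longleftrightarrow> openin T (fst c) \<and> open (snd c ` fst c) \<and>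
     homeomorphic_map (subtopology T (fst c)) (top_of_set (snd c ` fst c)) (snd c)"

definition smooth_manifold :: "('a, 'e::real_inner) manifold \<Rightarrow> bool" where
  "smooth_manifold M \<longleftrightarrow>
     finite_dimensional TYPE('e) \<and> Hausdorff_space (mtop M) \<and> second_countable (mtop M) \<and>
     (\<forall>c\<in>charts M. chart_of (mtop M) c) \<and> (\<Union>c\<in>charts M. fst c) = points M \<and>
     (\<forall>c\<in>charts M. \<forall>d\<in>charts M. smooth_on (snd c ` (fst c \<inter> fst d)) (snd d \<circ> chart_inv c))"

definition smooth_map ::
  "('a, 'e::real_inner) manifold \<Rightarrow> ('b, 'f::real_inner) manifold \<Rightarrow> ('a \<Rightarrow> 'b) \<Rightarrow> bool" where
  "smooth_map M N F \<longleftrightarrow> continuous_map (mtop M) (mtop N) F \<and>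
     (\<forall>c\<in>charts M. \<forall>d\<in>charts N.
        smooth_on (snd c ` {p \<in> fst c. F p \<in> fst d}) (snd d \<circ> F \<circ> chart_inv c))"

definition smooth_fun :: "('a, 'e::real_inner) manifold \<Rightarrow> ('a \<Rightarrow> real) \<Rightarrow> bool" where
  "smooth_fun M f \<longleftrightarrow> (\<forall>c\<in>charts M. smooth_on (snd c ` fst c) (f \<circ> chart_inv c))"

definition diffeomorphism ::
  "('a, 'e::real_inner) manifold \<Rightarrow> ('b, 'f::real_inner) manifold \<Rightarrow> ('a \<Rightarrow> 'b) \<Rightarrow> bool" where
  "diffeomorphism M N F \<longleftrightarrow> smooth_map M N F \<and>
     (\<exists>F'. smooth_map N M F' \<and> (\<forall>p\<in>points M. F' (F p) = p) \<and> (\<forall>q\<in>points N. F (F' q) = q))"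

definition product_manifold ::
  "('a, 'e) manifold \<Rightarrow> ('b, 'f) manifold \<Rightarrow> ('a \<times> 'b, 'e \<times> 'f) manifold" where
  "product_manifold M N = \<lparr>mtop = prod_topology (mtop M) (mtop N),
     charts = {(fst c \<times> fst d, map_prod (snd c) (snd d)) | c d. c \<in> charts M \<and> d \<in> charts N}\<rparr>"

definition real_line :: "(real, real) manifold" where
  "real_line = \<lparr>mtop = euclideanreal, charts = {(UNIV, \<lambda>t. t)}\<rparr>"


section \<open>Tangent vectors and differentials\<close>

text \<open>
  For every point \<open>p\<close> one chart \<open>chart_at M p\<close> around \<open>p\<close> is selected, and the tangent space
  \<open>T\<^sub>p M\<close> is the model space: a vector stands for the tangent vector whose coordinates in
  \<open>chart_at M p\<close> it is.  The functions \<open>from_chart\<close> and \<open>to_chart\<close> convert between these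
  coordinates and the coordinates in any other chart around \<open>p\<close>.
\<close>

definition chart_at :: "('a, 'e) manifold \<Rightarrow> 'a \<Rightarrow> ('a, 'e) chart" where
  "chart_at M p = (SOME c. c \<in> charts M \<and> p \<in> fst c)"

abbreviation coord_at :: "('a, 'e) manifold \<Rightarrow> 'a \<Rightarrow> 'a \<Rightarrow> 'e" where
  "coord_at M p \<equiv> snd (chart_at M p)"

definition from_chart ::
  "('a, 'e::real_normed_vector) manifold \<Rightarrow> ('a, 'e) chart \<Rightarrow> 'a \<Rightarrow> 'e \<Rightarrow> 'e" where
  "from_chart M c p = frechet_derivative (coord_at M p \<circ> chart_inv c) (at (snd c p))"

definition to_chart ::
  "('a, 'e::real_normed_vector) manifold \<Rightarrow> ('a, 'e) chart \<Rightarrow> 'a \<Rightarrow> 'e \<Rightarrow> 'e" where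
  "to_chart M c p = frechet_derivative (snd c \<circ> chart_inv (chart_at M p)) (at (coord_at M p p))"

definition differential ::
  "('a, 'e::real_normed_vector) manifold \<Rightarrow> ('b, 'f::real_normed_vector) manifold \<Rightarrow>
   ('a \<Rightarrow> 'b) \<Rightarrow> 'a \<Rightarrow> 'e \<Rightarrow> 'f" where
  "differential M N F p =
     frechet_derivative (coord_at N (F p) \<circ> F \<circ> chart_inv (chart_at M p)) (at (coord_at M p p))"

definition has_differential_on ::
  "('a, 'e::real_normed_vector) manifold \<Rightarrow> 'a set \<Rightarrow>
   ('a \<Rightarrow> 'f::real_normed_vector) \<Rightarrow> 'a \<Rightarrow> ('e \<Rightarrow> 'f) \<Rightarrow> bool" where
  "has_differential_on M A f p D \<longleftrightarrow>
     ((f \<circ> chart_inv (chart_at M p)) has_derivative D)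
       (at (coord_at M p p) within coord_at M p ` (A \<inter> fst (chart_at M p)))"

definition fun_differential ::
  "('a, 'e::real_normed_vector) manifold \<Rightarrow> ('a \<Rightarrow> real) \<Rightarrow> 'a \<Rightarrow> 'e \<Rightarrow> real" where
  "fun_differential M f p =
     frechet_derivative (f \<circ> chart_inv (chart_at M p)) (at (coord_at M p p))"

definition velocity ::
  "('a, 'e::real_normed_vector) manifold \<Rightarrow> (real \<Rightarrow> 'a) \<Rightarrow> real \<Rightarrow> 'e" where
  "velocity M \<gamma> t = vector_derivative (\<lambda>s. coord_at M (\<gamma> t) (\<gamma> s)) (at t)"

definition embedded_submanifold ::
  "('a, 'f::real_inner) manifold \<Rightarrow> ('a, 'e::real_inner) manifold \<Rightarrow> bool" where
  "embedded_submanifold N M \<longleftrightarrow> smooth_manifold N \<and> points N \<subseteq> points M \<and>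
     mtop N = subtopology (mtop M) (points N) \<and>
     smooth_map N M (\<lambda>p. p) \<and> (\<forall>p\<in>points N. inj (differential N M (\<lambda>p. p) p))"


section \<open>Vector fields\<close>

definition field_rep ::
  "('a, 'e::real_normed_vector) manifold \<Rightarrow> ('a, 'e) chart \<Rightarrow> ('a \<Rightarrow> 'e) \<Rightarrow> 'e \<Rightarrow> 'e" where
  "field_rep M c X x = to_chart M c (chart_inv c x) (X (chart_inv c x))"

definition smooth_field :: "('a, 'e::real_inner) manifold \<Rightarrow> ('a \<Rightarrow> 'e) \<Rightarrow> bool" where
  "smooth_field M X \<longleftrightarrow> (\<forall>c\<in>charts M. smooth_on (snd c ` fst c) (field_rep M c X))"

text \<open>In coordinates \<open>[X, Y] = DY X - DX Y\<close>, that is, \<open>[X, Y] f = X (Y f) - Y (X f)\<close>.\<close>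

definition field_bracket ::
  "('a, 'e::real_normed_vector) manifold \<Rightarrow> ('a \<Rightarrow> 'e) \<Rightarrow> ('a \<Rightarrow> 'e) \<Rightarrow> 'a \<Rightarrow> 'e" where
  "field_bracket M X Y p =
     (let c = chart_at M p; x = snd c p in
        frechet_derivative (field_rep M c Y) (at x) (field_rep M c X x) -
        frechet_derivative (field_rep M c X) (at x) (field_rep M c Y x))"


section \<open>Riemannian geometry\<close>

type_synonym ('a, 'e) metric = "'a \<Rightarrow> 'e \<Rightarrow> 'e \<Rightarrow> real"

definition metric_rep ::
  "('a, 'e::real_normed_vector) manifold \<Rightarrow> ('a, 'e) metric \<Rightarrow> ('a, 'e) chart \<Rightarrow> 'e \<Rightarrow> 'e \<Rightarrow> 'e \<Rightarrow> real" where
  "metric_rep M g c x u v =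
     g (chart_inv c x) (from_chart M c (chart_inv c x) u) (from_chart M c (chart_inv c x) v)"

definition riemannian_metric :: "('a, 'e::real_inner) manifold \<Rightarrow> ('a, 'e) metric \<Rightarrow> bool" where
  "riemannian_metric M g \<longleftrightarrow>
     (\<forall>p\<in>points M. bilinear (g p) \<and> (\<forall>u v. g p u v = g p v u) \<and> (\<forall>u. u \<noteq> 0 \<longrightarrow> g p u u > 0)) \<and>
     (\<forall>c\<in>charts M. \<forall>u v. smooth_on (snd c ` fst c) (\<lambda>x. metric_rep M g c x u v))"

definition isometry ::
  "('a, 'e::real_inner) manifold \<Rightarrow> ('a, 'e) metric \<Rightarrow>
   ('b, 'f::real_inner) manifold \<Rightarrow> ('b, 'f) metric \<Rightarrow> ('a \<Rightarrow> 'b) \<Rightarrow> bool" where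
  "isometry M g N h F \<longleftrightarrow> diffeomorphism M N F \<and>
     (\<forall>p\<in>points M. \<forall>u v. h (F p) (differential M N F p u) (differential M N F p v) = g p u v)"

definition horizontal ::
  "('a, 'e::real_normed_vector) manifold \<Rightarrow> ('a, 'e) metric \<Rightarrow>
   ('b, 'f::real_normed_vector) manifold \<Rightarrow> ('a \<Rightarrow> 'b) \<Rightarrow> 'a \<Rightarrow> 'e set" where
  "horizontal M g N F p = {u. \<forall>w. differential M N F p w = 0 \<longrightarrow> g p u w = 0}"

definition riemannian_submersion ::
  "('a, 'e::real_inner) manifold \<Rightarrow> ('a, 'e) metric \<Rightarrow>
   ('b, 'f::real_inner) manifold \<Rightarrow> ('b, 'f) metric \<Rightarrow> ('a \<Rightarrow> 'b) \<Rightarrow> bool" where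
  "riemannian_submersion M g N h F \<longleftrightarrow> smooth_map M N F \<and> F ` points M = points N \<and>
     (\<forall>p\<in>points M. surj (differential M N F p) \<and>
        (\<forall>u\<in>horizontal M g N F p. \<forall>v\<in>horizontal M g N F p.
           h (F p) (differential M N F p u) (differential M N F p v) = g p u v))"

text \<open>A connection is an operation on vector fields; only its values on the points of the manifold
  and on smooth fields are constrained.\<close>

definition affine_connection ::
  "('a, 'e::real_inner) manifold \<Rightarrow> (('a \<Rightarrow> 'e) \<Rightarrow> ('a \<Rightarrow> 'e) \<Rightarrow> 'a \<Rightarrow> 'e) \<Rightarrow> bool" where
  "affine_connection M D \<longleftrightarrow>
     (\<forall>X Y. smooth_field M X \<longrightarrow> smooth_field M Y \<longrightarrow> smooth_field M (D X Y)) \<and>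
     (\<forall>X X' Y. smooth_field M X \<longrightarrow> smooth_field M X' \<longrightarrow> smooth_field M Y \<longrightarrow>
        (\<forall>p\<in>points M. D (\<lambda>q. X q + X' q) Y p = D X Y p + D X' Y p)) \<and>
     (\<forall>X Y Y'. smooth_field M X \<longrightarrow> smooth_field M Y \<longrightarrow> smooth_field M Y' \<longrightarrow>
        (\<forall>p\<in>points M. D X (\<lambda>q. Y q + Y' q) p = D X Y p + D X Y' p)) \<and>
     (\<forall>f X Y. smooth_fun M f \<longrightarrow> smooth_field M X \<longrightarrow> smooth_field M Y \<longrightarrow>
        (\<forall>p\<in>points M. D (\<lambda>q. f q *\<^sub>R X q) Y p = f p *\<^sub>R D X Y p \<and>
           D X (\<lambda>q. f q *\<^sub>R Y q) p = f p *\<^sub>R D X Y p + fun_differential M f p (X p) *\<^sub>R Y p))"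

definition levi_civita ::
  "('a, 'e::real_inner) manifold \<Rightarrow> ('a, 'e) metric \<Rightarrow>
   (('a \<Rightarrow> 'e) \<Rightarrow> ('a \<Rightarrow> 'e) \<Rightarrow> 'a \<Rightarrow> 'e) \<Rightarrow> bool" where
  "levi_civita M g D \<longleftrightarrow> affine_connection M D \<and>
     (\<forall>X Y. smooth_field M X \<longrightarrow> smooth_field M Y \<longrightarrow>
        (\<forall>p\<in>points M. D X Y p - D Y X p = field_bracket M X Y p)) \<and>
     (\<forall>X Y Z. smooth_field M X \<longrightarrow> smooth_field M Y \<longrightarrow> smooth_field M Z \<longrightarrow>
        (\<forall>p\<in>points M. fun_differential M (\<lambda>q. g q (Y q) (Z q)) p (X p) =
           g p (D X Y p) (Z p) + g p (Y p) (D X Z p)))"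

text \<open>The Christoffel symbols of the metric in a chart, as a vector-valued bilinear map:
  the Koszul formula for coordinate fields.\<close>

definition christoffel ::
  "('a, 'e::real_normed_vector) manifold \<Rightarrow> ('a, 'e) metric \<Rightarrow> ('a, 'e) chart \<Rightarrow> 'e \<Rightarrow> 'e \<Rightarrow> 'e \<Rightarrow> 'e" where
  "christoffel M g c x u v = (THE z. \<forall>w. metric_rep M g c x z w =
     (frechet_derivative (\<lambda>y. metric_rep M g c y v w) (at x) u +
      frechet_derivative (\<lambda>y. metric_rep M g c y u w) (at x) v -
      frechet_derivative (\<lambda>y. metric_rep M g c y u v) (at x) w) / 2)"

definition geodesic ::
  "('a, 'e::real_inner) manifold \<Rightarrow> ('a, 'e) metric \<Rightarrow> (real \<Rightarrow> 'a) \<Rightarrow> bool" where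
  "geodesic M g \<gamma> \<longleftrightarrow> smooth_map real_line M \<gamma> \<and>
     (\<forall>t. let c = chart_at M (\<gamma> t); x = (\<lambda>s. snd c (\<gamma> s)); x' = (\<lambda>s. vector_derivative x (at s)) in
        vector_derivative x' (at t) + christoffel M g c (x t) (x' t) (x' t) = 0)"

definition geodesic_from ::
  "('a, 'e::real_inner) manifold \<Rightarrow> ('a, 'e) metric \<Rightarrow> 'a \<Rightarrow> 'e \<Rightarrow> (real \<Rightarrow> 'a) \<Rightarrow> bool" where
  "geodesic_from M g p v \<gamma> \<longleftrightarrow> geodesic M g \<gamma> \<and> \<gamma> 0 = p \<and> velocity M \<gamma> 0 = v"

text \<open>Exponential, logarithm and cut locus are only used on compact, hence complete, manifolds,
  where all geodesics are defined on the whole real line.\<close>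

definition riem_exp :: "('a, 'e::real_inner) manifold \<Rightarrow> ('a, 'e) metric \<Rightarrow> 'a \<Rightarrow> 'e \<Rightarrow> 'a" where
  "riem_exp M g p v = (THE q. \<exists>\<gamma>. geodesic_from M g p v \<gamma> \<and> \<gamma> 1 = q)"

definition curve_length ::
  "('a, 'e::real_inner) manifold \<Rightarrow> ('a, 'e) metric \<Rightarrow> (real \<Rightarrow> 'a) \<Rightarrow> real" where
  "curve_length M g \<gamma> = integral {0..1} (\<lambda>t. sqrt (g (\<gamma> t) (velocity M \<gamma> t) (velocity M \<gamma> t)))"

text \<open>Piecewise smooth curves give the same infimum: a reparametrization that comes to rest at the
  corners and at the end points makes them smooth on the whole real line without changing the length.\<close>

definition riem_dist :: "('a, 'e::real_inner) manifold \<Rightarrow> ('a, 'e) metric \<Rightarrow> 'a \<Rightarrow> 'a \<Rightarrow> real" where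
  "riem_dist M g p q = Inf {curve_length M g \<gamma> | \<gamma>. smooth_map real_line M \<gamma> \<and> \<gamma> 0 = p \<and> \<gamma> 1 = q}"

text \<open>A point of the cut locus is the last point up to which a unit speed geodesic from \<open>p\<close> is
  minimizing.\<close>

definition cut_locus :: "('a, 'e::real_inner) manifold \<Rightarrow> ('a, 'e) metric \<Rightarrow> 'a \<Rightarrow> 'a set" where
  "cut_locus M g p = {riem_exp M g p (t *\<^sub>R v) | t v. g p v v = 1 \<and> t > 0 \<and>
     riem_dist M g p (riem_exp M g p (t *\<^sub>R v)) = t \<and>
     (\<forall>s>t. riem_dist M g p (riem_exp M g p (s *\<^sub>R v)) \<noteq> s)}"

text \<open>Meaningful for \<open>q\<close> outside the cut locus of \<open>p\<close>, where the minimizing geodesic is unique.\<close>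

definition riem_log :: "('a, 'e::real_inner) manifold \<Rightarrow> ('a, 'e) metric \<Rightarrow> 'a \<Rightarrow> 'a \<Rightarrow> 'e" where
  "riem_log M g p q = (THE v. riem_exp M g p v = q \<and> sqrt (g p v v) = riem_dist M g p q)"


section \<open>Lie groups\<close>

definition lie_group :: "'g monoid \<Rightarrow> ('g, 'e::real_inner) manifold \<Rightarrow> bool" where
  "lie_group G M \<longleftrightarrow> smooth_manifold M \<and> group G \<and> carrier G = points M \<and>
     smooth_map (product_manifold M M) M (\<lambda>(P, Q). P \<otimes>\<^bsub>G\<^esub> Q) \<and>
     smooth_map M M (\<lambda>Q. inv\<^bsub>G\<^esub> Q)"

definition left_invariant_field ::
  "'g monoid \<Rightarrow> ('g, 'e::real_inner) manifold \<Rightarrow> 'e \<Rightarrow> 'g \<Rightarrow> 'e" where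
  "left_invariant_field G M u Q = differential M M (\<lambda>P. Q \<otimes>\<^bsub>G\<^esub> P) \<one>\<^bsub>G\<^esub> u"

definition lie_bracket :: "'g monoid \<Rightarrow> ('g, 'e::real_inner) manifold \<Rightarrow> 'e \<Rightarrow> 'e \<Rightarrow> 'e" where
  "lie_bracket G M u v =
     field_bracket M (left_invariant_field G M u) (left_invariant_field G M v) \<one>\<^bsub>G\<^esub>"

text \<open>This determines \<open>ex\<close>: for every \<open>u\<close>, the curve \<open>t \<mapsto> ex (t u)\<close> is the one-parameter subgroup with
  initial velocity \<open>u\<close>.\<close>

definition lie_exponential ::
  "'g monoid \<Rightarrow> ('g, 'e::real_inner) manifold \<Rightarrow> ('e \<Rightarrow> 'g) \<Rightarrow> bool" where
  "lie_exponential G M ex \<longleftrightarrow>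
     (\<forall>u. smooth_map real_line M (\<lambda>t. ex (t *\<^sub>R u)) \<and>
          (\<forall>s t. ex ((s + t) *\<^sub>R u) = ex (s *\<^sub>R u) \<otimes>\<^bsub>G\<^esub> ex (t *\<^sub>R u)) \<and>
          velocity M (\<lambda>t. ex (t *\<^sub>R u)) 0 = u)"

definition bi_invariant ::
  "'g monoid \<Rightarrow> ('g, 'e::real_inner) manifold \<Rightarrow> ('g, 'e) metric \<Rightarrow> bool" where
  "bi_invariant G M g \<longleftrightarrow>
     (\<forall>P\<in>carrier G. isometry M g M g (\<lambda>Q. P \<otimes>\<^bsub>G\<^esub> Q) \<and> isometry M g M g (\<lambda>Q. Q \<otimes>\<^bsub>G\<^esub> P))"


section \<open>Orbits of compact connected Lie groups\<close>

record ('g, 'e, 'm, 'f, 'h) orbit_data =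
  grp :: "'g monoid"
  grp_mf :: "('g, 'e) manifold"
  grp_metric :: "('g, 'e) metric"
  amb :: "('m, 'f) manifold"
  act :: "'g \<Rightarrow> 'm \<Rightarrow> 'm"
  base :: 'm
  orb :: "('m, 'h) manifold"
  orb_metric :: "('m, 'h) metric"

abbreviation unit_elt :: "('g, 'e, 'm, 'f, 'h) orbit_data \<Rightarrow> 'g" where
  "unit_elt S \<equiv> \<one>\<^bsub>grp S\<^esub>"

abbreviation isotropy :: "('g, 'e, 'm, 'f, 'h) orbit_data \<Rightarrow> 'g set" where
  "isotropy S \<equiv> stabilizer (grp S) (act S) (base S)"

text \<open>The quotient metric of \<open>G/K\<close> is the one that makes \<open>Q \<mapsto> Q K\<close> a Riemannian submersion;
  in particular that map is a smooth submersion, which determines the manifold structure of \<open>G/K\<close>.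
  On a coset \<open>C\<close> the map \<open>Q \<mapsto> Q \<cdot> b\<^sub>0\<close> is constant, and \<open>the_elem\<close> extracts its value.\<close>

definition carries_quotient_metric ::
  "('g, 'e::real_inner, 'm, 'f::real_inner, 'h::real_inner) orbit_data \<Rightarrow> bool" where
  "carries_quotient_metric S \<longleftrightarrow>
     (\<exists>(N :: ('g set, 'h) manifold) h.
        smooth_manifold N \<and> points N = lcosets\<^bsub>grp S\<^esub> (isotropy S) \<and> riemannian_metric N h \<and>
        riemannian_submersion (grp_mf S) (grp_metric S) N h (\<lambda>Q. Q <#\<^bsub>grp S\<^esub> isotropy S) \<and>
        isometry N h (orb S) (orb_metric S) (\<lambda>C. the_elem ((\<lambda>Q. act S Q (base S)) ` C)))"

definition orbit_setting ::
  "('g, 'e::real_inner, 'm, 'f::real_inner, 'h::real_inner) orbit_data \<Rightarrow> bool" where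
  "orbit_setting S \<longleftrightarrow>
     lie_group (grp S) (grp_mf S) \<and>
     compact_space (mtop (grp_mf S)) \<and> connected_space (mtop (grp_mf S)) \<and>
     riemannian_metric (grp_mf S) (grp_metric S) \<and>
     bi_invariant (grp S) (grp_mf S) (grp_metric S) \<and>
     smooth_manifold (amb S) \<and>
     group_action (grp S) (points (amb S)) (act S) \<and>
     smooth_map (product_manifold (grp_mf S) (amb S)) (amb S) (\<lambda>(Q, b). act S Q b) \<and>
     base S \<in> points (amb S) \<and>
     embedded_submanifold (orb S) (amb S) \<and>
     points (orb S) = orbit (grp S) (act S) (base S) \<and>
     riemannian_metric (orb S) (orb_metric S) \<and>
     carries_quotient_metric S"

definition orbit_map :: "('g, 'e, 'm, 'f, 'h) orbit_data \<Rightarrow> 'm \<Rightarrow> 'g \<Rightarrow> 'm" where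
  "orbit_map S b Q = act S Q b"

definition d_orbit_map ::
  "('g, 'e::real_normed_vector, 'm, 'f, 'h::real_normed_vector) orbit_data \<Rightarrow> 'm \<Rightarrow> 'g \<Rightarrow> 'e \<Rightarrow> 'h" where
  "d_orbit_map S b = differential (grp_mf S) (orb S) (orbit_map S b)"

definition k_at ::
  "('g, 'e::real_normed_vector, 'm, 'f, 'h::real_normed_vector) orbit_data \<Rightarrow> 'm \<Rightarrow> 'e set" where
  "k_at S b = {u. d_orbit_map S b (unit_elt S) u = 0}"

definition m_at ::
  "('g, 'e::real_normed_vector, 'm, 'f, 'h::real_normed_vector) orbit_data \<Rightarrow> 'm \<Rightarrow> 'e set" where
  "m_at S b = {u. \<forall>w\<in>k_at S b. grp_metric S (unit_elt S) u w = 0}"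

abbreviation k_alg ::
  "('g, 'e::real_normed_vector, 'm, 'f, 'h::real_normed_vector) orbit_data \<Rightarrow> 'e set" where
  "k_alg S \<equiv> k_at S (base S)"

abbreviation m_alg ::
  "('g, 'e::real_normed_vector, 'm, 'f, 'h::real_normed_vector) orbit_data \<Rightarrow> 'e set" where
  "m_alg S \<equiv> m_at S (base S)"

definition hor_lift ::
  "('g, 'e::real_normed_vector, 'm, 'f, 'h::real_normed_vector) orbit_data \<Rightarrow> 'g \<Rightarrow> 'h \<Rightarrow> 'e" where
  "hor_lift S Q =
     inv_into (horizontal (grp_mf S) (grp_metric S) (orb S) (orbit_map S (base S)) Q)
       (d_orbit_map S (base S) Q)"

definition d_act ::
  "('g, 'e, 'm, 'f, 'h::real_normed_vector) orbit_data \<Rightarrow> 'g \<Rightarrow> 'm \<Rightarrow> 'h \<Rightarrow> 'h" where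
  "d_act S Q b = differential (orb S) (orb S) (act S Q) b"

definition d_right ::
  "('g, 'e::real_normed_vector, 'm, 'f, 'h) orbit_data \<Rightarrow> 'g \<Rightarrow> 'g \<Rightarrow> 'e \<Rightarrow> 'e" where
  "d_right S P Q = differential (grp_mf S) (grp_mf S) (\<lambda>R. R \<otimes>\<^bsub>grp S\<^esub> P) Q"

definition sigma0 ::
  "('g, 'e::real_inner, 'm, 'f, 'h::real_inner) orbit_data \<Rightarrow> 'm \<Rightarrow> 'g" where
  "sigma0 S b = riem_exp (grp_mf S) (grp_metric S) (unit_elt S)
     (hor_lift S (unit_elt S) (riem_log (orb S) (orb_metric S) (base S) b))"

definition U_nbhd ::
  "('g, 'e::real_inner, 'm, 'f, 'h::real_inner) orbit_data \<Rightarrow> 'm set" where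
  "U_nbhd S = {b \<in> points (orb S). k_at S b \<inter> m_alg S = {0}}"

definition V_nbhd ::
  "('g, 'e::real_inner, 'm, 'f, 'h::real_inner) orbit_data \<Rightarrow> 'm set" where
  "V_nbhd S = U_nbhd S \<inter> (points (orb S) - cut_locus (orb S) (orb_metric S) (base S))"

definition admissible_lift ::
  "('g, 'e::real_inner, 'm, 'f, 'h::real_inner) orbit_data \<Rightarrow> ('m \<Rightarrow> 'g) \<Rightarrow> bool" where
  "admissible_lift S q \<longleftrightarrow>
     (\<forall>b\<in>points (orb S). q b \<in> carrier (grp S) \<and> act S (q b) (base S) = b) \<and>
     (\<forall>b\<in>points (orb S) - cut_locus (orb S) (orb_metric S) (base S). q b = sigma0 S b)"

text \<open>Meaningful for \<open>b\<close> in \<open>U_nbhd S\<close>.\<close>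

definition m_lift ::
  "('g, 'e::real_inner, 'm, 'f, 'h::real_inner) orbit_data \<Rightarrow> ('m \<Rightarrow> 'h) \<Rightarrow> 'm \<Rightarrow> 'e" where
  "m_lift S Z b = inv_into (m_alg S) (d_orbit_map S b (unit_elt S)) (Z b)"

text \<open>
  In the following, \<open>q\<close> is the chosen map \<open>b \<mapsto> Q\<^sub>b\<close>.  The formulas for \<open>X\<^sub>\<beta>\<close> and \<open>V\<^sub>\<beta>\<close> make sense
  at every point of the orbit; the maps of the same name on \<open>V_nbhd S\<close> are their restrictions.
\<close>

definition pulled_field ::
  "('g, 'e, 'm, 'f, 'h::real_inner) orbit_data \<Rightarrow> ('m \<Rightarrow> 'g) \<Rightarrow> 'm \<Rightarrow> ('m \<Rightarrow> 'h) \<Rightarrow> 'm \<Rightarrow> 'h" where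
  "pulled_field S q \<beta> X b =
     d_act S (inv\<^bsub>grp S\<^esub> (q \<beta>)) (act S (q \<beta>) b) (X (act S (q \<beta>) b))"

definition V_fun ::
  "('g, 'e::real_inner, 'm, 'f, 'h::real_inner) orbit_data \<Rightarrow> ('m \<Rightarrow> 'g) \<Rightarrow> 'm \<Rightarrow> ('m \<Rightarrow> 'h) \<Rightarrow> 'm \<Rightarrow> 'e" where
  "V_fun S q \<beta> Y b =
     d_right S (inv\<^bsub>grp S\<^esub> (q b)) (q b) (hor_lift S (q b) (pulled_field S q \<beta> Y b))"

definition U0_vec ::
  "('g, 'e::real_inner, 'm, 'f, 'h::real_inner) orbit_data \<Rightarrow> ('m \<Rightarrow> 'g) \<Rightarrow> 'm \<Rightarrow>
   ('m \<Rightarrow> 'h) \<Rightarrow> ('m \<Rightarrow> 'h) \<Rightarrow> 'e" where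
  "U0_vec S q \<beta> X Y = lie_bracket (grp S) (grp_mf S)
     (m_lift S (pulled_field S q \<beta> X) (base S)) (m_lift S (pulled_field S q \<beta> Y) (base S))"

definition phi_map ::
  "('g, 'e::real_inner, 'm, 'f, 'h::real_inner) orbit_data \<Rightarrow> ('m \<Rightarrow> 'g) \<Rightarrow> 'm \<Rightarrow> 'e \<Rightarrow> 'h" where
  "phi_map S q \<beta> u = d_act S (q \<beta>) (base S) (d_orbit_map S (base S) (unit_elt S) u)"

end

(* Write A_b u for the value at b of the fundamental field generated by u.  The right translate V of
   the horizontal lift of a vector W in T_b B satisfies <V, u> = g^B(W, A_b u) for all u, so it is the
   adjoint of A_b applied to W and depends smoothly on b, with no reference to the cut locus or to the
   choice of Q_b.  Equivariance of A turns the claim at b_0 into one at beta: phi o V is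
   b |-> sum_i v_i(Q_beta b) A_beta e_i with v_i = g^B(Y, e_i^* ), where the e_i are orthonormal in the
   Lie algebra and e_i^* is the fundamental field of e_i.  Expanding X and Y in fundamental fields, the
   Leibniz rule for nabla gives the first term, and the Koszul formula together with the
   Ad-invariance of the inner product gives nabla_{u^*} w^* = -1/2 A[u, w] at beta for u, w in m_beta,
   which is the second.  The same identities give the geodesic equation for the orbits of
   one-parameter groups.

   Smoothness of the action on the orbit is the only point where the embedding enters: a linear left
   inverse of the differential of the inclusion reduces it to solving a linear system with smooth
   coefficients, so that the inverse function theorem is not needed. *)
theory Submission
  imports Defs
begin

section \<open>Inner products on finite-dimensional spaces\<close>

text \<open>No flows are used. Three relations are differentiated in the group variable at the unit,
  in coordinates: the one between left translation, right translation and \<open>Ad\<close>; the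
  equivariance \<open>A_act\<close>; the invariance of the metric on the orbit. The first two rest
  on the symmetry of mixed second derivatives, of the multiplication and of the action; they give
  the bracket as derivative of \<open>Ad\<close>, and the bracket of fundamental fields with the
  minus sign of a left action.

  The fundamental fields of an orthonormal basis span the tangent spaces but are in general
  dependent. The coefficients g^B(Y, A_b e) still reproduce Y, because A_b is isometric on m_b and
  so A_b after its adjoint is the identity. Once the Leibniz rule has split off their derivatives,
  the coefficients are frozen at beta and the sums collapse to single fundamental fields with
  generators in m_beta. Only there is the metric directly the inner product of the Lie algebra, and
  only there is nabla computed.

  Model spaces are merely of class \<open>real_inner\<close>, so bases are explicit finite sets, and
  \<open>Ck_on\<close> only sees derivatives in fixed directions; derivatives in moving directions
  are expanded in such a basis.\<close>

definition inner_form :: "('e::real_vector \<Rightarrow> 'e \<Rightarrow> real) \<Rightarrow> bool" where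
  "inner_form g \<longleftrightarrow> bilinear g \<and> (\<forall>u v. g u v = g v u) \<and> (\<forall>u. u \<noteq> 0 \<longrightarrow> g u u > 0)"

definition orthonormal :: "('e::real_vector \<Rightarrow> 'e \<Rightarrow> real) \<Rightarrow> 'e set \<Rightarrow> bool" where
  "orthonormal g F \<longleftrightarrow> finite F \<and> (\<forall>u\<in>F. \<forall>v\<in>F. g u v = (if u = v then 1 else 0))"

lemma inner_form_inner: "inner_form ((\<bullet>) :: 'e::real_inner \<Rightarrow> 'e \<Rightarrow> real)"
  by (auto simp: inner_form_def bilinear_def inner_commute intro!: linearI
      simp: inner_add_left inner_add_right)

lemma inner_form_eqI:
  assumes "inner_form g" "\<And>w. g u w = g v w"
  shows "u = v"
proof (rule ccontr)
  assume "u \<noteq> v"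
  then have "g (u - v) (u - v) > 0" using assms(1) by (auto simp: inner_form_def)
  moreover have "g (u - v) (u - v) = 0"
    using assms(1) bilinear_lsub[of g u v "u - v"] assms(2)[of "u - v"] by (simp add: inner_form_def)
  ultimately show False by simp
qed

text \<open>Gram-Schmidt for a form \<open>g\<close> that need not be the inner product of the type,
  as the fibres of a Riemannian metric are not. A generator that is already in the span is dropped,
  so \<open>A\<close> may be dependent.\<close>

lemma orthonormal_exists:
  assumes g: "inner_form g" and A: "finite A"
  shows "\<exists>F. orthonormal g F \<and> span F = span A"
  using A
proof induction
  case empty
  then show ?case by (intro exI[of _ "{}"]) (auto simp: orthonormal_def)
next
  case (insert a A)
  then obtain F where oF: "orthonormal g F" and span: "span F = span A" by blast
  then have F: "finite F" "\<And>u v. u \<in> F \<Longrightarrow> v \<in> F \<Longrightarrow> g u v = (if u = v then 1 else 0)"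
    unfolding orthonormal_def by auto
  have bil: "bilinear g" and sym: "\<And>u v. g u v = g v u" and pos: "\<And>u. u \<noteq> 0 \<Longrightarrow> g u u > 0"
    using g by (auto simp: inner_form_def)
  define a' where "a' = a - (\<Sum>f\<in>F. g a f *\<^sub>R f)"
  have sumF: "(\<Sum>f\<in>F. g a f *\<^sub>R f) \<in> span F"
    by (intro span_sum span_scale span_base)
  have orth: "g a' f = 0" if f: "f \<in> F" for f
  proof -
    have lin: "linear (\<lambda>x. g x f)" using bil by (simp add: bilinear_def)
    have "g (\<Sum>k\<in>F. g a k *\<^sub>R k) f = (\<Sum>k\<in>F. g a k * g k f)"
      by (simp add: linear_sum[OF lin] linear_cmul[OF lin] )
    also have "\<dots> = (\<Sum>k\<in>F. if k = f then g a k else 0)"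
      by (rule sum.cong) (auto simp: F f)
    also have "\<dots> = g a f" using F f by simp
    finally show ?thesis by (simp add: a'_def bilinear_lsub[OF bil])
  qed
  show ?case
  proof (cases "a' = 0")
    case True
    then have "a \<in> span F" using sumF by (simp add: a'_def)
    then have "span (insert a A) = span F" using span by (simp add: span_redundant)
    then show ?thesis using oF by metis
  next
    case False
    define e where "e = (1 / sqrt (g a' a')) *\<^sub>R a'"
    have ge: "g e e = 1"
      using pos[OF False] by (simp add: e_def bilinear_lmul[OF bil] bilinear_rmul[OF bil])
    have gef: "g e f = 0" if "f \<in> F" for f
      using orth[OF that] by (simp add: e_def bilinear_lmul[OF bil])
    have a_eq: "a = sqrt (g a' a') *\<^sub>R e + (\<Sum>f\<in>F. g a f *\<^sub>R f)"
      using pos[OF False] by (simp add: e_def a'_def)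
    have "span (insert e F) = span (insert a A)"
    proof (subst span_eq, intro conjI)
      have "(\<Sum>f\<in>F. g a f *\<^sub>R f) \<in> span (insert a A)"
        using sumF span span_mono[of A "insert a A"] by blast
      then have "e \<in> span (insert a A)"
        unfolding e_def a'_def by (intro span_scale span_diff) (auto intro: span_base)
      moreover have "F \<subseteq> span (insert a A)"
        using span span_superset[of F] span_mono[of A "insert a A"] by blast
      ultimately show "insert e F \<subseteq> span (insert a A)" by simp
      have "(\<Sum>f\<in>F. g a f *\<^sub>R f) \<in> span (insert e F)"
        using sumF span_mono[of F "insert e F"] by blast
      then have "a \<in> span (insert e F)"
        by (subst a_eq) (intro span_add span_scale, auto intro: span_base)
      moreover have "A \<subseteq> span (insert e F)"
        using span span_superset[of A] span_mono[of F "insert e F"] by blast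
      ultimately show "insert a A \<subseteq> span (insert e F)" by simp
    qed
    moreover have "e \<notin> F" using ge gef by fastforce
    then have "orthonormal g (insert e F)"
      unfolding orthonormal_def using F ge gef gef[unfolded sym[of e]] by auto
    ultimately show ?thesis by blast
  qed
qed

lemma orthonormal_expand:
  assumes g: "inner_form g" and F: "orthonormal g F" and v: "v \<in> span F"
  shows "v = (\<Sum>f\<in>F. g v f *\<^sub>R f)"
proof -
  have fin: "finite F" using F by (simp add: orthonormal_def)
  have bil: "bilinear g" using g by (simp add: inner_form_def)
  obtain c where c: "v = (\<Sum>f\<in>F. c f *\<^sub>R f)" using v fin by (auto simp: span_finite)
  have "g v f = c f" if f: "f \<in> F" for f
  proof -
    have lin: "linear (\<lambda>x. g x f)" using bil by (simp add: bilinear_def)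
    have "g v f = (\<Sum>k\<in>F. c k * g k f)"
      by (simp add: c linear_sum[OF lin] linear_cmul[OF lin])
    also have "\<dots> = (\<Sum>k\<in>F. if k = f then c k else 0)"
      by (rule sum.cong) (use F f in \<open>auto simp: orthonormal_def\<close>)
    finally show ?thesis using fin f by simp
  qed
  then show ?thesis by (subst c) (auto intro!: sum.cong)
qed

lemma orthonormal_basis:
  fixes g :: "'e::real_vector \<Rightarrow> 'e \<Rightarrow> real"
  assumes "inner_form g" "finite_dimensional TYPE('e)"
  obtains F where "finite F" "orthonormal g F" "\<And>v. v = (\<Sum>f\<in>F. g v f *\<^sub>R f)"
proof -
  obtain A :: "'e set" where A: "finite A" "span A = UNIV" using assms by (auto simp: finite_dimensional_def)
  obtain F where F: "orthonormal g F" "span F = UNIV"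
    using orthonormal_exists[OF assms(1) A(1)] A by auto
  show ?thesis
    by (rule that[OF _ F(1) orthonormal_expand[OF assms(1) F(1)]])
      (use F in \<open>auto simp: orthonormal_def\<close>)
qed

lemma inner_basis:
  assumes "finite_dimensional TYPE('e)"
  obtains B :: "'e::real_inner set" where "finite B" "\<And>v. v = (\<Sum>b\<in>B. (v \<bullet> b) *\<^sub>R b)"
  using orthonormal_basis[OF inner_form_inner assms] by metis

text \<open>The orthogonal projection of \<open>v\<close> to \<open>W\<close>, written out in an
  orthonormal basis of \<open>W\<close>. It serves to strip the vertical part off a tangent vector
  of the group.\<close>

lemma orthogonal_decomposition:
  fixes g :: "'e::real_vector \<Rightarrow> 'e \<Rightarrow> real"
  assumes g: "inner_form g" and fd: "finite_dimensional TYPE('e)"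
    and W: "subspace W"
  obtains w where "w \<in> W" "\<And>z. z \<in> W \<Longrightarrow> g (v - w) z = 0"
proof -
  have bil: "bilinear g" and sym: "\<And>u v. g u v = g v u"
    using g by (auto simp: inner_form_def)
  obtain A :: "'e set" where A: "finite A" "span A = UNIV" using fd by (auto simp: finite_dimensional_def)
  obtain B where B: "B \<subseteq> W" "independent B" "W \<subseteq> span B"
    using maximal_independent_subset[of W] by blast
  then have "finite B" using independent_span_bound[of A B] A by auto
  then obtain F where F: "orthonormal g F" "span F = span B"
    using orthonormal_exists[OF g] by blast
  have FW: "span F = W" using F B W by (metis span_minimal subset_antisym)
  define w where "w = (\<Sum>f\<in>F. g v f *\<^sub>R f)"
  have "w \<in> W" unfolding w_def FW[symmetric] by (intro span_sum span_scale span_base)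
  moreover have "g (v - w) z = 0" if "z \<in> W" for z
  proof -
    have z: "z = (\<Sum>f\<in>F. g z f *\<^sub>R f)" using orthonormal_expand[OF g F(1)] that FW by auto
    have lin1: "linear (\<lambda>x. g x z)" and lin2: "linear (g v)" using bil by (auto simp: bilinear_def)
    have "g w z = (\<Sum>f\<in>F. g v f * g f z)"
      by (simp add: w_def linear_sum[OF lin1] linear_cmul[OF lin1])
    moreover have "g v z = (\<Sum>f\<in>F. g v f * g f z)"
      by (subst z) (simp add: linear_sum[OF lin2] linear_cmul[OF lin2] sym mult.commute)
    ultimately show ?thesis by (simp add: bilinear_lsub[OF bil])
  qed
  ultimately show ?thesis by (rule that)
qed

section \<open>Finite dimension and boundedness of linear maps\<close>

lemma finite_dimensional_real: "finite_dimensional TYPE(real)"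
  unfolding finite_dimensional_def
proof (intro exI conjI)
  have "x \<in> span {1}" for x :: real
    using span_scale[OF span_base[of 1 "{1::real}"], of x] by simp
  then show "span {1::real} = UNIV" by auto
qed simp

lemma finite_dimensional_prod:
  assumes "finite_dimensional (e :: 'e::real_vector itself)" "finite_dimensional (f :: 'f::real_vector itself)"
  shows "finite_dimensional TYPE('e \<times> 'f)"
proof -
  obtain A :: "'e set" where A: "finite A" "span A = UNIV" using assms by (auto simp: finite_dimensional_def)
  obtain B :: "'f set" where B: "finite B" "span B = UNIV" using assms by (auto simp: finite_dimensional_def)
  let ?C = "(\<lambda>a. (a, 0)) ` A \<union> (\<lambda>b. (0, b)) ` B"
  have 1: "linear (\<lambda>a::'e. (a, 0::'f))" and 2: "linear (\<lambda>b::'f. (0::'e, b))"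
    by (auto intro!: linearI)
  have "(x, y) \<in> span ?C" for x y
  proof -
    have "(x, 0) \<in> span ((\<lambda>a. (a, 0::'f)) ` A)" using A by (simp add: linear_span_image[OF 1])
    moreover have "(0, y) \<in> span ((\<lambda>b. (0::'e, b)) ` B)" using B by (simp add: linear_span_image[OF 2])
    ultimately have "(x, 0) + (0, y) \<in> span ?C"
      by (intro span_add) (meson span_mono Un_upper1 Un_upper2 subsetD)+
    then show ?thesis by simp
  qed
  then have "span ?C = UNIV" by auto
  then show ?thesis unfolding finite_dimensional_def using A B by (intro exI[of _ ?C]) auto
qed

text \<open>In a finite basis \<open>f\<close> is a sum of the bounded maps
  \<open>(v \<bullet> b) *\<^sub>R f b\<close>.\<close>

lemma fd_bounded_linear:
  fixes f :: "'e::real_inner \<Rightarrow> 'f::real_normed_vector"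
  assumes "finite_dimensional TYPE('e)" "linear f"
  shows "bounded_linear f"
proof -
  obtain B :: "'e set" where B: "\<And>v. v = (\<Sum>b\<in>B. (v \<bullet> b) *\<^sub>R b)" using inner_basis[OF assms(1)] by metis
  have "f v = (\<Sum>b\<in>B. (v \<bullet> b) *\<^sub>R f b)" for v
    by (subst B) (simp add: linear_sum[OF assms(2)] linear_cmul[OF assms(2)])
  then have "f = (\<lambda>v. \<Sum>b\<in>B. (v \<bullet> b) *\<^sub>R f b)" by (rule ext)
  moreover have "bounded_linear (\<lambda>v. \<Sum>b\<in>B. (v \<bullet> b) *\<^sub>R f b)"
    by (intro bounded_linear_sum bounded_linear_scaleR_const bounded_linear_inner_left)
  ultimately show ?thesis by simp
qed

section \<open>Functions of class \<open>C\<^sup>k\<close>\<close>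

lemma Ck_on_subset: "Ck_on k S f \<Longrightarrow> T \<subseteq> S \<Longrightarrow> Ck_on k T f"
  by (induction k arbitrary: f) (auto intro: continuous_on_subset)

text \<open>\<open>frechet_derivative\<close> at a point looks at a full neighbourhood; since
  \<open>S\<close> is open, agreement on \<open>S\<close> passes to the derivatives at its
  points.\<close>

lemma Ck_on_cong:
  assumes "open S" "Ck_on k S f" "\<And>x. x \<in> S \<Longrightarrow> f x = g x"
  shows "Ck_on k S g"
  using assms(2,3)
proof (induction k arbitrary: f g)
  case 0
  then show ?case using continuous_on_cong by (metis Ck_on.simps(1))
next
  case (Suc k)
  have der: "(g has_derivative frechet_derivative f (at x)) (at x)" if "x \<in> S" for x
    by (rule has_derivative_transform_within_open[OF _ \<open>open S\<close> that Suc.prems(2)])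
      (use Suc.prems(1) that in \<open>auto simp: frechet_derivative_works\<close>)
  then have "frechet_derivative f (at x) v = frechet_derivative g (at x) v" if "x \<in> S" for x v
    using that frechet_derivative_at by metis
  note eq = this
  have "Ck_on k S (\<lambda>x. frechet_derivative g (at x) v)" for v
    by (rule Suc.IH[of "\<lambda>x. frechet_derivative f (at x) v"]) (use Suc.prems(1) eq in auto)
  then show ?case using der by (auto simp: differentiable_def)
qed

lemma Ck_on_SucI:
  assumes "open S" "\<And>x. x \<in> S \<Longrightarrow> (f has_derivative f' x) (at x)" "\<And>v. Ck_on k S (\<lambda>x. f' x v)"
  shows "Ck_on (Suc k) S f"
proof -
  have "Ck_on k S (\<lambda>x. frechet_derivative f (at x) v)" for v
    by (rule Ck_on_cong[OF assms(1) assms(3)[of v]]) (use assms(2) frechet_derivative_at in metis)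
  then show ?thesis using assms(2) by (auto simp: differentiable_def)
qed

lemma Ck_on_SucD: "Ck_on (Suc k) S f \<Longrightarrow> Ck_on k S (\<lambda>x. frechet_derivative f (at x) v)"
  by simp

lemma Ck_on_has_derivative:
  "Ck_on (Suc k) S f \<Longrightarrow> x \<in> S \<Longrightarrow> (f has_derivative frechet_derivative f (at x)) (at x)"
  by (simp add: frechet_derivative_works)

lemma Ck_on_continuous: "Ck_on k S f \<Longrightarrow> continuous_on S f"
  by (cases k) (auto intro!: continuous_at_imp_continuous_on differentiable_imp_continuous_within)

lemma Ck_on_Suc_imp: "Ck_on (Suc k) S f \<Longrightarrow> Ck_on k S f"
proof (induction k arbitrary: f)
  case 0
  then show ?case by (simp only: Ck_on.simps(1) Ck_on_continuous)
qed simp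

lemma Ck_on_local:
  assumes "\<And>x. x \<in> S \<Longrightarrow> \<exists>T. open T \<and> x \<in> T \<and> Ck_on k T f"
  shows "Ck_on k S f"
  using assms
proof (induction k arbitrary: f)
  case 0
  have "isCont f x" if "x \<in> S" for x
    using 0[OF that] by (auto simp: continuous_on_eq_continuous_at)
  then show ?case by (simp add: continuous_at_imp_continuous_on)
next
  case (Suc k)
  have "f differentiable at x" if "x \<in> S" for x using Suc.prems[OF that] by auto
  moreover have "Ck_on k S (\<lambda>x. frechet_derivative f (at x) v)" for v
  proof (rule Suc.IH)
    fix x assume "x \<in> S"
    then obtain T where "open T" "x \<in> T" "Ck_on (Suc k) T f" using Suc.prems by blast
    then show "\<exists>T. open T \<and> x \<in> T \<and> Ck_on k T (\<lambda>x. frechet_derivative f (at x) v)"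
      using Ck_on_SucD by blast
  qed
  ultimately show ?case by simp
qed

lemma Ck_on_const: "open S \<Longrightarrow> Ck_on k S (\<lambda>x. c)"
  by (induction k arbitrary: c) (simp, rule Ck_on_SucI, auto intro: has_derivative_const)

lemma Ck_on_bounded_linear:
  assumes "bounded_linear f" "open S"
  shows "Ck_on k S f"
proof (cases k)
  case 0
  then show ?thesis using assms by (simp add: linear_continuous_on)
next
  case (Suc n)
  show ?thesis unfolding Suc
    by (rule Ck_on_SucI[OF assms(2) bounded_linear_imp_has_derivative[OF assms(1)] Ck_on_const[OF assms(2)]])
qed

lemma Ck_on_add: "open S \<Longrightarrow> Ck_on k S f \<Longrightarrow> Ck_on k S g \<Longrightarrow> Ck_on k S (\<lambda>x. f x + g x)"
proof (induction k arbitrary: f g)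
  case 0
  then show ?case by (auto intro: continuous_intros)
next
  case (Suc k)
  show ?case
    by (rule Ck_on_SucI[OF \<open>open S\<close> has_derivative_add[OF Ck_on_has_derivative Ck_on_has_derivative]
        Suc.IH[OF \<open>open S\<close> Ck_on_SucD Ck_on_SucD]]) (rule Suc.prems | assumption)+
qed

lemma Ck_on_bounded_bilinear:
  assumes "bounded_bilinear prd" "open S" "Ck_on k S f" "Ck_on k S g"
  shows "Ck_on k S (\<lambda>x. prd (f x) (g x))"
  using assms(3,4)
proof (induction k arbitrary: f g)
  case 0
  then show ?case using bounded_bilinear.continuous_on[OF assms(1)] by simp
next
  case (Suc k)
  note k = Ck_on_Suc_imp[OF Suc.prems(1)] Ck_on_Suc_imp[OF Suc.prems(2)]
    Ck_on_SucD[OF Suc.prems(1)] Ck_on_SucD[OF Suc.prems(2)]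
  show ?case
    by (rule Ck_on_SucI[OF assms(2) bounded_bilinear.FDERIV[OF assms(1)
            Ck_on_has_derivative[OF Suc.prems(1)] Ck_on_has_derivative[OF Suc.prems(2)]]
          Ck_on_add[OF assms(2) Suc.IH[OF k(1,4)] Suc.IH[OF k(3,2)]]])
qed

lemma Ck_on_sum:
  "open S \<Longrightarrow> (\<And>i. i \<in> I \<Longrightarrow> Ck_on k S (f i)) \<Longrightarrow> Ck_on k S (\<lambda>x. \<Sum>i\<in>I. f i x)"
  by (induction I rule: infinite_finite_induct) (auto intro: Ck_on_const Ck_on_add)

text \<open>The chain rule produces \<open>g'\<close> at \<open>f x\<close> in the direction
  \<open>f' x v\<close>, which moves with x, whereas the induction hypothesis knows
  \<open>g'\<close> only in fixed directions. Expanding the moving direction in a finite basis makes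
  it a sum of products.\<close>

lemma Ck_on_compose:
  fixes f :: "'a::real_normed_vector \<Rightarrow> 'b::real_inner" and g :: "'b \<Rightarrow> 'c::real_normed_vector"
  assumes fd: "finite_dimensional TYPE('b)" and "open S" "open T"
    and "Ck_on k S f" "Ck_on k T g" "f ` S \<subseteq> T"
  shows "Ck_on k S (\<lambda>x. g (f x))"
  using assms(4-6)
proof (induction k arbitrary: f g)
  case 0
  then show ?case using continuous_on_compose2 by auto
next
  case (Suc k)
  obtain B :: "'b set" where B: "\<And>v. v = (\<Sum>b\<in>B. (v \<bullet> b) *\<^sub>R b)" using inner_basis[OF fd] by metis
  let ?f' = "\<lambda>x. frechet_derivative f (at x)" and ?g' = "\<lambda>x. frechet_derivative g (at x)"
  have der: "((\<lambda>x. g (f x)) has_derivative (\<lambda>v. ?g' (f x) (?f' x v))) (at x)" if "x \<in> S" for x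
    by (rule has_derivative_compose[OF Ck_on_has_derivative[OF Suc.prems(1) that]
          Ck_on_has_derivative[OF Suc.prems(2)]]) (use Suc.prems(3) that in auto)
  have eq: "(\<Sum>b\<in>B. (?f' x v \<bullet> b) *\<^sub>R ?g' (f x) b) = ?g' (f x) (?f' x v)" if "x \<in> S" for x v
  proof -
    have "linear (?g' (f x))" using Ck_on_has_derivative[OF Suc.prems(2), of "f x"] that Suc.prems(3)
      by (auto intro: has_derivative_linear)
    then show ?thesis by (subst (2) B) (simp add: linear_sum linear_cmul)
  qed
  note k = Suc.IH[OF Ck_on_Suc_imp[OF Suc.prems(1)] Ck_on_SucD[OF Suc.prems(2)] Suc.prems(3)]
    Ck_on_SucD[OF Suc.prems(1)]
  have "Ck_on k S (\<lambda>x. \<Sum>b\<in>B. (?f' x v \<bullet> b) *\<^sub>R ?g' (f x) b)" for v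
    by (rule Ck_on_sum[OF \<open>open S\<close> Ck_on_bounded_bilinear[OF bounded_bilinear_scaleR \<open>open S\<close>
        Ck_on_bounded_bilinear[OF bounded_bilinear_inner \<open>open S\<close> k(2) Ck_on_const[OF \<open>open S\<close>]] k(1)]])
  then show ?case
    by (intro Ck_on_SucI[OF \<open>open S\<close> der] Ck_on_cong[OF \<open>open S\<close> _ eq])
qed

lemma smooth_on_Ck: "smooth_on S f \<Longrightarrow> Ck_on k S f"
  by (simp add: smooth_on_def)

lemma smooth_on_subset: "smooth_on S f \<Longrightarrow> T \<subseteq> S \<Longrightarrow> smooth_on T f"
  unfolding smooth_on_def using Ck_on_subset by blast

lemma smooth_on_cong:
  "open S \<Longrightarrow> smooth_on S f \<Longrightarrow> (\<And>x. x \<in> S \<Longrightarrow> f x = g x) \<Longrightarrow> smooth_on S g"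
  unfolding smooth_on_def using Ck_on_cong by blast

lemma smooth_on_local:
  assumes "\<And>x. x \<in> S \<Longrightarrow> \<exists>T. open T \<and> x \<in> T \<and> smooth_on T f"
  shows "smooth_on S f"
  unfolding smooth_on_def
proof
  fix k show "Ck_on k S f"
    by (rule Ck_on_local) (use assms smooth_on_Ck in metis)
qed

lemma smooth_on_has_derivative:
  "smooth_on S f \<Longrightarrow> x \<in> S \<Longrightarrow> (f has_derivative frechet_derivative f (at x)) (at x)"
  using Ck_on_has_derivative smooth_on_Ck by blast

lemma smooth_on_derivative:
  "smooth_on S f \<Longrightarrow> smooth_on S (\<lambda>x. frechet_derivative f (at x) v)"
  unfolding smooth_on_def using Ck_on_SucD by blast

lemma smooth_on_continuous: "smooth_on S f \<Longrightarrow> continuous_on S f"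
  using Ck_on_continuous smooth_on_Ck by blast

lemma smooth_on_const: "open S \<Longrightarrow> smooth_on S (\<lambda>x. c)"
  by (simp add: smooth_on_def Ck_on_const)

lemma smooth_on_bounded_linear: "bounded_linear f \<Longrightarrow> open S \<Longrightarrow> smooth_on S f"
  by (simp add: smooth_on_def Ck_on_bounded_linear)

lemma smooth_on_id: "open S \<Longrightarrow> smooth_on S (\<lambda>x. x)"
  by (rule smooth_on_bounded_linear[OF bounded_linear_ident])

lemma smooth_on_add:
  "open S \<Longrightarrow> smooth_on S f \<Longrightarrow> smooth_on S g \<Longrightarrow> smooth_on S (\<lambda>x. f x + g x)"
  by (simp add: smooth_on_def Ck_on_add)

lemma smooth_on_scaleR:
  "open S \<Longrightarrow> smooth_on S f \<Longrightarrow> smooth_on S g \<Longrightarrow> smooth_on S (\<lambda>x. f x *\<^sub>R g x)"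
  by (simp add: smooth_on_def Ck_on_bounded_bilinear[OF bounded_bilinear_scaleR])

lemma smooth_on_inner:
  "open S \<Longrightarrow> smooth_on S f \<Longrightarrow> smooth_on S g \<Longrightarrow> smooth_on S (\<lambda>x. f x \<bullet> g x)"
  by (simp add: smooth_on_def Ck_on_bounded_bilinear[OF bounded_bilinear_inner])

lemma smooth_on_compose:
  fixes f :: "'a::real_normed_vector \<Rightarrow> 'b::real_inner" and g :: "'b \<Rightarrow> 'c::real_normed_vector"
  assumes "finite_dimensional TYPE('b)" "open S" "open T"
    and "smooth_on S f" "smooth_on T g" "f ` S \<subseteq> T"
  shows "smooth_on S (\<lambda>x. g (f x))"
  unfolding smooth_on_def
  by (rule allI, rule Ck_on_compose[OF assms(1-3) smooth_on_Ck[OF assms(4)] smooth_on_Ck[OF assms(5)] assms(6)])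

lemma smooth_on_compose_linear:
  fixes f :: "'a::real_normed_vector \<Rightarrow> 'b::real_inner" and g :: "'b \<Rightarrow> 'c::real_normed_vector"
  assumes "finite_dimensional TYPE('b)" "open S" "smooth_on S f" "bounded_linear g"
  shows "smooth_on S (\<lambda>x. g (f x))"
  by (rule smooth_on_compose[OF assms(1,2) open_UNIV assms(3) smooth_on_bounded_linear[OF assms(4)]]) auto

lemma smooth_on_Pair:
  fixes f :: "'a::real_normed_vector \<Rightarrow> 'b::real_inner" and g :: "'a \<Rightarrow> 'c::real_inner"
  assumes fd: "finite_dimensional TYPE('b)" "finite_dimensional TYPE('c)"
    and S: "open S" and "smooth_on S f" "smooth_on S g"
  shows "smooth_on S (\<lambda>x. (f x, g x))"
proof -
  have "bounded_linear (\<lambda>x::'b. (x, 0::'c))" "bounded_linear (\<lambda>y::'c. (0::'b, y))"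
    by (auto intro: bounded_linear_Pair bounded_linear_ident bounded_linear_zero)
  note bl = this
  have "smooth_on S (\<lambda>x. (f x, 0) + (0, g x))"
    by (rule smooth_on_add[OF S smooth_on_compose_linear[OF fd(1) S assms(4) bl(1)]
          smooth_on_compose_linear[OF fd(2) S assms(5) bl(2)]])
  then show ?thesis by simp
qed

section \<open>Families of linear maps applied to moving vectors\<close>

lemma Ck_on_apply:
  fixes A :: "'a::real_normed_vector \<Rightarrow> 'b::real_inner \<Rightarrow> 'c::real_normed_vector"
  assumes fd: "finite_dimensional TYPE('b)" and S: "open S"
    and lin: "\<And>x. x \<in> S \<Longrightarrow> linear (A x)" and A: "\<And>v. Ck_on k S (\<lambda>x. A x v)" and w: "Ck_on k S w"
  shows "Ck_on k S (\<lambda>x. A x (w x))"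
proof -
  obtain B :: "'b set" where B: "\<And>v. v = (\<Sum>b\<in>B. (v \<bullet> b) *\<^sub>R b)" using inner_basis[OF fd] by metis
  have "(\<Sum>b\<in>B. (w x \<bullet> b) *\<^sub>R A x b) = A x (w x)" if "x \<in> S" for x
    using lin[OF that] by (subst (2) B) (simp add: linear_sum linear_cmul)
  moreover have "Ck_on k S (\<lambda>x. \<Sum>b\<in>B. (w x \<bullet> b) *\<^sub>R A x b)"
    by (rule Ck_on_sum[OF S Ck_on_bounded_bilinear[OF bounded_bilinear_scaleR S
        Ck_on_bounded_bilinear[OF bounded_bilinear_inner S w Ck_on_const[OF S]] A]])
  ultimately show ?thesis by (rule Ck_on_cong[OF S, rotated])
qed

lemma smooth_on_apply:
  fixes A :: "'a::real_normed_vector \<Rightarrow> 'b::real_inner \<Rightarrow> 'c::real_normed_vector"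
  assumes "finite_dimensional TYPE('b)" "open S"
    and "\<And>x. x \<in> S \<Longrightarrow> linear (A x)" "\<And>v. smooth_on S (\<lambda>x. A x v)" "smooth_on S w"
  shows "smooth_on S (\<lambda>x. A x (w x))"
  unfolding smooth_on_def
  by (rule allI, rule Ck_on_apply[OF assms(1,2,3) smooth_on_Ck[OF assms(4)] smooth_on_Ck[OF assms(5)]])

lemma has_derivative_linear_growth:
  assumes "(g has_derivative g') (at x)"
  obtains K d where "K > 0" "d > 0" "\<And>y. norm (y - x) < d \<Longrightarrow> norm (g y - g x) \<le> K * norm (y - x)"
proof -
  have bl: "bounded_linear g'" using assms by (rule has_derivative_bounded_linear)
  obtain d where d: "d > 0" "\<And>y. norm (y - x) < d \<Longrightarrow> norm (g y - g x - g' (y - x)) \<le> norm (y - x)"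
    using assms unfolding has_derivative_within_alt by (metis UNIV_I mult_1 zero_less_one)
  have "norm (g y - g x) \<le> (onorm g' + 1) * norm (y - x)" if "norm (y - x) < d" for y
    using d(2)[OF that] onorm[OF bl, of "y - x"] norm_triangle_sub[of "g y - g x" "g' (y - x)"]
    by (simp add: algebra_simps)
  then show ?thesis using d(1) onorm_pos_le[OF bl] by (intro that[of "onorm g' + 1"]) auto
qed

text \<open>A product rule in which \<open>f\<close> is only continuous: \<open>f\<close> is o(1)
  and \<open>g\<close> is O(norm (y - x)), so the product is of smaller order than norm (y -
  x).\<close>

lemma has_derivative_vanishing_scaleR:
  fixes f :: "'a::real_normed_vector \<Rightarrow> real" and g :: "'a \<Rightarrow> 'b::real_normed_vector"
  assumes f: "isCont f x" "f x = 0" and g: "(g has_derivative g') (at x)" "g x = 0"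
  shows "((\<lambda>y. f y *\<^sub>R g y) has_derivative (\<lambda>h. 0)) (at x)"
  unfolding has_derivative_within_alt
proof (intro conjI allI impI)
  fix e :: real assume "e > 0"
  obtain K d where K: "K > 0" "d > 0" "\<And>y. norm (y - x) < d \<Longrightarrow> norm (g y) \<le> K * norm (y - x)"
    using has_derivative_linear_growth[OF g(1)] g(2) by auto
  obtain d' where d': "d' > 0" "\<And>y. norm (y - x) < d' \<Longrightarrow> \<bar>f y\<bar> < e / K"
    using f K(1) \<open>e > 0\<close> unfolding continuous_at_eps_delta dist_norm
    by (metis diff_zero divide_pos_pos real_norm_def)
  show "\<exists>d>0. \<forall>y\<in>UNIV. norm (y - x) < d \<longrightarrow>
      norm (f y *\<^sub>R g y - f x *\<^sub>R g x - 0) \<le> e * norm (y - x)"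
  proof (intro exI[of _ "min d d'"] conjI ballI impI)
    fix y assume "norm (y - x) < min d d'"
    then have "\<bar>f y\<bar> * norm (g y) \<le> (e / K) * (K * norm (y - x))"
      using K d' \<open>e > 0\<close> by (intro mult_mono) (auto intro: less_imp_le)
    then show "norm (f y *\<^sub>R g y - f x *\<^sub>R g x - 0) \<le> e * norm (y - x)"
      using K(1) f(2) by simp
  qed (use K d' in auto)
qed simp

text \<open>The product of the increments of \<open>A\<close> and of \<open>w\<close> is negligible
  as soon as \<open>w\<close> is continuous. This is what makes the solution of a linear system
  differentiable when so far only its continuity is known.\<close>

lemma has_derivative_apply_vanishing:
  fixes A :: "'a::real_normed_vector \<Rightarrow> 'b::real_inner \<Rightarrow> 'c::real_normed_vector"
  assumes fd: "finite_dimensional TYPE('b)" and S: "open S" "x \<in> S"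
    and lin: "\<And>y. y \<in> S \<Longrightarrow> linear (A y)"
    and A: "\<And>v. ((\<lambda>y. A y v) has_derivative (\<lambda>h. A' h v)) (at x)"
    and w: "isCont w x" "w x = 0"
  shows "((\<lambda>y. A y (w y) - A x (w y)) has_derivative (\<lambda>h. 0)) (at x)"
proof -
  obtain B :: "'b set" where B: "\<And>v. v = (\<Sum>b\<in>B. (v \<bullet> b) *\<^sub>R b)" using inner_basis[OF fd] by metis
  have "((\<lambda>y. \<Sum>b\<in>B. (w y \<bullet> b) *\<^sub>R (A y b - A x b)) has_derivative (\<lambda>h. \<Sum>b\<in>B. 0)) (at x)"
  proof (intro has_derivative_sum has_derivative_vanishing_scaleR)
    show "((\<lambda>y. A y b - A x b) has_derivative (\<lambda>h. A' h b)) (at x)" for b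
      using has_derivative_diff[OF A[of b] has_derivative_const[of "A x b"]] by simp
  qed (use w in \<open>auto intro: continuous_intros\<close>)
  moreover have "(\<Sum>b\<in>B. (w y \<bullet> b) *\<^sub>R (A y b - A x b)) = A y (w y) - A x (w y)" if "y \<in> S" for y
    using lin[OF that] lin[OF S(2)]
    by (subst (3 4) B) (simp add: linear_sum linear_cmul scaleR_diff_right sum_subtractf)
  ultimately show ?thesis using has_derivative_transform_within_open[OF _ S] by force
qed

lemma has_derivative_apply:
  fixes A :: "'a::real_normed_vector \<Rightarrow> 'b::real_inner \<Rightarrow> 'c::real_normed_vector"
  assumes fd: "finite_dimensional TYPE('b)" and S: "open S" "x \<in> S"
    and lin: "\<And>y. y \<in> S \<Longrightarrow> linear (A y)"
    and A: "\<And>v. ((\<lambda>y. A y v) has_derivative (\<lambda>h. A' h v)) (at x)"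
    and w: "(w has_derivative w') (at x)"
  shows "((\<lambda>y. A y (w y)) has_derivative (\<lambda>h. A' h (w x) + A x (w' h))) (at x)"
proof -
  have bl: "bounded_linear (A x)" by (rule fd_bounded_linear[OF fd lin[OF S(2)]])
  have "((\<lambda>y. A y (w y - w x) - A x (w y - w x)) has_derivative (\<lambda>h. 0)) (at x)"
    by (rule has_derivative_apply_vanishing[OF fd S lin A])
      (use has_derivative_continuous[OF w] in \<open>auto intro: continuous_intros\<close>)
  \<comment> \<open>With increment \<open>d = w y - w x\<close>, the value \<open>A y (w y)\<close>
    is \<open>(A y d - A x d) + (A y (w x) + A x d)\<close>, and the first bracket has derivative
    0.\<close>
  from has_derivative_add[OF this has_derivative_add[OF A[of "w x"]
      bounded_linear.has_derivative[OF bl has_derivative_diff[OF w has_derivative_const[of "w x"]]]]]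
  have "((\<lambda>y. (A y (w y - w x) - A x (w y - w x)) + (A y (w x) + A x (w y - w x))) has_derivative
      (\<lambda>h. A' h (w x) + A x (w' h))) (at x)" by simp
  then show ?thesis
    by (rule has_derivative_transform_within_open[OF _ S]) (simp add: linear_diff[OF lin])
qed

lemma has_derivative_family_linear:
  assumes S: "open S" "x \<in> S" and lin: "\<And>y. y \<in> S \<Longrightarrow> linear (A y)"
    and A: "\<And>v. ((\<lambda>y. A y v) has_derivative (\<lambda>h. A' h v)) (at x)"
  shows "linear (A' h)"
proof (rule linearI)
  fix u v :: 'b and r :: real
  have "((\<lambda>y. A y (u + v)) has_derivative (\<lambda>h. A' h u + A' h v)) (at x)"
    by (rule has_derivative_transform_within_open[OF has_derivative_add[OF A A] S])
      (simp add: linear_add[OF lin])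
  from has_derivative_unique[OF this A] show "A' h (u + v) = A' h u + A' h v" by metis
  have "((\<lambda>y. A y (r *\<^sub>R u)) has_derivative (\<lambda>h. r *\<^sub>R A' h u)) (at x)"
    by (rule has_derivative_transform_within_open[OF has_derivative_scaleR_right[OF A] S])
      (simp add: linear_cmul[OF lin])
  from has_derivative_unique[OF this A] show "A' h (r *\<^sub>R u) = r *\<^sub>R A' h u" by metis
qed

subsection \<open>Symmetry of the second derivative\<close>

text \<open>The mean value theorem twice, first in the direction \<open>u\<close> and then in the
  direction \<open>v\<close>, turns the second difference into \<open>t\<^sup>2\<close> times a
  value of the second derivative near \<open>x\<close>. The second difference itself is symmetric in
  \<open>u\<close> and \<open>v\<close>.\<close>

lemma second_difference:
  fixes f :: "'a::real_normed_vector \<Rightarrow> real"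
  assumes S: "open S" "x \<in> S"
    and f: "\<And>y. y \<in> S \<Longrightarrow> (f has_derivative f' y) (at y)"
    and f': "\<And>y. y \<in> S \<Longrightarrow> ((\<lambda>y. f' y u) has_derivative F y) (at y)"
    and cont: "isCont (\<lambda>y. F y v) x" and e: "e > 0"
  shows "\<exists>d>0. \<forall>t. 0 < t \<and> t < d \<longrightarrow>
    \<bar>f (x + t *\<^sub>R u + t *\<^sub>R v) - f (x + t *\<^sub>R u) - f (x + t *\<^sub>R v) + f x - t\<^sup>2 * F x v\<bar> \<le> e * t\<^sup>2"
proof -
  obtain r where r: "r > 0" "\<And>y. norm (y - x) < r \<Longrightarrow> y \<in> S"
    using S unfolding open_dist dist_norm by metis
  obtain r' where r': "r' > 0" "\<And>y. norm (y - x) < r' \<Longrightarrow> \<bar>F y v - F x v\<bar> < e"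
    using cont e unfolding continuous_at_eps_delta dist_norm real_norm_def by metis
  \<comment> \<open>Any increment with both parameters below \<open>d\<close> stays in both balls;
    the summand 1 keeps the denominator positive when \<open>u\<close> and \<open>v\<close>
    vanish.\<close>
  define d where "d = min r r' / (norm u + norm v + 1)"
  have np: "norm u + norm v + 1 > 0" by (simp add: add_nonneg_pos)
  have near: "norm (x + s *\<^sub>R u + t *\<^sub>R v - x) < min r r'" if "0 \<le> s" "0 \<le> t" "s < d" "t < d" for s t
  proof -
    have "norm (x + s *\<^sub>R u + t *\<^sub>R v - x) \<le> s * norm u + t * norm v"
      using that norm_triangle_ineq[of "s *\<^sub>R u" "t *\<^sub>R v"] by simp
    also have "\<dots> \<le> d * norm u + d * norm v" using that by (intro add_mono mult_right_mono) auto
    also have "\<dots> < d * (norm u + norm v + 1)" using that by (simp add: algebra_simps)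
    finally show ?thesis using np by (simp add: d_def)
  qed
  have "\<bar>f (x + t *\<^sub>R u + t *\<^sub>R v) - f (x + t *\<^sub>R u) - f (x + t *\<^sub>R v) + f x - t\<^sup>2 * F x v\<bar> \<le> e * t\<^sup>2"
    if t: "0 < t" "t < d" for t
  proof -
    have inS: "x + s *\<^sub>R u + s' *\<^sub>R v \<in> S" if "0 \<le> s" "s \<le> t" "0 \<le> s'" "s' \<le> t" for s s'
      using near[of s s'] that t r(2) by auto
    have D1: "DERIV (\<lambda>s. f (x + s *\<^sub>R u + t *\<^sub>R v) - f (x + s *\<^sub>R u)) s :>
        f' (x + s *\<^sub>R u + t *\<^sub>R v) u - f' (x + s *\<^sub>R u) u" if "0 \<le> s" "s \<le> t" for s
    proof -
      have a: "((\<lambda>s. x + s *\<^sub>R u + c *\<^sub>R v) has_derivative (\<lambda>h. h *\<^sub>R u)) (at s)" for c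
        by (auto intro!: derivative_eq_intros)
      have b: "((\<lambda>s. f (x + s *\<^sub>R u + c *\<^sub>R v)) has_derivative (\<lambda>h. f' (x + s *\<^sub>R u + c *\<^sub>R v) (h *\<^sub>R u))) (at s)"
        if "0 \<le> c" "c \<le> t" for c
        by (rule has_derivative_compose[OF a f]) (use inS that \<open>0 \<le> s\<close> \<open>s \<le> t\<close> in auto)
      have lin: "f' (x + s *\<^sub>R u + c *\<^sub>R v) (h *\<^sub>R u) = f' (x + s *\<^sub>R u + c *\<^sub>R v) u * h"
        if "0 \<le> c" "c \<le> t" for c h
        using has_derivative_linear[OF f[OF inS[OF \<open>0 \<le> s\<close> \<open>s \<le> t\<close> that]]]
        by (simp add: linear_cmul mult.commute)
      have "((\<lambda>s. f (x + s *\<^sub>R u + c *\<^sub>R v)) has_real_derivative f' (x + s *\<^sub>R u + c *\<^sub>R v) u) (at s)"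
        if "0 \<le> c" "c \<le> t" for c
        using b[OF that] lin[OF that] by (simp add: has_field_derivative_def)
      from DERIV_diff[OF this[of t] this[of 0]] show ?thesis using t by simp
    qed
    \<comment> \<open>Mean value theorem for the first difference in \<open>v\<close>, viewed as a
      function of the parameter along \<open>u\<close>.\<close>
    obtain z where z: "0 < z" "z < t" and zeq: "f (x + t *\<^sub>R u + t *\<^sub>R v) - f (x + t *\<^sub>R u) - (f (x + t *\<^sub>R v) - f x) =
        t * (f' (x + z *\<^sub>R u + t *\<^sub>R v) u - f' (x + z *\<^sub>R u) u)"
      using MVT2[OF t(1) D1] by auto
    have D2: "DERIV (\<lambda>s. f' (x + z *\<^sub>R u + s *\<^sub>R v) u) s :> F (x + z *\<^sub>R u + s *\<^sub>R v) v"
      if "0 \<le> s" "s \<le> t" for s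
    proof -
      have a: "((\<lambda>s. x + z *\<^sub>R u + s *\<^sub>R v) has_derivative (\<lambda>h. h *\<^sub>R v)) (at s)"
        by (auto intro!: derivative_eq_intros)
      have S': "x + z *\<^sub>R u + s *\<^sub>R v \<in> S" using inS z that by auto
      have "F (x + z *\<^sub>R u + s *\<^sub>R v) (h *\<^sub>R v) = F (x + z *\<^sub>R u + s *\<^sub>R v) v * h" for h
        using has_derivative_linear[OF f'[OF S']] by (simp add: linear_cmul mult.commute)
      then show ?thesis
        using has_derivative_compose[OF a f'[OF S']] by (simp add: has_field_derivative_def)
    qed
    obtain y where y: "0 < y" "y < t" "f' (x + z *\<^sub>R u + t *\<^sub>R v) u - f' (x + z *\<^sub>R u) u = t * F (x + z *\<^sub>R u + y *\<^sub>R v) v"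
      using MVT2[OF t(1) D2] by auto
    have "\<bar>F (x + z *\<^sub>R u + y *\<^sub>R v) v - F x v\<bar> < e"
      using near[of z y] z y t by (intro r'(2)) auto
    moreover have "f (x + t *\<^sub>R u + t *\<^sub>R v) - f (x + t *\<^sub>R u) - f (x + t *\<^sub>R v) + f x - t\<^sup>2 * F x v =
        t\<^sup>2 * (F (x + z *\<^sub>R u + y *\<^sub>R v) v - F x v)"
      using zeq y(3) by (simp add: algebra_simps power2_eq_square)
    ultimately show ?thesis by (simp add: abs_mult mult.commute[of e] mult_left_mono)
  qed
  moreover have "d > 0" using r r' np by (simp add: d_def)
  ultimately show ?thesis by blast
qed

lemma mixed_derivatives_commute_real:
  fixes f :: "'a::real_normed_vector \<Rightarrow> real"
  assumes S: "open S" "x \<in> S" and f: "smooth_on S f"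
  shows "frechet_derivative (\<lambda>y. frechet_derivative f (at y) u) (at x) v =
    frechet_derivative (\<lambda>y. frechet_derivative f (at y) v) (at x) u" (is "?F u v = ?F v u")
proof (rule ccontr)
  assume neq: "?F u v \<noteq> ?F v u"
  \<comment> \<open>A third of the gap: both orders approximate the same second difference up to
    \<open>e\<close>, which bounds the gap by \<open>2 * e\<close>.\<close>
  define e where "e = \<bar>?F u v - ?F v u\<bar> / 3"
  have e: "e > 0" using neq by (simp add: e_def)
  have cont: "isCont (\<lambda>y. frechet_derivative (\<lambda>y. frechet_derivative f (at y) u) (at y) v) x" for u v
    using smooth_on_continuous[OF smooth_on_derivative[OF smooth_on_derivative[OF f]]] S
    by (simp add: continuous_on_eq_continuous_at)
  note sd = second_difference[OF S smooth_on_has_derivative[OF f]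
    smooth_on_has_derivative[OF smooth_on_derivative[OF f]] cont e]
  obtain d1 where d1: "d1 > 0" "\<And>t. 0 < t \<Longrightarrow> t < d1 \<Longrightarrow>
      \<bar>f (x + t *\<^sub>R u + t *\<^sub>R v) - f (x + t *\<^sub>R u) - f (x + t *\<^sub>R v) + f x - t\<^sup>2 * ?F u v\<bar> \<le> e * t\<^sup>2"
    using sd[of u v] by auto
  obtain d2 where d2: "d2 > 0" "\<And>t. 0 < t \<Longrightarrow> t < d2 \<Longrightarrow>
      \<bar>f (x + t *\<^sub>R v + t *\<^sub>R u) - f (x + t *\<^sub>R v) - f (x + t *\<^sub>R u) + f x - t\<^sup>2 * ?F v u\<bar> \<le> e * t\<^sup>2"
    using sd[of v u] by auto
  define t where "t = min d1 d2 / 2"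
  have t: "0 < t" "t < d1" "t < d2" using d1 d2 by (auto simp: t_def min_def)
  have "x + t *\<^sub>R v + t *\<^sub>R u = x + t *\<^sub>R u + t *\<^sub>R v" by simp
  then have "\<bar>t\<^sup>2 * ?F u v - t\<^sup>2 * ?F v u\<bar> \<le> 2 * (e * t\<^sup>2)"
    using d1(2)[OF t(1,2)] d2(2)[OF t(1,3)] by (simp only: abs_le_iff) linarith
  then have "t\<^sup>2 * \<bar>?F u v - ?F v u\<bar> \<le> t\<^sup>2 * (2 * e)"
    by (simp add: abs_mult flip: right_diff_distrib) (simp add: mult_ac)
  then have "\<bar>?F u v - ?F v u\<bar> \<le> 2 * e" using t(1) by simp
  then show False using e by (simp add: e_def)
qed

text \<open>The mean value theorem needs real values, so the claim is tested against every vector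
  \<open>w\<close>.\<close>

lemma mixed_derivatives_commute:
  fixes f :: "'a::real_normed_vector \<Rightarrow> 'b::real_inner"
  assumes S: "open S" "x \<in> S" and f: "smooth_on S f"
  shows "frechet_derivative (\<lambda>y. frechet_derivative f (at y) u) (at x) v =
    frechet_derivative (\<lambda>y. frechet_derivative f (at y) v) (at x) u"
proof -
  let ?F = "\<lambda>u v. frechet_derivative (\<lambda>y. frechet_derivative f (at y) u) (at x) v"
  have "?F u v \<bullet> w = ?F v u \<bullet> w" for w
  proof -
    let ?g = "\<lambda>y. f y \<bullet> w"
    have g: "smooth_on S ?g" using smooth_on_inner[OF S(1) f smooth_on_const[OF S(1)]] .
    have 1: "frechet_derivative ?g (at y) u = frechet_derivative f (at y) u \<bullet> w" if "y \<in> S" for y u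
      using frechet_derivative_at[OF has_derivative_inner_left[OF smooth_on_has_derivative[OF f that]]] by metis
    have 2: "frechet_derivative (\<lambda>y. frechet_derivative ?g (at y) u) (at x) v = ?F u v \<bullet> w" for u v
    proof -
      have "((\<lambda>y. frechet_derivative ?g (at y) u) has_derivative (\<lambda>v. ?F u v \<bullet> w)) (at x)"
        by (rule has_derivative_transform_within_open[OF has_derivative_inner_left[OF
            smooth_on_has_derivative[OF smooth_on_derivative[OF f] S(2)]] S]) (simp add: 1)
      from frechet_derivative_at[OF this] show ?thesis by metis
    qed
    show ?thesis using mixed_derivatives_commute_real[OF S g, of u v] by (simp add: 2)
  qed
  then show ?thesis by (rule inner_form_eqI[OF inner_form_inner])
qed

subsection \<open>Linear systems with smooth coefficients and immersions\<close>

text \<open>The lower bound is uniform in y, so the residual of the fixed vector \<open>s x\<close>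
  in the system at y controls \<open>s y - s x\<close>.\<close>

lemma linear_solution_continuous:
  fixes A :: "'a::real_normed_vector \<Rightarrow> 'b::real_inner \<Rightarrow> 'b"
  assumes S: "open S" "x \<in> S" and lin: "\<And>y. y \<in> S \<Longrightarrow> linear (A y)"
    and c: "c > 0" "\<And>y v. y \<in> S \<Longrightarrow> c * norm v \<le> norm (A y v)"
    and A: "\<And>v. isCont (\<lambda>y. A y v) x" and w: "isCont w x" and eq: "\<And>y. y \<in> S \<Longrightarrow> A y (s y) = w y"
  shows "isCont s x"
proof -
  have "((\<lambda>y. norm (w y - A y (s x)) / c) \<longlongrightarrow> norm (w x - A x (s x)) / c) (at x)"
    using w A[of "s x"] c(1) by (intro tendsto_intros) (auto simp: isCont_def)
  then have lim: "((\<lambda>y. norm (w y - A y (s x)) / c) \<longlongrightarrow> 0) (at x)" using eq[OF S(2)] by simp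
  have "\<forall>\<^sub>F y in at x. norm (s y - s x) \<le> norm (w y - A y (s x)) / c"
    using eventually_at_in_open'[OF S]
  proof eventually_elim
    case (elim y)
    then have "c * norm (s y - s x) \<le> norm (w y - A y (s x))"
      using c(2)[of y "s y - s x"] eq by (simp add: linear_diff[OF lin])
    then show ?case using c(1) by (simp add: field_simps)
  qed
  then have "((\<lambda>y. s y - s x) \<longlongrightarrow> 0) (at x)" by (rule Lim_null_comparison[OF _ lim])
  then show ?thesis by (simp add: isCont_def LIM_zero_iff)
qed

lemma bounded_below_left_inverse:
  fixes A :: "'b::real_inner \<Rightarrow> 'b"
  assumes fd: "finite_dimensional TYPE('b)" and lin: "linear A"
    and c: "c > 0" "\<And>v. c * norm v \<le> norm (A v)"
  obtains L where "bounded_linear L" "\<And>v. L (A v) = v"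
proof -
  have "v = 0" if "A v = 0" for v
    using c(1) c(2)[of v] that by (simp add: mult_le_0_iff)
  then have "inj A" using linear_injective_0[OF lin] by blast
  then obtain L where "linear L" "L \<circ> A = id" using linear_injective_left_inverse[OF lin] by blast
  then show ?thesis
    using fd_bounded_linear[OF fd] by (intro that[of L]) (auto simp: fun_eq_iff)
qed

text \<open>Implicit differentiation of \<open>A y (s y) = w y\<close>. Continuity of
  \<open>s\<close> makes the product of the two increments negligible; what remains expresses
  \<open>A x (s y)\<close> through differentiable functions, and a left inverse of
  \<open>A x\<close> frees \<open>s\<close>.\<close>

lemma linear_solution_has_derivative:
  fixes A :: "'a::real_normed_vector \<Rightarrow> 'b::real_inner \<Rightarrow> 'b"
  assumes fd: "finite_dimensional TYPE('b)"
    and S: "open S" "x \<in> S" and lin: "\<And>y. y \<in> S \<Longrightarrow> linear (A y)"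
    and c: "c > 0" "\<And>y v. y \<in> S \<Longrightarrow> c * norm v \<le> norm (A y v)"
    and A: "\<And>v. ((\<lambda>y. A y v) has_derivative (\<lambda>h. A' h v)) (at x)"
    and w: "(w has_derivative w') (at x)" and eq: "\<And>y. y \<in> S \<Longrightarrow> A y (s y) = w y"
  shows "\<exists>s'. (s has_derivative s') (at x) \<and> (\<forall>h. A x (s' h) = w' h - A' h (s x))"
proof -
  have bl: "bounded_linear (A x)" by (rule fd_bounded_linear[OF fd lin[OF S(2)]])
  obtain L where L: "bounded_linear L" "\<And>v. L (A x v) = v"
    using bounded_below_left_inverse[OF fd lin[OF S(2)] c(1) c(2)[OF S(2)]] by blast
  have "isCont s x"
    by (rule linear_solution_continuous[OF S lin c _ _ eq])
      (use has_derivative_continuous A w in blast)+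
  then have "((\<lambda>y. A y (s y - s x) - A x (s y - s x)) has_derivative (\<lambda>h. 0)) (at x)"
    by (intro has_derivative_apply_vanishing[OF fd S lin A]) (auto intro: continuous_intros)
  from has_derivative_diff[OF has_derivative_add[OF has_derivative_diff[OF w A[of "s x"]]
        has_derivative_const[of "A x (s x)"]] this]
  have "((\<lambda>y. w y - A y (s x) + A x (s x) - (A y (s y - s x) - A x (s y - s x))) has_derivative
      (\<lambda>h. w' h - A' h (s x))) (at x)" by simp
  then have "((\<lambda>y. A x (s y)) has_derivative (\<lambda>h. w' h - A' h (s x))) (at x)"
    by (rule has_derivative_transform_within_open[OF _ S]) (simp add: linear_diff[OF lin] eq S(2))
  from bounded_linear.has_derivative[OF L(1) this]
  have s: "(s has_derivative (\<lambda>h. L (w' h - A' h (s x)))) (at x)" by (simp add: L(2))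
  \<comment> \<open>\<open>L\<close> is only known as a left inverse; that \<open>A x\<close> maps
    the derivative found to the right value is read off from the product rule and the uniqueness of
    derivatives.\<close>
  have "((\<lambda>y. A y (s y)) has_derivative w') (at x)"
    by (rule has_derivative_transform_within_open[OF w S]) (simp add: eq)
  from has_derivative_unique[OF this has_derivative_apply[OF fd S lin A s]]
  have "w' h = A' h (s x) + A x (L (w' h - A' h (s x)))" for h by metis
  then have "A x (L (w' h - A' h (s x))) = w' h - A' h (s x)" for h by (metis add_diff_cancel_left')
  then show ?thesis using s by blast
qed

text \<open>Bootstrapping: the derivative of \<open>s\<close> solves the same system with a
  right-hand side that involves only first derivatives of the data and \<open>s\<close> itself, so
  each order of regularity yields the next.\<close>

lemma Ck_on_linear_solution:
  fixes A :: "'a::real_normed_vector \<Rightarrow> 'b::real_inner \<Rightarrow> 'b"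
  assumes fd: "finite_dimensional TYPE('b)"
    and S: "open S" and lin: "\<And>y. y \<in> S \<Longrightarrow> linear (A y)"
    and c: "c > 0" "\<And>y v. y \<in> S \<Longrightarrow> c * norm v \<le> norm (A y v)"
    and "\<And>v. Ck_on k S (\<lambda>y. A y v)" "Ck_on k S w" "\<And>y. y \<in> S \<Longrightarrow> A y (s y) = w y"
  shows "Ck_on k S s"
  using assms(6-)
proof (induction k arbitrary: s w)
  case 0
  have "isCont s x" if "x \<in> S" for x
    by (rule linear_solution_continuous[where A = A and w = w, OF S that lin c])
      (use 0 that in \<open>auto simp: continuous_on_eq_continuous_at[OF S]\<close>)
  then show ?case by (simp add: continuous_at_imp_continuous_on)
next
  case (Suc k)
  let ?A' = "\<lambda>x h v. frechet_derivative (\<lambda>y. A y v) (at x) h" and ?w' = "\<lambda>x. frechet_derivative w (at x)"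
  have ex: "\<exists>s'. (s has_derivative s') (at x) \<and> (\<forall>h. A x (s' h) = ?w' x h - ?A' x h (s x))" if "x \<in> S" for x
    by (rule linear_solution_has_derivative[OF fd S that lin c _ _ Suc.prems(3)])
      (use Ck_on_has_derivative[OF Suc.prems(1) that] Ck_on_has_derivative[OF Suc.prems(2) that] in auto)
  define s' where "s' x = frechet_derivative s (at x)" for x
  have s': "(s has_derivative s' x) (at x)" "A x (s' x h) = ?w' x h - ?A' x h (s x)" if "x \<in> S" for x h
    using ex[OF that] frechet_derivative_at unfolding s'_def by metis+
  have lin': "linear (?A' x h)" if "x \<in> S" for x h
    by (rule has_derivative_family_linear[OF S that lin])
      (use Ck_on_has_derivative[OF Suc.prems(1) that] in auto)
  have sk: "Ck_on k S s"
    by (rule Suc.IH[OF Ck_on_Suc_imp[OF Suc.prems(1)] Ck_on_Suc_imp[OF Suc.prems(2)] Suc.prems(3)])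
  have "Ck_on k S (\<lambda>x. ?w' x h + (- 1) *\<^sub>R ?A' x h (s x))" for h
    by (rule Ck_on_add[OF S Ck_on_SucD[OF Suc.prems(2)] Ck_on_bounded_bilinear[OF bounded_bilinear_scaleR S
      Ck_on_const[OF S] Ck_on_apply[OF fd S lin' Ck_on_SucD[OF Suc.prems(1)] sk]]])
  then have "Ck_on k S (\<lambda>x. s' x h)" for h
    by (rule Suc.IH[OF Ck_on_Suc_imp[OF Suc.prems(1)]]) (simp add: s')
  then show ?case by (intro Ck_on_SucI[OF S s'(1)])
qed

text \<open>Composing \<open>f\<close> with a left inverse of its derivative at \<open>x0\<close>
  gives a map \<open>h\<close> whose derivative there is the identity. Near \<open>x0\<close> it
  shrinks distances at most by the factor 1/2, so estimates for \<open>h\<close> after \<phi> become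
  estimates for \<phi>. Nothing is assumed of \<phi> beyond its range and the smoothness of the
  composite.\<close>

lemma immersion_smooth_lift:
  fixes f :: "'b::real_inner \<Rightarrow> 'c::real_inner"
  assumes fdb: "finite_dimensional TYPE('b)" and fdc: "finite_dimensional TYPE('c)"
    and D: "open D" "x0 \<in> D" and f: "smooth_on D f" and inj: "inj (frechet_derivative f (at x0))"
  obtains N where "open N" "x0 \<in> N" "N \<subseteq> D"
    "\<And>W (\<phi> :: 'a::real_normed_vector \<Rightarrow> 'b). \<lbrakk>open W; \<phi> ` W \<subseteq> N; smooth_on W (\<lambda>x. f (\<phi> x))\<rbrakk> \<Longrightarrow> smooth_on W \<phi>"
proof -
  let ?f' = "\<lambda>x. frechet_derivative f (at x)"
  obtain B :: "'b set" where B: "finite B" "\<And>v. v = (\<Sum>b\<in>B. (v \<bullet> b) *\<^sub>R b)" using inner_basis[OF fdb] by metis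
  have lin: "linear (?f' x0)" using smooth_on_has_derivative[OF f D(2)] by (rule has_derivative_linear)
  obtain L where L: "linear L" "L \<circ> ?f' x0 = id" using linear_injective_left_inverse[OF lin inj] by blast
  have Lb: "bounded_linear L" by (rule fd_bounded_linear[OF fdc L(1)])
  define h where "h x = L (f x)" for x
  have hs: "smooth_on D h" unfolding h_def by (rule smooth_on_compose_linear[OF fdc D(1) f Lb])
  let ?h' = "\<lambda>x. frechet_derivative h (at x)"
  have h0: "?h' x0 = (\<lambda>v. v)"
    using frechet_derivative_at[OF bounded_linear.has_derivative[OF Lb smooth_on_has_derivative[OF f D(2)]]] L(2)
    by (auto simp: h_def[abs_def] fun_eq_iff)
  have hd: "(h has_derivative ?h' x) (at x)" "linear (?h' x)" if "x \<in> D" for x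
    using smooth_on_has_derivative[OF hs that] has_derivative_linear by auto
  \<comment> \<open>A bound for the operator norm of \<open>?h' x\<close> minus the identity, as a
    finite sum whose continuity at \<open>x0\<close> follows from that of \<open>?h' x b\<close> for
    each fixed \<open>b\<close>.\<close>
  define \<nu> where "\<nu> x = (\<Sum>b\<in>B. norm b * norm (?h' x b - b))" for x
  have "isCont (\<lambda>x. ?h' x b) x0" for b
    using smooth_on_continuous[OF smooth_on_derivative[OF hs]] D by (simp add: continuous_on_eq_continuous_at)
  then have "isCont \<nu> x0" unfolding \<nu>_def by (intro continuous_intros)
  moreover have "\<nu> x0 = 0" by (simp add: \<nu>_def h0)
  ultimately obtain d where d: "d > 0" "\<And>x. dist x x0 < d \<Longrightarrow> \<nu> x < 1 / 2"
    unfolding continuous_at_eps_delta dist_norm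
    by (metis abs_less_iff diff_zero half_gt_zero_iff real_norm_def zero_less_one)
  obtain r where r: "r > 0" "\<And>x. dist x x0 < r \<Longrightarrow> x \<in> D" using D unfolding open_dist by blast
  \<comment> \<open>A ball, because the mean value inequality for \<open>h x - x\<close> needs a
    convex set.\<close>
  define N where "N = ball x0 (min d r)"
  have ND: "N \<subseteq> D" using r by (auto simp: N_def dist_commute)
  have h'_id: "norm (?h' x v - v) \<le> 1 / 2 * norm v" if "x \<in> N" for x v
  proof -
    have lx: "linear (?h' x)" using hd ND that by auto
    have "?h' x v - v = (\<Sum>b\<in>B. (v \<bullet> b) *\<^sub>R (?h' x b - b))"
      by (subst (1 2) B(2)) (simp add: linear_sum[OF lx] linear_cmul[OF lx] scaleR_diff_right sum_subtractf)
    also have "norm \<dots> \<le> (\<Sum>b\<in>B. norm v * (norm b * norm (?h' x b - b)))"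
    proof (rule sum_norm_le)
      fix b
      have "\<bar>v \<bullet> b\<bar> * norm (?h' x b - b) \<le> (norm v * norm b) * norm (?h' x b - b)"
        by (intro mult_right_mono Cauchy_Schwarz_ineq2) auto
      then show "norm ((v \<bullet> b) *\<^sub>R (?h' x b - b)) \<le> norm v * (norm b * norm (?h' x b - b))"
        by (simp add: mult.assoc)
    qed
    also have "\<dots> = norm v * \<nu> x" by (simp add: \<nu>_def sum_distrib_left)
    also have "\<dots> \<le> norm v * (1 / 2)"
      using d(2)[of x] that by (intro mult_left_mono) (auto simp: N_def dist_commute)
    finally show ?thesis by simp
  qed
  have below: "1 / 2 * norm v \<le> norm (?h' x v)" if "x \<in> N" for x v
    using h'_id[OF that, of v] norm_triangle_ineq3[of "?h' x v" v] by linarith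
  have expand: "1 / 2 * norm (x - y) \<le> norm (h x - h y)" if "x \<in> N" "y \<in> N" for x y
  proof -
    have "norm ((h x - x) - (h y - y)) \<le> 1 / 2 * norm (x - y)"
    proof (rule differentiable_bound[where f' = "\<lambda>x v. ?h' x v - v" and S = N, OF _ _ _ that])
      show "convex N" by (simp add: N_def)
      show "((\<lambda>x. h x - x) has_derivative (\<lambda>v. ?h' x v - v)) (at x within N)" if "x \<in> N" for x
        using has_derivative_diff[OF hd(1) has_derivative_ident] that ND has_derivative_at_withinI by blast
      show "onorm (\<lambda>v. ?h' x v - v) \<le> 1 / 2" if "x \<in> N" for x
        by (rule onorm_bound) (simp_all only: h'_id[OF that])
    qed
    moreover have "(h x - x) - (h y - y) = (h x - h y) - (x - y)" by simp
    ultimately have "norm ((h x - h y) - (x - y)) \<le> 1 / 2 * norm (x - y)" by simp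
    then show ?thesis using norm_triangle_ineq3[of "h x - h y" "x - y"] by linarith
  qed
  show thesis
  proof (rule that[of N])
    show "open N" "x0 \<in> N" "N \<subseteq> D" using ND d(1) r(1) by (auto simp: N_def)
    fix W and \<phi> :: "'a \<Rightarrow> 'b" assume W: "open W" "\<phi> ` W \<subseteq> N" and f\<phi>: "smooth_on W (\<lambda>x. f (\<phi> x))"
    define w where "w x = h (\<phi> x)" for x
    have ws: "smooth_on W w"
      unfolding w_def h_def by (rule smooth_on_compose_linear[OF fdc W(1) f\<phi> Lb])
    note wd = smooth_on_has_derivative[OF ws]
    have diff: "\<phi> differentiable (at p)" if p: "p \<in> W" for p
    proof -
      define a where "a = \<phi> p"
      have a: "a \<in> N" "a \<in> D" using W p ND by (auto simp: a_def)
      obtain T where T: "bounded_linear T" "\<And>v. T (?h' a v) = v"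
        using bounded_below_left_inverse[OF fdb hd(2)[OF a(2)] _ below[OF a(1)]] by auto
      \<comment> \<open>The remainder of \<open>h\<close> at \<open>a\<close>. Pulled back by \<phi>
        it is o(norm (x - p)), since \<phi> moves at most twice as far as \<open>w\<close>; then
        \<open>\<phi> x - a = T (w x - h a - e (\<phi> x))\<close> exhibits the derivative of
        \<phi>.\<close>
      define e where "e y = h y - h a - ?h' a (y - a)" for y
      have "((\<lambda>x. e (\<phi> x)) has_derivative (\<lambda>_. 0)) (at p)"
        unfolding has_derivative_within_alt
      proof (intro conjI allI impI)
        fix \<epsilon> :: real assume \<epsilon>: "\<epsilon> > 0"
        obtain K s where K: "K > 0" "s > 0" "\<And>x. norm (x - p) < s \<Longrightarrow> norm (w x - w p) \<le> K * norm (x - p)"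
          using has_derivative_linear_growth[OF wd[OF p]] by metis
        obtain \<delta> where \<delta>: "\<delta> > 0" "\<And>y. norm (y - a) < \<delta> \<Longrightarrow> norm (e y) \<le> \<epsilon> / (2 * K) * norm (y - a)"
          using hd(1)[OF a(2)] K(1) \<epsilon> unfolding has_derivative_within_alt e_def
          by (metis UNIV_I divide_pos_pos mult_pos_pos zero_less_numeral)
        obtain s' where s': "s' > 0" "\<And>x. norm (x - p) < s' \<Longrightarrow> x \<in> W"
          using W(1) p unfolding open_dist dist_norm by blast
        show "\<exists>d>0. \<forall>x\<in>UNIV. norm (x - p) < d \<longrightarrow>
            norm (e (\<phi> x) - e (\<phi> p) - 0) \<le> \<epsilon> * norm (x - p)"
        \<comment> \<open>The radii ensure, in this order, the growth bound for \<open>w\<close>,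
          membership in \<open>W\<close>, and that \<open>\<phi> x\<close> is within \<delta> of
          \<open>a\<close>.\<close>
        proof (intro exI[of _ "min s (min s' (\<delta> / (2 * K)))"] conjI ballI impI)
          show "0 < min s (min s' (\<delta> / (2 * K)))" using K s' \<delta> by simp
          fix x assume x: "norm (x - p) < min s (min s' (\<delta> / (2 * K)))"
          have "1 / 2 * norm (\<phi> x - a) \<le> norm (w x - w p)"
            using expand[of "\<phi> x" a] W s'(2)[of x] x a by (auto simp: w_def a_def)
          also have "\<dots> \<le> K * norm (x - p)" using K x by auto
          finally have 1: "norm (\<phi> x - a) \<le> 2 * K * norm (x - p)" by simp
          also have "\<dots> < \<delta>" using x K(1) by (simp add: field_simps)
          finally have "norm (e (\<phi> x)) \<le> \<epsilon> / (2 * K) * norm (\<phi> x - a)" by (rule \<delta>(2))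
          also have "\<dots> \<le> \<epsilon> / (2 * K) * (2 * K * norm (x - p))"
            using 1 \<epsilon> K(1) by (intro mult_left_mono) auto
          also have "\<dots> = \<epsilon> * norm (x - p)" using K(1) by simp
          finally show "norm (e (\<phi> x) - e (\<phi> p) - 0) \<le> \<epsilon> * norm (x - p)"
            by (simp add: e_def a_def linear_0[OF hd(2)[OF a(2)[unfolded a_def]]])
        qed
      qed simp
      from bounded_linear.has_derivative[OF T(1) has_derivative_diff[OF has_derivative_diff[OF wd[OF p]
            has_derivative_const[of "h a"]] this]]
      have "((\<lambda>x. T (w x - h a - e (\<phi> x))) has_derivative (\<lambda>v. T (frechet_derivative w (at p) v))) (at p)"
        by simp
      then have "((\<lambda>x. \<phi> x - a) has_derivative (\<lambda>v. T (frechet_derivative w (at p) v))) (at p)"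
        by (simp add: w_def e_def T(2))
      from has_derivative_add[OF this has_derivative_const[of a]] show ?thesis
        by (auto simp: differentiable_def)
    qed
    have \<phi>d: "(\<phi> has_derivative frechet_derivative \<phi> (at p)) (at p)" if "p \<in> W" for p
      using diff[OF that] by (simp add: frechet_derivative_works)
    have \<phi>N: "\<phi> p \<in> N" "\<phi> p \<in> D" if "p \<in> W" for p using W ND that by auto
    have chain: "?h' (\<phi> p) (frechet_derivative \<phi> (at p) v) = frechet_derivative w (at p) v"
      if "p \<in> W" for p v
      using fun_cong[OF frechet_derivative_at[OF has_derivative_compose[OF \<phi>d[OF that] hd(1)[OF \<phi>N(2)[OF that]]]], of v]
      by (simp add: w_def[abs_def])
    have "Ck_on k W \<phi>" for k
    proof (induction k)
      case 0
      show ?case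
        by (auto intro!: continuous_at_imp_continuous_on dest!: has_derivative_continuous[OF \<phi>d])
    next
      case (Suc k)
      have "Ck_on k W (\<lambda>p. frechet_derivative \<phi> (at p) v)" for v
      \<comment> \<open>The differentiated identity \<open>h (\<phi> p) = w p\<close> is a linear
        system for the derivative of \<phi>. Its coefficients are as regular as \<phi> is known to
        be, which gains one order.\<close>
      proof (rule Ck_on_linear_solution[OF fdb W(1), where A = "\<lambda>p. ?h' (\<phi> p)" and c = "1 / 2"])
        show "Ck_on k W (\<lambda>p. ?h' (\<phi> p) u)" for u
          by (rule Ck_on_compose[OF fdb W(1) D(1) Suc smooth_on_Ck[OF smooth_on_derivative[OF hs]]])
            (use \<phi>N in auto)
        show "Ck_on k W (\<lambda>p. frechet_derivative w (at p) v)"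
          by (rule smooth_on_Ck[OF smooth_on_derivative[OF ws]])
      qed (use \<phi>N hd below chain in auto)
      then show ?case by (intro Ck_on_SucI[OF W(1) \<phi>d])
    qed
    then show "smooth_on W \<phi>" by (simp add: smooth_on_def)
  qed
qed

section \<open>Charts\<close>

text \<open>The part of \<^const>\<open>smooth_manifold\<close> that differential calculus uses.\<close>

definition atlas :: "('a, 'e::real_inner) manifold \<Rightarrow> bool" where
  "atlas M \<longleftrightarrow> finite_dimensional TYPE('e) \<and> (\<forall>c\<in>charts M. chart_of (mtop M) c) \<and>
     (\<Union>c\<in>charts M. fst c) = points M \<and>
     (\<forall>c\<in>charts M. \<forall>d\<in>charts M. smooth_on (snd c ` (fst c \<inter> fst d)) (snd d \<circ> chart_inv c))"

lemma smooth_manifold_atlas: "smooth_manifold M \<Longrightarrow> atlas M"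
  by (simp add: smooth_manifold_def atlas_def)

lemma chart_of_inj: "chart_of T c \<Longrightarrow> inj_on (snd c) (fst c)"
  unfolding chart_of_def homeomorphic_map_def
  by (metis inf.absorb2 openin_subset topspace_subtopology)

lemma chart_inv_left: "chart_of T c \<Longrightarrow> p \<in> fst c \<Longrightarrow> chart_inv c (snd c p) = p"
  by (simp add: chart_of_inj)

lemma chart_inv_right: "x \<in> snd c ` fst c \<Longrightarrow> snd c (chart_inv c x) = x"
  by (rule f_inv_into_f)

lemma chart_inv_mem: "x \<in> snd c ` fst c \<Longrightarrow> chart_inv c x \<in> fst c"
  by (rule inv_into_into)

lemma chart_open_image:
  assumes c: "chart_of T c" and U: "openin T U"
  shows "open (snd c ` {p \<in> fst c. p \<in> U})"
proof -
  have "openin (subtopology T (fst c)) {p \<in> fst c. p \<in> U}"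
    using U by (metis (no_types) Int_def inf_commute openin_subtopology_Int mem_Collect_eq)
  moreover have "open_map (subtopology T (fst c)) (top_of_set (snd c ` fst c)) (snd c)"
    using c by (simp add: chart_of_def homeomorphic_imp_open_map)
  ultimately have "openin (top_of_set (snd c ` fst c)) (snd c ` {p \<in> fst c. p \<in> U})"
    by (auto simp: open_map_def)
  then show ?thesis using c by (auto simp: chart_of_def openin_open_eq)
qed

lemma chart_open_preimage:
  assumes c: "chart_of T c" and V: "open V"
  shows "openin T {p \<in> fst c. snd c p \<in> V}"
proof -
  have "continuous_map (subtopology T (fst c)) (top_of_set (snd c ` fst c)) (snd c)"
    using c by (simp add: chart_of_def homeomorphic_imp_continuous_map)
  then have "openin (subtopology T (fst c)) {p \<in> topspace (subtopology T (fst c)). snd c p \<in> (snd c ` fst c) \<inter> V}"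
    using V by (intro openin_continuous_map_preimage[of _ "top_of_set (snd c ` fst c)"]) (auto simp: openin_open)
  moreover have "{p \<in> topspace (subtopology T (fst c)). snd c p \<in> (snd c ` fst c) \<inter> V} = {p \<in> fst c. snd c p \<in> V}"
    using c openin_subset[of T "fst c"] by (auto simp: chart_of_def)
  ultimately show ?thesis using c openin_trans_full[of T "fst c"] by (auto simp: chart_of_def)
qed

lemma atlas_chart: "atlas M \<Longrightarrow> c \<in> charts M \<Longrightarrow> chart_of (mtop M) c"
  by (simp add: atlas_def)

lemma atlas_chart_subset: "atlas M \<Longrightarrow> c \<in> charts M \<Longrightarrow> p \<in> fst c \<Longrightarrow> p \<in> points M"
  by (auto simp: atlas_def)

lemma fd_atlas: "atlas (M :: ('a, 'e::real_inner) manifold) \<Longrightarrow> finite_dimensional TYPE('e)"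
  by (simp add: atlas_def)

lemma chart_at:
  assumes "atlas M" "p \<in> points M"
  shows "chart_at M p \<in> charts M" "p \<in> fst (chart_at M p)"
proof -
  have "p \<in> (\<Union>c\<in>charts M. fst c)" using assms unfolding atlas_def by metis
  then have "\<exists>c. c \<in> charts M \<and> p \<in> fst c" by blast
  from someI_ex[OF this] show "chart_at M p \<in> charts M" "p \<in> fst (chart_at M p)"
    by (auto simp: chart_at_def)
qed

definition rep :: "('a, 'e) chart \<Rightarrow> ('b, 'f) chart \<Rightarrow> ('a \<Rightarrow> 'b) \<Rightarrow> 'e \<Rightarrow> 'f" where
  "rep c d F x = snd d (F (chart_inv c x))"

lemma rep_comp: "snd d \<circ> F \<circ> chart_inv c = rep c d F"
  by (simp add: rep_def fun_eq_iff)

lemma atlas_transition: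
  assumes "atlas M" "c \<in> charts M" "d \<in> charts M"
  shows "smooth_on (snd c ` (fst c \<inter> fst d)) (rep c d (\<lambda>p. p))"
  using assms by (auto simp: atlas_def rep_def[abs_def] o_def)

lemma smooth_map_continuous: "smooth_map M N F \<Longrightarrow> continuous_map (mtop M) (mtop N) F"
  by (simp add: smooth_map_def)

lemma smooth_map_point: "smooth_map M N F \<Longrightarrow> p \<in> points M \<Longrightarrow> F p \<in> points N"
  using smooth_map_continuous continuous_map_image_subset_topspace by blast

lemma smooth_map_rep:
  "smooth_map M N F \<Longrightarrow> c \<in> charts M \<Longrightarrow> d \<in> charts N \<Longrightarrow>
    smooth_on (snd c ` {p \<in> fst c. F p \<in> fst d}) (rep c d F)"
  by (simp add: smooth_map_def rep_comp)

lemma smooth_map_open_domain: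
  assumes M: "atlas M" "c \<in> charts M" and F: "continuous_map (mtop M) (mtop N) F" and U: "openin (mtop N) U"
  shows "open (snd c ` {p \<in> fst c. F p \<in> U})"
proof -
  have "open (snd c ` {p \<in> fst c. p \<in> {p \<in> points M. F p \<in> U}})"
    by (rule chart_open_image[OF atlas_chart[OF M] openin_continuous_map_preimage[OF F U]])
  moreover have "{p \<in> fst c. p \<in> {p \<in> points M. F p \<in> U}} = {p \<in> fst c. F p \<in> U}"
    using atlas_chart_subset[OF M] by auto
  ultimately show ?thesis by simp
qed

lemma atlas_chart_openin: "atlas M \<Longrightarrow> c \<in> charts M \<Longrightarrow> openin (mtop M) (fst c)"
  using atlas_chart[of M c] by (simp add: chart_of_def)

lemma atlas_chart_open: "atlas M \<Longrightarrow> c \<in> charts M \<Longrightarrow> open (snd c ` fst c)"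
  using atlas_chart[of M c] by (simp add: chart_of_def)

lemma smooth_map_rep_open:
  "atlas M \<Longrightarrow> atlas N \<Longrightarrow> smooth_map M N F \<Longrightarrow> c \<in> charts M \<Longrightarrow> d \<in> charts N \<Longrightarrow>
    open (snd c ` {p \<in> fst c. F p \<in> fst d})"
  by (rule smooth_map_open_domain[OF _ _ smooth_map_continuous atlas_chart_openin])

lemma atlas_inv: "atlas M \<Longrightarrow> c \<in> charts M \<Longrightarrow> p \<in> fst c \<Longrightarrow> chart_inv c (snd c p) = p"
  by (meson atlas_chart chart_inv_left)

text \<open>Maps are total functions, while group and action identities hold only on the points;
  smoothness has to ignore the values elsewhere.\<close>

lemma smooth_map_cong:
  assumes M: "atlas M" and N: "atlas N" and F: "smooth_map M N F" and eq: "\<And>p. p \<in> points M \<Longrightarrow> F p = G p"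
  shows "smooth_map M N G"
  unfolding smooth_map_def
proof (intro conjI ballI)
  show "continuous_map (mtop M) (mtop N) G"
    using continuous_map_eq smooth_map_continuous[OF F] eq by blast
  fix c d assume cd: "c \<in> charts M" "d \<in> charts N"
  have D: "{p \<in> fst c. G p \<in> fst d} = {p \<in> fst c. F p \<in> fst d}"
    using eq atlas_chart_subset[OF M cd(1)] by auto
  show "smooth_on (snd c ` {p \<in> fst c. G p \<in> fst d}) (snd d \<circ> G \<circ> chart_inv c)"
    unfolding D rep_comp
    by (rule smooth_on_cong[OF smooth_map_rep_open[OF M N F cd] smooth_map_rep[OF F cd]])
      (auto simp: rep_def atlas_inv[OF M cd(1)] eq atlas_chart_subset[OF M cd(1)])
qed

lemma smooth_map_id: "atlas M \<Longrightarrow> smooth_map M M (\<lambda>p. p)"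
  using atlas_transition[of M] by (auto simp: smooth_map_def rep_comp Int_def)

text \<open>No single chart of \<open>N\<close> covers the image of a chart of \<open>M\<close>;
  around each point one chart of \<open>N\<close> is inserted and the domain shrunk
  accordingly.\<close>

lemma smooth_map_compose:
  assumes M: "atlas M" and N: "atlas N" and P: "atlas P"
    and F: "smooth_map M N F" and G: "smooth_map N P G"
  shows "smooth_map M P (\<lambda>p. G (F p))"
  unfolding smooth_map_def rep_comp
proof (intro conjI ballI)
  show cont: "continuous_map (mtop M) (mtop P) (\<lambda>p. G (F p))"
    using continuous_map_compose[OF smooth_map_continuous[OF F] smooth_map_continuous[OF G]] by (simp add: o_def)
  fix c e assume c: "c \<in> charts M" and e: "e \<in> charts P"
  show "smooth_on (snd c ` {p \<in> fst c. G (F p) \<in> fst e}) (rep c e (\<lambda>p. G (F p)))"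
  proof (rule smooth_on_local)
    fix x assume "x \<in> snd c ` {p \<in> fst c. G (F p) \<in> fst e}"
    then obtain p where p: "p \<in> fst c" "G (F p) \<in> fst e" "x = snd c p" by auto
    have Fp: "F p \<in> points N" using smooth_map_point[OF F] atlas_chart_subset[OF M c p(1)] .
    define d where "d = chart_at N (F p)"
    have d: "d \<in> charts N" "F p \<in> fst d" using chart_at[OF N Fp] by (auto simp: d_def)
    define V where "V = {q \<in> fst d. G q \<in> fst e}"
    have V: "openin (mtop N) V"
    proof -
      have "openin (mtop N) ({q \<in> points N. G q \<in> fst e} \<inter> fst d)"
        by (intro openin_Int openin_continuous_map_preimage[OF smooth_map_continuous[OF G]]
            atlas_chart_openin[OF P e] atlas_chart_openin[OF N d(1)])
      moreover have "{q \<in> points N. G q \<in> fst e} \<inter> fst d = V"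
        using atlas_chart_subset[OF N d(1)] by (auto simp: V_def)
      ultimately show ?thesis by simp
    qed
    let ?T = "snd c ` {p \<in> fst c. F p \<in> V}"
    have T: "open ?T" by (rule smooth_map_open_domain[OF M c smooth_map_continuous[OF F] V])
    have "smooth_on ?T (\<lambda>x. rep d e G (rep c d F x))"
    proof (rule smooth_on_compose[OF fd_atlas[OF N] T smooth_map_rep_open[OF N P G d(1) e]])
      show "smooth_on ?T (rep c d F)"
        by (rule smooth_on_subset[OF smooth_map_rep[OF F c d(1)]]) (auto simp: V_def)
      show "smooth_on (snd d ` {q \<in> fst d. G q \<in> fst e}) (rep d e G)"
        by (rule smooth_map_rep[OF G d(1) e])
    qed (auto simp: V_def rep_def atlas_inv[OF M c])
    then have "smooth_on ?T (rep c e (\<lambda>p. G (F p)))"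
      by (rule smooth_on_cong[OF T]) (auto simp: V_def rep_def atlas_inv[OF M c] atlas_inv[OF N d(1)])
    then show "\<exists>T. open T \<and> x \<in> T \<and> smooth_on T (rep c e (\<lambda>p. G (F p)))"
      using T p d by (intro exI[of _ ?T]) (auto simp: V_def)
  qed
qed

lemma smooth_map_const:
  assumes M: "atlas M" and N: "atlas N" and q: "q \<in> points N"
  shows "smooth_map M N (\<lambda>p. q)"
  unfolding smooth_map_def rep_comp
proof (intro conjI ballI)
  show cont: "continuous_map (mtop M) (mtop N) (\<lambda>p. q)" using q by simp
  fix c d assume cd: "c \<in> charts M" "d \<in> charts N"
  have "open (snd c ` {p \<in> fst c. q \<in> fst d})"
    by (rule smooth_map_open_domain[OF M cd(1) cont atlas_chart_openin[OF N cd(2)]])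
  then show "smooth_on (snd c ` {p \<in> fst c. q \<in> fst d}) (rep c d (\<lambda>p. q))"
    unfolding rep_def[abs_def] by (rule smooth_on_const)
qed

subsection \<open>Products\<close>

abbreviation prod_chart :: "('a, 'e) chart \<Rightarrow> ('b, 'f) chart \<Rightarrow> ('a \<times> 'b, 'e \<times> 'f) chart" where
  "prod_chart c d \<equiv> (fst c \<times> fst d, map_prod (snd c) (snd d))"

lemma prod_manifold_simps:
  "mtop (product_manifold M N) = prod_topology (mtop M) (mtop N)"
  "points (product_manifold M N) = points M \<times> points N"
  by (auto simp: product_manifold_def)

lemma prod_charts: "c \<in> charts M \<Longrightarrow> d \<in> charts N \<Longrightarrow> prod_chart c d \<in> charts (product_manifold M N)"
  unfolding product_manifold_def manifold.simps by (rule CollectI, rule exI[of _ c], rule exI[of _ d]) simp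

lemma prod_chartsE:
  assumes "k \<in> charts (product_manifold M N)"
  obtains c d where "c \<in> charts M" "d \<in> charts N" "k = prod_chart c d"
  using assms by (auto simp: product_manifold_def)

lemma prod_chart_image: "snd (prod_chart c d) ` fst (prod_chart c d) = (snd c ` fst c) \<times> (snd d ` fst d)"
  by (simp add: map_prod_surj_on)

lemma prod_chart_of:
  assumes c: "chart_of T c" and d: "chart_of T' d"
  shows "chart_of (prod_topology T T') (prod_chart c d)"
  unfolding chart_of_def
proof (intro conjI)
  show "openin (prod_topology T T') (fst (prod_chart c d))"
    using c d by (auto simp: chart_of_def openin_prod_Times_iff)
  show "open (snd (prod_chart c d) ` fst (prod_chart c d))"
    unfolding prod_chart_image using c d by (auto simp: chart_of_def open_Times)
  have sub: "subtopology (prod_topology T T') (fst c \<times> fst d) =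
      prod_topology (subtopology T (fst c)) (subtopology T' (fst d))"
    by (simp add: subtopology_Times)
  have im: "top_of_set ((snd c ` fst c) \<times> (snd d ` fst d)) =
      prod_topology (top_of_set (snd c ` fst c)) (top_of_set (snd d ` fst d))"
    by (simp add: subtopology_Times euclidean_product_topology flip: prod_topology_subtopology)
  obtain c' where c': "homeomorphic_maps (subtopology T (fst c)) (top_of_set (snd c ` fst c)) (snd c) c'"
    using c by (auto simp: chart_of_def homeomorphic_map_maps)
  obtain d' where d': "homeomorphic_maps (subtopology T' (fst d)) (top_of_set (snd d ` fst d)) (snd d) d'"
    using d by (auto simp: chart_of_def homeomorphic_map_maps)
  have "homeomorphic_maps (prod_topology (subtopology T (fst c)) (subtopology T' (fst d)))
      (prod_topology (top_of_set (snd c ` fst c)) (top_of_set (snd d ` fst d)))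
      (\<lambda>(x, y). (snd c x, snd d y)) (\<lambda>(x, y). (c' x, d' y))"
    using c' d' by (subst homeomorphic_maps_prod) auto
  then show "homeomorphic_map (subtopology (prod_topology T T') (fst (prod_chart c d)))
     (top_of_set (snd (prod_chart c d) ` fst (prod_chart c d))) (snd (prod_chart c d))"
    unfolding prod_chart_image unfolding fst_conv snd_conv sub im map_prod_def homeomorphic_map_maps by blast
qed

lemma prod_chart_inv:
  assumes "chart_of T c" "chart_of T' d" "x \<in> snd c ` fst c" "y \<in> snd d ` fst d"
  shows "chart_inv (prod_chart c d) (x, y) = (chart_inv c x, chart_inv d y)"
proof -
  have "chart_inv (prod_chart c d) (snd (prod_chart c d) (chart_inv c x, chart_inv d y)) = (chart_inv c x, chart_inv d y)"
    by (rule chart_inv_left[OF prod_chart_of[OF assms(1,2)]]) (simp add: chart_inv_mem assms)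
  then show ?thesis using assms by (simp add: chart_inv_right)
qed

lemma atlas_product:
  assumes M: "atlas (M :: ('a, 'e::real_inner) manifold)" and N: "atlas (N :: ('b, 'f::real_inner) manifold)"
  shows "atlas (product_manifold M N)"
  unfolding atlas_def
proof (intro conjI ballI)
  note fd = fd_atlas[OF M] fd_atlas[OF N]
  show "finite_dimensional TYPE('e \<times> 'f)" by (rule finite_dimensional_prod[OF fd])
  show "chart_of (mtop (product_manifold M N)) k" if k: "k \<in> charts (product_manifold M N)" for k
    using prod_chartsE[OF k] prod_chart_of atlas_chart[OF M] atlas_chart[OF N]
    by (metis prod_manifold_simps(1))
  have "(\<Union>c\<in>charts M. fst c) = points M" "(\<Union>d\<in>charts N. fst d) = points N"
    using M N by (auto simp: atlas_def)
  note pts = this[symmetric]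
  show "(\<Union>k\<in>charts (product_manifold M N). fst k) = points (product_manifold M N)"
    unfolding prod_manifold_simps(2)
  proof (intro equalityI subsetI)
    fix z assume "z \<in> (\<Union>k\<in>charts (product_manifold M N). fst k)"
    then obtain k where "k \<in> charts (product_manifold M N)" "z \<in> fst k" by blast
    then show "z \<in> points M \<times> points N"
      by (elim prod_chartsE) (auto simp: atlas_chart_subset[OF M] atlas_chart_subset[OF N])
  next
    fix z assume "z \<in> points M \<times> points N"
    then obtain c d where "c \<in> charts M" "d \<in> charts N" "fst z \<in> fst c" "snd z \<in> fst d"
      unfolding pts by (cases z) auto
    then show "z \<in> (\<Union>k\<in>charts (product_manifold M N). fst k)"
      by (intro UN_I[OF prod_charts]) (auto simp: mem_Times_iff)
  qed
  fix k l assume k: "k \<in> charts (product_manifold M N)" and l: "l \<in> charts (product_manifold M N)"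
  obtain c d where c: "c \<in> charts M" and d: "d \<in> charts N" and k: "k = prod_chart c d" using prod_chartsE[OF k] .
  obtain c' d' where c': "c' \<in> charts M" and d': "d' \<in> charts N" and l: "l = prod_chart c' d'" using prod_chartsE[OF l] .
  let ?A = "snd c ` (fst c \<inter> fst c')" and ?B = "snd d ` (fst d \<inter> fst d')"
  have im: "snd k ` (fst k \<inter> fst l) = ?A \<times> ?B"
    by (simp add: k l Times_Int_Times map_prod_surj_on)
  have AB: "open ?A" "open ?B"
    using chart_open_image[OF atlas_chart[OF M c] atlas_chart_openin[OF M c']]
      chart_open_image[OF atlas_chart[OF N d] atlas_chart_openin[OF N d']] by (simp_all add: Int_def)
  then have op: "open (?A \<times> ?B)" by (rule open_Times)
  have "smooth_on (?A \<times> ?B) (\<lambda>z. (rep c c' (\<lambda>p. p) (fst z), rep d d' (\<lambda>p. p) (snd z)))"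
  proof (rule smooth_on_Pair[OF fd op])
    show "smooth_on (?A \<times> ?B) (\<lambda>z. rep c c' (\<lambda>p. p) (fst z))"
      by (rule smooth_on_compose[OF fd(1) op AB(1) smooth_on_bounded_linear[OF bounded_linear_fst op]
            atlas_transition[OF M c c']]) auto
    show "smooth_on (?A \<times> ?B) (\<lambda>z. rep d d' (\<lambda>p. p) (snd z))"
      by (rule smooth_on_compose[OF fd(2) op AB(2) smooth_on_bounded_linear[OF bounded_linear_snd op]
            atlas_transition[OF N d d']]) auto
  qed
  then have "smooth_on (?A \<times> ?B) (snd l \<circ> chart_inv k)"
  proof (rule smooth_on_cong[OF op])
    fix z assume "z \<in> ?A \<times> ?B"
    then have "fst z \<in> snd c ` fst c" "snd z \<in> snd d ` fst d" by auto
    from prod_chart_inv[OF atlas_chart[OF M c] atlas_chart[OF N d] this]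
    show "(rep c c' (\<lambda>p. p) (fst z), rep d d' (\<lambda>p. p) (snd z)) = (snd l \<circ> chart_inv k) z"
      by (simp add: rep_def k l)
  qed
  then show "smooth_on (snd k ` (fst k \<inter> fst l)) (snd l \<circ> chart_inv k)" by (simp only: im)
qed

lemma smooth_map_Pair:
  assumes L: "atlas L" and M: "atlas M" and N: "atlas N" and F: "smooth_map L M F" and G: "smooth_map L N G"
  shows "smooth_map L (product_manifold M N) (\<lambda>p. (F p, G p))"
  unfolding smooth_map_def rep_comp
proof (intro conjI ballI)
  show cont: "continuous_map (mtop L) (mtop (product_manifold M N)) (\<lambda>p. (F p, G p))"
    using smooth_map_continuous[OF F] smooth_map_continuous[OF G]
    by (simp add: prod_manifold_simps continuous_map_paired)
  fix c k assume c: "c \<in> charts L" and k: "k \<in> charts (product_manifold M N)"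
  obtain d e where d: "d \<in> charts M" and e: "e \<in> charts N" and k_eq: "k = prod_chart d e" using prod_chartsE[OF k] .
  let ?D = "snd c ` {p \<in> fst c. (F p, G p) \<in> fst k}"
  have op: "open ?D"
    by (rule smooth_map_open_domain[OF L c cont atlas_chart_openin[OF atlas_product[OF M N] k]])
  have "smooth_on ?D (\<lambda>x. (rep c d F x, rep c e G x))"
    by (rule smooth_on_Pair[OF fd_atlas[OF M] fd_atlas[OF N] op
      smooth_on_subset[OF smooth_map_rep[OF F c d]] smooth_on_subset[OF smooth_map_rep[OF G c e]]])
      (auto simp: k_eq)
  then show "smooth_on ?D (rep c k (\<lambda>p. (F p, G p)))"
    by (rule smooth_on_cong[OF op]) (simp add: rep_def k_eq)
qed

lemma smooth_map_fst:
  assumes M: "atlas M" and N: "atlas N"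
  shows "smooth_map (product_manifold M N) M fst"
  unfolding smooth_map_def rep_comp
proof (intro conjI ballI)
  show cont: "continuous_map (mtop (product_manifold M N)) (mtop M) fst"
    by (simp add: prod_manifold_simps continuous_map_fst)
  fix k e assume k: "k \<in> charts (product_manifold M N)" and e: "e \<in> charts M"
  obtain c d where c: "c \<in> charts M" and d: "d \<in> charts N" and k_eq: "k = prod_chart c d" using prod_chartsE[OF k] .
  let ?D = "snd k ` {p \<in> fst k. fst p \<in> fst e}"
  have op: "open ?D"
    by (rule smooth_map_open_domain[OF atlas_product[OF M N] k cont atlas_chart_openin[OF M e]])
  have "smooth_on ?D (\<lambda>z. rep c e (\<lambda>p. p) (fst z))"
    by (rule smooth_on_compose[OF fd_atlas[OF M] op _ smooth_on_bounded_linear[OF bounded_linear_fst op]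
       atlas_transition[OF M c e]]) (use smooth_map_rep_open[OF M M smooth_map_id[OF M] c e] in \<open>auto simp: k_eq Int_def\<close>)
  then show "smooth_on ?D (rep k e fst)"
    by (rule smooth_on_cong[OF op])
      (auto simp: rep_def k_eq prod_chart_inv[OF atlas_chart[OF M c] atlas_chart[OF N d], simplified]
          atlas_inv[OF M c] atlas_inv[OF N d])
qed

lemma smooth_map_snd:
  assumes M: "atlas M" and N: "atlas N"
  shows "smooth_map (product_manifold M N) N snd"
  unfolding smooth_map_def rep_comp
proof (intro conjI ballI)
  show cont: "continuous_map (mtop (product_manifold M N)) (mtop N) snd"
    by (simp add: prod_manifold_simps continuous_map_snd)
  fix k e assume k: "k \<in> charts (product_manifold M N)" and e: "e \<in> charts N"
  obtain c d where c: "c \<in> charts M" and d: "d \<in> charts N" and k_eq: "k = prod_chart c d" using prod_chartsE[OF k] .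
  let ?D = "snd k ` {p \<in> fst k. snd p \<in> fst e}"
  have op: "open ?D"
    by (rule smooth_map_open_domain[OF atlas_product[OF M N] k cont atlas_chart_openin[OF N e]])
  have "smooth_on ?D (\<lambda>z. rep d e (\<lambda>p. p) (snd z))"
    by (rule smooth_on_compose[OF fd_atlas[OF N] op _ smooth_on_bounded_linear[OF bounded_linear_snd op]
       atlas_transition[OF N d e]]) (use smooth_map_rep_open[OF N N smooth_map_id[OF N] d e] in \<open>auto simp: k_eq Int_def\<close>)
  then show "smooth_on ?D (rep k e snd)"
    by (rule smooth_on_cong[OF op])
      (auto simp: rep_def k_eq prod_chart_inv[OF atlas_chart[OF M c] atlas_chart[OF N d], simplified]
          atlas_inv[OF M c] atlas_inv[OF N d])
qed

subsection \<open>Differentials in charts\<close>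

text \<open>Holds without differentiability: both sides choose from the same set of
  derivatives.\<close>

lemma frechet_derivative_cong_open:
  assumes "open S" "x \<in> S" "\<And>y. y \<in> S \<Longrightarrow> f y = g y"
  shows "frechet_derivative f (at x) = frechet_derivative g (at x)"
proof -
  have "(f has_derivative f') (at x) \<longleftrightarrow> (g has_derivative f') (at x)" for f'
    using has_derivative_transform_within_open[OF _ assms(1,2)] assms(3) by metis
  then show ?thesis by (simp add: frechet_derivative_def)
qed

text \<open>The differential between two arbitrary charts. \<open>differential\<close>,
  \<open>to_chart\<close> and \<open>from_chart\<close> are the instances with selected charts, so
  that one chain rule covers them all.\<close>

definition dch :: "('a, 'e::real_normed_vector) chart \<Rightarrow> ('b, 'f::real_normed_vector) chart \<Rightarrow> ('a \<Rightarrow> 'b) \<Rightarrow> 'a \<Rightarrow> 'e \<Rightarrow> 'f" where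
  "dch c d F p = frechet_derivative (rep c d F) (at (snd c p))"

lemma rep_has_derivative:
  assumes "smooth_map M N F" "c \<in> charts M" "d \<in> charts N" "p \<in> fst c" "F p \<in> fst d"
  shows "(rep c d F has_derivative dch c d F p) (at (snd c p))"
  unfolding dch_def by (rule smooth_on_has_derivative[OF smooth_map_rep[OF assms(1-3)]]) (use assms in auto)

lemma dch_linear:
  assumes "smooth_map M N F" "c \<in> charts M" "d \<in> charts N" "p \<in> fst c" "F p \<in> fst d"
  shows "linear (dch c d F p)"
  using rep_has_derivative[OF assms] by (rule has_derivative_linear)

lemma has_derivative_chart_compose:
  fixes f :: "'b \<Rightarrow> 'v::real_normed_vector"
  assumes M: "atlas M" and N: "atlas N" and F: "smooth_map M N F" and c: "c \<in> charts M" "p \<in> fst c"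
    and d: "d \<in> charts N" "F p \<in> fst d"
    and f: "((\<lambda>y. f (chart_inv d y)) has_derivative f') (at (snd d (F p)))"
  shows "((\<lambda>x. f (F (chart_inv c x))) has_derivative (\<lambda>u. f' (dch c d F p u))) (at (snd c p))"
proof -
  let ?S = "snd c ` {p \<in> fst c. F p \<in> fst d}"
  have S: "open ?S" "snd c p \<in> ?S" using smooth_map_rep_open[OF M N F c(1) d(1)] c d by auto
  have "rep c d F (snd c p) = snd d (F p)" using c by (simp add: rep_def atlas_inv[OF M])
  with f have "((\<lambda>y. f (chart_inv d y)) has_derivative f') (at (rep c d F (snd c p)))" by simp
  from has_derivative_compose[OF rep_has_derivative[OF F c(1) d(1) c(2) d(2)] this]
  show ?thesis
    by (rule has_derivative_transform_within_open[OF _ S]) (auto simp: rep_def atlas_inv[OF N d(1)] atlas_inv[OF M c(1)])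
qed

lemma dch_compose:
  assumes M: "atlas M" and N: "atlas N" and F: "smooth_map M N F" and G: "smooth_map N P G"
    and c: "c \<in> charts M" "p \<in> fst c" and d: "d \<in> charts N" "F p \<in> fst d" and e: "e \<in> charts P" "G (F p) \<in> fst e"
  shows "dch c e (\<lambda>p. G (F p)) p u = dch d e G (F p) (dch c d F p u)"
proof -
  have "((\<lambda>y. snd e (G (chart_inv d y))) has_derivative dch d e G (F p)) (at (snd d (F p)))"
    using rep_has_derivative[OF G d(1) e(1) d(2) e(2)] by (simp add: rep_def[abs_def])
  from has_derivative_chart_compose[OF M N F c d this]
  have "(rep c e (\<lambda>p. G (F p)) has_derivative (\<lambda>u. dch d e G (F p) (dch c d F p u))) (at (snd c p))"
    by (simp add: rep_def[abs_def])
  from fun_cong[OF frechet_derivative_at[OF this], of u] show ?thesis by (simp add: dch_def)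
qed

lemma dch_cong:
  assumes M: "atlas M" and c: "c \<in> charts M" "p \<in> fst c" and eq: "\<And>q. q \<in> points M \<Longrightarrow> F q = G q"
  shows "dch c d F p = dch c d G p"
  unfolding dch_def
  by (rule frechet_derivative_cong_open[OF atlas_chart_open[OF M c(1)]])
    (use c in \<open>auto simp: rep_def atlas_inv[OF M c(1)] eq atlas_chart_subset[OF M c(1)]\<close>)

lemma dch_id:
  assumes M: "atlas M" and c: "c \<in> charts M" "p \<in> fst c"
  shows "dch c c (\<lambda>p. p) p = (\<lambda>u. u)"
proof -
  have "((\<lambda>x. x) has_derivative (\<lambda>u. u)) (at (snd c p))" by (rule has_derivative_ident)
  then have "(rep c c (\<lambda>p. p) has_derivative (\<lambda>u. u)) (at (snd c p))"
    by (rule has_derivative_transform_within_open[OF _ atlas_chart_open[OF M c(1)]])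
      (use c in \<open>auto simp: rep_def atlas_inv[OF M c(1)]\<close>)
  from frechet_derivative_at[OF this] show ?thesis by (simp add: dch_def)
qed

lemma dch_transition_inverse:
  assumes M: "atlas M" and c: "c \<in> charts M" "p \<in> fst c" and d: "d \<in> charts M" "p \<in> fst d"
  shows "dch d c (\<lambda>p. p) p (dch c d (\<lambda>p. p) p u) = u"
  using dch_compose[OF M M smooth_map_id[OF M] smooth_map_id[OF M] c d c] dch_id[OF M c] by simp

lemma differential_dch: "differential M N F p = dch (chart_at M p) (chart_at N (F p)) F p"
  by (simp add: differential_def dch_def rep_comp)

lemma to_chart_dch: "to_chart M c p = dch (chart_at M p) c (\<lambda>p. p) p"
proof -
  have "snd c \<circ> chart_inv (chart_at M p) = rep (chart_at M p) c (\<lambda>p. p)" by (simp add: rep_def fun_eq_iff)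
  then show ?thesis by (simp add: to_chart_def dch_def)
qed

lemma from_chart_dch: "from_chart M c p = dch c (chart_at M p) (\<lambda>p. p) p"
proof -
  have "coord_at M p \<circ> chart_inv c = rep c (chart_at M p) (\<lambda>p. p)" by (simp add: rep_def fun_eq_iff)
  then show ?thesis by (simp add: from_chart_def dch_def)
qed

lemma chart_point: "atlas M \<Longrightarrow> c \<in> charts M \<Longrightarrow> p \<in> fst c \<Longrightarrow> chart_at M p \<in> charts M \<and> p \<in> fst (chart_at M p)"
  using chart_at atlas_chart_subset by metis

lemma to_from_chart:
  assumes M: "atlas M" and c: "c \<in> charts M" "p \<in> fst c"
  shows "to_chart M c p (from_chart M c p u) = u" "from_chart M c p (to_chart M c p u) = u"
  using dch_transition_inverse[OF M c, of "chart_at M p"] dch_transition_inverse[OF M _ _ c, of "chart_at M p"]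
    chart_point[OF M c] by (auto simp: to_chart_dch from_chart_dch)

lemma to_chart_self: "atlas M \<Longrightarrow> p \<in> points M \<Longrightarrow> to_chart M (chart_at M p) p = (\<lambda>u. u)"
  using dch_id chart_at by (metis to_chart_dch)

lemma from_chart_self: "atlas M \<Longrightarrow> p \<in> points M \<Longrightarrow> from_chart M (chart_at M p) p = (\<lambda>u. u)"
  using dch_id chart_at by (metis from_chart_dch)

lemma to_chart_linear: "atlas M \<Longrightarrow> c \<in> charts M \<Longrightarrow> p \<in> fst c \<Longrightarrow> linear (to_chart M c p)"
  unfolding to_chart_dch using chart_point by (metis dch_linear smooth_map_id)

lemma from_chart_linear: "atlas M \<Longrightarrow> c \<in> charts M \<Longrightarrow> p \<in> fst c \<Longrightarrow> linear (from_chart M c p)"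
  unfolding from_chart_dch using chart_point by (metis dch_linear smooth_map_id)

lemma to_chart_differential:
  assumes M: "atlas M" and N: "atlas N" and F: "smooth_map M N F" and p: "p \<in> points M"
    and d: "d \<in> charts N" "F p \<in> fst d"
  shows "to_chart N d (F p) (differential M N F p u) = dch (chart_at M p) d F p u"
  unfolding to_chart_dch differential_dch
  using dch_compose[OF M N F smooth_map_id[OF N] chart_at[OF M p] _ _ d] chart_at[OF N smooth_map_point[OF F p]]
  by simp

lemma differential_compose:
  assumes M: "atlas M" and N: "atlas N" and P: "atlas P" and F: "smooth_map M N F" and G: "smooth_map N P G"
    and p: "p \<in> points M"
  shows "differential M P (\<lambda>p. G (F p)) p u = differential N P G (F p) (differential M N F p u)"
  unfolding differential_dch
  by (rule dch_compose[OF M N F G]) (use chart_at M N P p smooth_map_point F G in metis)+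

lemma differential_id: "atlas M \<Longrightarrow> p \<in> points M \<Longrightarrow> differential M M (\<lambda>p. p) p = (\<lambda>u. u)"
  unfolding differential_dch using dch_id chart_at by metis

lemma differential_cong:
  assumes "atlas M" "p \<in> points M" "\<And>q. q \<in> points M \<Longrightarrow> F q = G q"
  shows "differential M N F p = differential M N G p"
  unfolding differential_dch using dch_cong[OF assms(1) chart_at[OF assms(1,2)] assms(3)] assms(2,3) by simp

lemma differential_linear:
  assumes "atlas M" "atlas N" "smooth_map M N F" "p \<in> points M"
  shows "linear (differential M N F p)"
  unfolding differential_dch
  by (rule dch_linear[OF assms(3)]) (use assms chart_at smooth_map_point in metis)+

lemma differential_inverse:
  assumes M: "atlas M" and N: "atlas N" and F: "smooth_map M N F" and G: "smooth_map N M G"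
    and p: "p \<in> points M" and inv: "\<And>q. q \<in> points M \<Longrightarrow> G (F q) = q"
  shows "differential N M G (F p) (differential M N F p u) = u"
  using differential_compose[OF M N M F G p, of u] differential_id[OF M p]
    differential_cong[OF M p, of "\<lambda>p. G (F p)" "\<lambda>p. p" M] inv
  by simp

subsection \<open>Embedded submanifolds\<close>

text \<open>The subspace topology gives continuity into \<open>N\<close>. This confines
  \<open>f\<close> near a point to a small part of one chart of \<open>N\<close>, where the
  inclusion is an immersion and smoothness can be lifted through it.\<close>

lemma smooth_map_into_embedded:
  fixes P :: "('p, 'u::real_inner) manifold" and N :: "('a, 'v::real_inner) manifold"
    and M :: "('a, 'w::real_inner) manifold"
  assumes P: "atlas P" and M: "atlas M" and N: "embedded_submanifold N M"
    and f: "smooth_map P M f" and im: "\<And>p. p \<in> points P \<Longrightarrow> f p \<in> points N"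
  shows "smooth_map P N f"
  unfolding smooth_map_def rep_comp
proof (intro conjI ballI)
  have aN: "atlas N" and top: "mtop N = subtopology (mtop M) (points N)" and \<iota>: "smooth_map N M (\<lambda>p. p)"
    and inj: "\<And>p. p \<in> points N \<Longrightarrow> inj (differential N M (\<lambda>p. p) p)"
    using N by (auto simp: embedded_submanifold_def smooth_manifold_atlas)
  show cont: "continuous_map (mtop P) (mtop N) f"
    using smooth_map_continuous[OF f] im
    by (subst top) (auto simp: continuous_map_in_subtopology)
  fix c d assume c: "c \<in> charts P" and d: "d \<in> charts N"
  show "smooth_on (snd c ` {p \<in> fst c. f p \<in> fst d}) (rep c d f)"
  proof (rule smooth_on_local)
    fix x assume "x \<in> snd c ` {p \<in> fst c. f p \<in> fst d}"
    then obtain p where p: "p \<in> fst c" "f p \<in> fst d" "x = snd c p" by auto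
    have fpN: "f p \<in> points N" using im atlas_chart_subset[OF P c p(1)] .
    have fpM: "f p \<in> points M" using smooth_map_point[OF \<iota> fpN] .
    define e where "e = chart_at M (f p)"
    have e: "e \<in> charts M" "f p \<in> fst e" using chart_at[OF M fpM] by (auto simp: e_def)
    let ?D = "snd d ` {q \<in> fst d. q \<in> fst e}" and ?\<iota> = "rep d e (\<lambda>p. p)"
    have D: "open ?D" "snd d (f p) \<in> ?D"
      using smooth_map_rep_open[OF aN M \<iota> d e(1)] p e by auto
    have s: "smooth_on ?D ?\<iota>" by (rule smooth_map_rep[OF \<iota> d e(1)])
    have k: "chart_at N (f p) \<in> charts N" "f p \<in> fst (chart_at N (f p))" using chart_at[OF aN fpN] by auto
    \<comment> \<open>Injectivity is given in the selected chart of \<open>N\<close>; a change to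
      the chart \<open>d\<close> preserves it, having an inverse.\<close>
    have "inj (dch (chart_at N (f p)) e (\<lambda>p. p) (f p) \<circ> dch d (chart_at N (f p)) (\<lambda>p. p) (f p))"
    proof (rule inj_compose)
      show "inj (dch (chart_at N (f p)) e (\<lambda>p. p) (f p))"
        using inj[OF fpN] by (simp add: differential_dch e_def)
      show "inj (dch d (chart_at N (f p)) (\<lambda>p. p) (f p))"
        by (rule inj_on_inverseI[of _ "dch (chart_at N (f p)) d (\<lambda>p. p) (f p)"])
          (rule dch_transition_inverse[OF aN d p(2) k])
    qed
    moreover have "dch d e (\<lambda>p. p) (f p) =
        (\<lambda>u. dch (chart_at N (f p)) e (\<lambda>p. p) (f p) (dch d (chart_at N (f p)) (\<lambda>p. p) (f p) u))"
      by (rule ext) (rule dch_compose[OF aN aN smooth_map_id[OF aN] \<iota> d p(2) k e])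
    ultimately have "inj (frechet_derivative ?\<iota> (at (snd d (f p))))"
      by (simp add: dch_def[symmetric] o_def)
    note im_lift = immersion_smooth_lift[OF fd_atlas[OF aN] fd_atlas[OF M] D s this,
        where 'a = 'u]
    obtain V where V: "open V" "snd d (f p) \<in> V" "V \<subseteq> ?D"
      and lift: "\<And>W (\<phi> :: 'u \<Rightarrow> 'v). \<lbrakk>open W; \<phi> ` W \<subseteq> V; smooth_on W (\<lambda>x. ?\<iota> (\<phi> x))\<rbrakk> \<Longrightarrow> smooth_on W \<phi>"
      by (rule im_lift) (rule that, assumption+)
    let ?U = "{q \<in> fst d. snd d q \<in> V}"
    let ?W = "snd c ` {p \<in> fst c. f p \<in> ?U}"
    have W: "open ?W"
      by (rule smooth_map_open_domain[OF P c cont chart_open_preimage[OF atlas_chart[OF aN d] V(1)]])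
    have Ue: "q \<in> fst e" if "q \<in> ?U" for q
      using that V(3) chart_of_inj[OF atlas_chart[OF aN d]] by (auto dest!: subsetD simp: inj_on_def)
    have "smooth_on ?W (rep c e f)"
      by (rule smooth_on_subset[OF smooth_map_rep[OF f c e(1)]]) (use Ue in auto)
    then have "smooth_on ?W (\<lambda>x. ?\<iota> (rep c d f x))"
      by (rule smooth_on_cong[OF W]) (auto simp: rep_def atlas_inv[OF P c] atlas_inv[OF aN d])
    then have "smooth_on ?W (rep c d f)"
      by (rule lift[OF W, rotated]) (auto simp: rep_def atlas_inv[OF P c])
    then show "\<exists>T. open T \<and> x \<in> T \<and> smooth_on T (rep c d f)"
      using W p V(2) by (intro exI[of _ ?W]) auto
  qed
qed

subsection \<open>Slices of maps on a product\<close>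

lemma product_rep:
  assumes "atlas M" "atlas N" "c \<in> charts M" "d \<in> charts N" "p \<in> fst c" "q \<in> fst d"
  shows "rep (prod_chart c d) e F (snd c p, snd d q) = snd e (F (p, q))"
  using prod_chart_inv[OF atlas_chart[OF assms(1,3)] atlas_chart[OF assms(2,4)], of "snd c p" "snd d q"] assms
  by (simp add: rep_def atlas_inv[OF assms(1,3)] atlas_inv[OF assms(2,4)])

lemma smooth_map_slice1:
  assumes "atlas M" "atlas N" "atlas P" "smooth_map (product_manifold M N) P F" "q \<in> points N"
  shows "smooth_map M P (\<lambda>p. F (p, q))"
  by (rule smooth_map_compose[OF assms(1) atlas_product[OF assms(1,2)] assms(3) smooth_map_Pair[OF assms(1) assms(1,2)
          smooth_map_id[OF assms(1)] smooth_map_const[OF assms(1,2,5)]] assms(4)])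

lemma smooth_map_slice2:
  assumes "atlas M" "atlas N" "atlas P" "smooth_map (product_manifold M N) P F" "p \<in> points M"
  shows "smooth_map N P (\<lambda>q. F (p, q))"
  by (rule smooth_map_compose[OF assms(2) atlas_product[OF assms(1,2)] assms(3) smooth_map_Pair[OF assms(2) assms(1,2)
          smooth_map_const[OF assms(2,1,5)] smooth_map_id[OF assms(2)]] assms(4)])

context
  fixes M :: "('a, 'e::real_inner) manifold" and N :: "('b, 'f::real_inner) manifold" and P :: "('c, 'h::real_inner) manifold"
    and F :: "'a \<times> 'b \<Rightarrow> 'c" and c d e
  assumes M: "atlas M" and N: "atlas N" and P: "atlas P" and F: "smooth_map (product_manifold M N) P F"
    and c: "c \<in> charts M" and d: "d \<in> charts N" and e: "e \<in> charts P"
begin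

text \<open>The open set of coordinate pairs on which the representation of \<open>F\<close> is
  smooth. The differentials of the slices of \<open>F\<close> are partial derivatives of that one
  representation, which makes its mixed second derivatives available.\<close>

definition product_domain where
  "product_domain = snd (prod_chart c d) ` {z \<in> fst (prod_chart c d). F z \<in> fst e}"

lemma product_domainI: "p \<in> fst c \<Longrightarrow> q \<in> fst d \<Longrightarrow> F (p, q) \<in> fst e \<Longrightarrow> (snd c p, snd d q) \<in> product_domain"
  unfolding product_domain_def by (rule image_eqI[of _ _ "(p, q)"]) auto

lemma product_domain_open: "open product_domain"
  unfolding product_domain_def by (rule smooth_map_rep_open[OF atlas_product[OF M N] P F prod_charts[OF c d] e])

lemma product_rep_smooth: "smooth_on product_domain (rep (prod_chart c d) e F)"
  unfolding product_domain_def by (rule smooth_map_rep[OF F prod_charts[OF c d] e])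

lemma product_rep_has_derivative:
  assumes "p \<in> fst c" "q \<in> fst d" "F (p, q) \<in> fst e"
  shows "(rep (prod_chart c d) e F has_derivative
    frechet_derivative (rep (prod_chart c d) e F) (at (snd c p, snd d q))) (at (snd c p, snd d q))"
  by (rule smooth_on_has_derivative[OF product_rep_smooth product_domainI[OF assms]])

lemma dch_slice1:
  assumes p: "p \<in> fst c" "q \<in> fst d" "F (p, q) \<in> fst e"
  shows "dch c e (\<lambda>p. F (p, q)) p u = frechet_derivative (rep (prod_chart c d) e F) (at (snd c p, snd d q)) (u, 0)"
proof -
  have "((\<lambda>x. (x, snd d q)) has_derivative (\<lambda>u. (u, 0))) (at (snd c p))"
    by (intro derivative_eq_intros) auto
  from has_derivative_compose[OF this product_rep_has_derivative[OF p]]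
  have "(rep c e (\<lambda>p. F (p, q)) has_derivative
      (\<lambda>u. frechet_derivative (rep (prod_chart c d) e F) (at (snd c p, snd d q)) (u, 0))) (at (snd c p))"
    by (rule has_derivative_transform_within_open[OF _ atlas_chart_open[OF M c]])
      (use p in \<open>auto simp: product_rep[OF M N c d] rep_def[of c] atlas_inv[OF M c]\<close>)
  from fun_cong[OF frechet_derivative_at[OF this], of u] show ?thesis by (simp add: dch_def)
qed

lemma dch_slice2:
  assumes p: "p \<in> fst c" "q \<in> fst d" "F (p, q) \<in> fst e"
  shows "dch d e (\<lambda>q. F (p, q)) q u = frechet_derivative (rep (prod_chart c d) e F) (at (snd c p, snd d q)) (0, u)"
proof -
  have "((\<lambda>x. (snd c p, x)) has_derivative (\<lambda>u. (0, u))) (at (snd d q))"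
    by (intro derivative_eq_intros) auto
  from has_derivative_compose[OF this product_rep_has_derivative[OF p]]
  have "(rep d e (\<lambda>q. F (p, q)) has_derivative
      (\<lambda>u. frechet_derivative (rep (prod_chart c d) e F) (at (snd c p, snd d q)) (0, u))) (at (snd d q))"
    by (rule has_derivative_transform_within_open[OF _ atlas_chart_open[OF N d]])
      (use p in \<open>auto simp: product_rep[OF M N c d] rep_def[of d] atlas_inv[OF N d]\<close>)
  from fun_cong[OF frechet_derivative_at[OF this], of u] show ?thesis by (simp add: dch_def)
qed

text \<open>With \<open>p\<close> the unit of the group and \<open>w\<close> a group direction this
  is the smoothness of a fundamental field.\<close>

lemma slice_derivative_smooth2:
  assumes p: "p \<in> fst c" and S: "open S" "\<And>y. y \<in> S \<Longrightarrow> (snd c p, y) \<in> product_domain"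
  shows "smooth_on S (\<lambda>y. frechet_derivative (rep (prod_chart c d) e F) (at (snd c p, y)) w)"
  by (rule smooth_on_compose[OF finite_dimensional_prod[OF fd_atlas[OF M] fd_atlas[OF N]]
      S(1) product_domain_open smooth_on_Pair[OF fd_atlas[OF M] fd_atlas[OF N] S(1)
        smooth_on_const[OF S(1)] smooth_on_id[OF S(1)]] smooth_on_derivative[OF product_rep_smooth]]) (use S in auto)

end

section \<open>Vector fields, metrics and connections\<close>

lemma smooth_fun_const: "atlas M \<Longrightarrow> smooth_fun M (\<lambda>p. r)"
  unfolding smooth_fun_def o_def by (auto intro: smooth_on_const atlas_chart_open)

lemma smooth_fun_cong:
  assumes M: "atlas M" and f: "smooth_fun M f" and eq: "\<And>p. p \<in> points M \<Longrightarrow> f p = g p"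
  shows "smooth_fun M g"
  unfolding smooth_fun_def
proof
  fix c assume c: "c \<in> charts M"
  show "smooth_on (snd c ` fst c) (g \<circ> chart_inv c)"
    by (rule smooth_on_cong[OF atlas_chart_open[OF M c], of "f \<circ> chart_inv c"])
      (use f c in \<open>auto simp: smooth_fun_def eq atlas_inv[OF M c] atlas_chart_subset[OF M c]\<close>)
qed

lemma smooth_fun_has_derivative:
  assumes M: "atlas M" and f: "smooth_fun M f" and p: "p \<in> points M"
  shows "((\<lambda>x. f (chart_inv (chart_at M p) x)) has_derivative fun_differential M f p) (at (coord_at M p p))"
  using smooth_on_has_derivative[of "coord_at M p ` fst (chart_at M p)" "f \<circ> chart_inv (chart_at M p)" "coord_at M p p"]
    f chart_at[OF M p] by (auto simp: smooth_fun_def fun_differential_def o_def)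

lemma fun_differential_const: "fun_differential M (\<lambda>p. r) p = (\<lambda>v. 0)"
  by (simp add: fun_differential_def o_def)

lemma fun_differential_compose:
  assumes M: "atlas M" and N: "atlas N" and F: "smooth_map M N F" and c: "c \<in> charts M" "p \<in> fst c"
    and f: "smooth_fun N f"
  shows "((\<lambda>x. f (F (chart_inv c x))) has_derivative
    (\<lambda>u. fun_differential N f (F p) (dch c (chart_at N (F p)) F p u))) (at (snd c p))"
proof -
  have q: "F p \<in> points N" using smooth_map_point[OF F] atlas_chart_subset[OF M c] by blast
  show ?thesis
    by (rule has_derivative_chart_compose[OF M N F c chart_at[OF N q] smooth_fun_has_derivative[OF N f q]])
qed

lemma field_rep_chart:
  "atlas M \<Longrightarrow> c \<in> charts M \<Longrightarrow> p \<in> fst c \<Longrightarrow> field_rep M c X (snd c p) = to_chart M c p (X p)"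
  by (simp add: field_rep_def atlas_inv)

lemma smooth_fieldI:
  assumes "\<And>c. c \<in> charts M \<Longrightarrow> smooth_on (snd c ` fst c) (field_rep M c X)"
  shows "smooth_field M X"
  using assms by (simp add: smooth_field_def)

lemma smooth_field_rep: "smooth_field M X \<Longrightarrow> c \<in> charts M \<Longrightarrow> smooth_on (snd c ` fst c) (field_rep M c X)"
  by (simp add: smooth_field_def)

lemma smooth_field_cong:
  assumes M: "atlas M" and X: "smooth_field M X" and eq: "\<And>p. p \<in> points M \<Longrightarrow> X p = Y p"
  shows "smooth_field M Y"
proof (rule smooth_fieldI)
  fix c assume c: "c \<in> charts M"
  show "smooth_on (snd c ` fst c) (field_rep M c Y)"
    by (rule smooth_on_cong[OF atlas_chart_open[OF M c] smooth_field_rep[OF X c]])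
      (auto simp: field_rep_chart[OF M c] eq atlas_chart_subset[OF M c])
qed

lemma smooth_field_zero:
  assumes M: "atlas M" shows "smooth_field M (\<lambda>p. 0)"
proof (rule smooth_fieldI)
  fix c assume c: "c \<in> charts M"
  show "smooth_on (snd c ` fst c) (field_rep M c (\<lambda>p. 0))"
    by (rule smooth_on_cong[OF atlas_chart_open[OF M c] smooth_on_const[OF atlas_chart_open[OF M c]], of 0])
      (auto simp: field_rep_chart[OF M c] linear_0[OF to_chart_linear[OF M c]])
qed

lemma smooth_field_add:
  assumes M: "atlas M" and X: "smooth_field M X" and Y: "smooth_field M Y"
  shows "smooth_field M (\<lambda>p. X p + Y p)"
proof (rule smooth_fieldI)
  fix c assume c: "c \<in> charts M"
  show "smooth_on (snd c ` fst c) (field_rep M c (\<lambda>p. X p + Y p))"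
    by (rule smooth_on_cong[OF atlas_chart_open[OF M c] smooth_on_add[OF atlas_chart_open[OF M c]
        smooth_field_rep[OF X c] smooth_field_rep[OF Y c]]])
      (auto simp: field_rep_chart[OF M c] linear_add[OF to_chart_linear[OF M c]])
qed

lemma smooth_field_scaleR:
  assumes M: "atlas M" and f: "smooth_fun M f" and X: "smooth_field M X"
  shows "smooth_field M (\<lambda>p. f p *\<^sub>R X p)"
proof (rule smooth_fieldI)
  fix c assume c: "c \<in> charts M"
  have "smooth_on (snd c ` fst c) (f \<circ> chart_inv c)" using f c by (simp add: smooth_fun_def)
  from smooth_on_scaleR[OF atlas_chart_open[OF M c] this smooth_field_rep[OF X c]]
  show "smooth_on (snd c ` fst c) (field_rep M c (\<lambda>p. f p *\<^sub>R X p))"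
    by (rule smooth_on_cong[OF atlas_chart_open[OF M c]])
      (auto simp: field_rep_chart[OF M c] atlas_inv[OF M c] linear_cmul[OF to_chart_linear[OF M c]])
qed

lemma smooth_field_sum:
  assumes M: "atlas M" and I: "finite I" and f: "\<And>i. i \<in> I \<Longrightarrow> smooth_fun M (f i)" "\<And>i. i \<in> I \<Longrightarrow> smooth_field M (E i)"
  shows "smooth_field M (\<lambda>p. \<Sum>i\<in>I. f i p *\<^sub>R E i p)"
  using I f
proof (induction I)
  case empty
  show ?case using smooth_field_zero[OF M] by simp
next
  case (insert i I)
  have "smooth_field M (\<lambda>p. f i p *\<^sub>R E i p + (\<Sum>i\<in>I. f i p *\<^sub>R E i p))"
    by (rule smooth_field_add[OF M smooth_field_scaleR[OF M] insert.IH]) (use insert.prems in auto)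
  then show ?case using insert.hyps by simp
qed

section \<open>Metrics evaluated on vector fields\<close>

lemma riemannian_metric_inner_form: "riemannian_metric M g \<Longrightarrow> p \<in> points M \<Longrightarrow> inner_form (g p)"
  unfolding riemannian_metric_def inner_form_def by blast

lemma inner_formD:
  assumes "inner_form g"
  shows "bilinear g" "g u v = g v u" "u \<noteq> 0 \<Longrightarrow> g u u > 0" "linear (g u)" "linear (\<lambda>u. g u v)"
  using assms by (auto simp: inner_form_def bilinear_def)

lemma has_derivative_bilinear:
  fixes f k :: "'a::real_normed_vector \<Rightarrow> 'b::real_inner" and g :: "'b \<Rightarrow> 'b \<Rightarrow> real"
  assumes fd: "finite_dimensional TYPE('b)" and g: "inner_form g"
    and f: "(f has_derivative f') (at x)" and k: "(k has_derivative k') (at x)"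
  shows "((\<lambda>y. g (f y) (k y)) has_derivative (\<lambda>u. g (f' u) (k x) + g (f x) (k' u))) (at x)"
proof -
  have "((\<lambda>y. g (f y) v) has_derivative (\<lambda>u. g (f' u) v)) (at x)" for v
    by (rule bounded_linear.has_derivative[OF fd_bounded_linear[OF fd inner_formD(5)[OF g]] f])
  from has_derivative_apply[where A = "\<lambda>y v. g (f y) v", OF fd open_UNIV UNIV_I inner_formD(4)[OF g] this k]
  show ?thesis .
qed

lemma metric_rep_chart:
  assumes "atlas M" "c \<in> charts M" "p \<in> fst c"
  shows "metric_rep M g c (snd c p) (to_chart M c p u) (to_chart M c p v) = g p u v"
  by (simp add: metric_rep_def atlas_inv[OF assms] to_from_chart[OF assms])

lemma metric_rep_linear:
  assumes M: "atlas M" and g: "riemannian_metric M g" and c: "c \<in> charts M" "x \<in> snd c ` fst c"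
  shows "linear (metric_rep M g c x u)" "linear (\<lambda>u. metric_rep M g c x u v)"
proof -
  obtain p where p: "p \<in> fst c" "x = snd c p" using c(2) by auto
  have l: "linear (from_chart M c p)" by (rule from_chart_linear[OF M c(1) p(1)])
  note g = inner_formD[OF riemannian_metric_inner_form[OF g atlas_chart_subset[OF M c(1) p(1)]]]
  show "linear (metric_rep M g c x u)" "linear (\<lambda>u. metric_rep M g c x u v)"
    using linear_compose[OF l g(4)] linear_compose[OF l g(5)]
    by (simp_all add: metric_rep_def[abs_def] p atlas_inv[OF M c(1)] o_def)
qed

lemma metric_rep_smooth:
  "riemannian_metric M g \<Longrightarrow> c \<in> charts M \<Longrightarrow> smooth_on (snd c ` fst c) (\<lambda>x. metric_rep M g c x u v)"
  by (simp add: riemannian_metric_def)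

lemma metric_fields_rep_smooth:
  assumes M: "atlas M" and g: "riemannian_metric M g" and X: "smooth_field M X" and Y: "smooth_field M Y" and c: "c \<in> charts M"
  shows "smooth_on (snd c ` fst c) (\<lambda>x. metric_rep M g c x (field_rep M c X x) (field_rep M c Y x))"
proof -
  note op = atlas_chart_open[OF M c] and fd = fd_atlas[OF M]
  have "smooth_on (snd c ` fst c) (\<lambda>x. metric_rep M g c x u (field_rep M c Y x))" for u
    by (rule smooth_on_apply[OF fd op metric_rep_linear(1)[OF M g c] metric_rep_smooth[OF g c] smooth_field_rep[OF Y c]])
  then show ?thesis
    by (intro smooth_on_apply[OF fd op _ _ smooth_field_rep[OF X c],
          where A = "\<lambda>x u. metric_rep M g c x u (field_rep M c Y x)"] metric_rep_linear(2)[OF M g c])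
qed

lemma smooth_fun_metric:
  assumes M: "atlas M" and g: "riemannian_metric M g" and X: "smooth_field M X" and Y: "smooth_field M Y"
  shows "smooth_fun M (\<lambda>p. g p (X p) (Y p))"
  unfolding smooth_fun_def
proof
  fix c assume c: "c \<in> charts M"
  show "smooth_on (snd c ` fst c) ((\<lambda>p. g p (X p) (Y p)) \<circ> chart_inv c)"
    by (rule smooth_on_cong[OF atlas_chart_open[OF M c] metric_fields_rep_smooth[OF M g X Y c]])
      (auto simp: field_rep_chart[OF M c] metric_rep_chart[OF M c] atlas_inv[OF M c])
qed

text \<open>The product rule for the three factors metric, \<open>X\<close> and \<open>Y\<close>. In
  the chart selected at \<open>p\<close> tangent vectors at \<open>p\<close> are their own
  coordinates, so no conversion remains.\<close>

lemma metric_fields_derivative: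
  assumes M: "atlas M" and g: "riemannian_metric M g" and X: "smooth_field M X" and Y: "smooth_field M Y" and p: "p \<in> points M"
  defines "c \<equiv> chart_at M p"
  defines "x \<equiv> snd c p"
  shows "fun_differential M (\<lambda>q. g q (X q) (Y q)) p u =
    frechet_derivative (\<lambda>y. metric_rep M g c y (X p) (Y p)) (at x) u +
    g p (frechet_derivative (field_rep M c X) (at x) u) (Y p) +
    g p (X p) (frechet_derivative (field_rep M c Y) (at x) u)"
proof -
  have c: "c \<in> charts M" "p \<in> fst c" using chart_at[OF M p] by (auto simp: c_def)
  note op = atlas_chart_open[OF M c(1)] and fd = fd_atlas[OF M]
  have x: "x \<in> snd c ` fst c" using c(2) by (simp add: x_def)
  have Xp: "field_rep M c X x = X p" "field_rep M c Y x = Y p"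
    using field_rep_chart[OF M c] to_chart_self[OF M p] by (simp_all add: x_def c_def)
  have gp: "metric_rep M g c x u v = g p u v" for u v
    using from_chart_self[OF M p] c by (simp add: metric_rep_def x_def c_def atlas_inv[OF M])
  note dX = smooth_on_has_derivative[OF smooth_field_rep[OF X c(1)] x]
  note dY = smooth_on_has_derivative[OF smooth_field_rep[OF Y c(1)] x]
  note dg = smooth_on_has_derivative[OF metric_rep_smooth[OF g c(1)] x]
  let ?G = "metric_rep M g c" and ?X = "field_rep M c X" and ?Y = "field_rep M c Y"
  have 1: "((\<lambda>y. ?G y v (?Y y)) has_derivative
      (\<lambda>u. frechet_derivative (\<lambda>y. ?G y v (Y p)) (at x) u + g p v (frechet_derivative ?Y (at x) u))) (at x)" for v
    using has_derivative_apply[OF fd op x metric_rep_linear(1)[OF M g c(1)] dg dY, of v] by (simp add: Xp gp)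
  have "((\<lambda>y. ?G y (?X y) (?Y y)) has_derivative
      (\<lambda>u. frechet_derivative (\<lambda>y. ?G y (X p) (Y p)) (at x) u + g p (X p) (frechet_derivative ?Y (at x) u) +
        g p (frechet_derivative ?X (at x) u) (Y p))) (at x)"
    using has_derivative_apply[where A = "\<lambda>y v. ?G y v (?Y y)", OF fd op x metric_rep_linear(2)[OF M g c(1)] 1 dX] by (simp add: Xp gp)
  then have "((\<lambda>y. g (chart_inv c y) (X (chart_inv c y)) (Y (chart_inv c y))) has_derivative
      (\<lambda>u. frechet_derivative (\<lambda>y. ?G y (X p) (Y p)) (at x) u + g p (X p) (frechet_derivative ?Y (at x) u) +
        g p (frechet_derivative ?X (at x) u) (Y p))) (at x)"
    by (rule has_derivative_transform_within_open[OF _ op x])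
      (auto simp: field_rep_chart[OF M c(1)] metric_rep_chart[OF M c(1)] atlas_inv[OF M c(1)])
  from fun_cong[OF has_derivative_unique[OF this smooth_fun_has_derivative[OF M smooth_fun_metric[OF M g X Y] p,
        folded c_def, folded x_def]], of u]
  show ?thesis by simp
qed

subsection \<open>Connections\<close>

lemma
  assumes D: "affine_connection M D"
  shows connection_add_left: "\<lbrakk>smooth_field M X; smooth_field M X'; smooth_field M Y; p \<in> points M\<rbrakk> \<Longrightarrow>
      D (\<lambda>q. X q + X' q) Y p = D X Y p + D X' Y p"
    and connection_add_right: "\<lbrakk>smooth_field M X; smooth_field M Y; smooth_field M Y'; p \<in> points M\<rbrakk> \<Longrightarrow>
      D X (\<lambda>q. Y q + Y' q) p = D X Y p + D X Y' p"
    and connection_scale_left: "\<lbrakk>smooth_fun M f; smooth_field M X; smooth_field M Y; p \<in> points M\<rbrakk> \<Longrightarrow>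
      D (\<lambda>q. f q *\<^sub>R X q) Y p = f p *\<^sub>R D X Y p"
    and connection_scale_right: "\<lbrakk>smooth_fun M f; smooth_field M X; smooth_field M Y; p \<in> points M\<rbrakk> \<Longrightarrow>
      D X (\<lambda>q. f q *\<^sub>R Y q) p = f p *\<^sub>R D X Y p + fun_differential M f p (X p) *\<^sub>R Y p"
  using D by (simp_all add: affine_connection_def)

text \<open>A connection acts on fields defined on the whole type; the indicator function of the complement
  of the manifold is smooth and shows that the values there do not matter.\<close>

lemma smooth_fun_complement_indicator:
  assumes M: "atlas M"
  shows "smooth_fun M (\<lambda>q. if q \<in> points M then 0 else 1)"
  by (rule smooth_fun_cong[OF M smooth_fun_const[OF M, of 0]]) simp

lemma connection_cong:
  assumes M: "atlas M" and D: "affine_connection M D" and X: "smooth_field M X" and Y: "smooth_field M Y"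
    and eqX: "\<And>q. q \<in> points M \<Longrightarrow> X q = X' q" and eqY: "\<And>q. q \<in> points M \<Longrightarrow> Y q = Y' q" and p: "p \<in> points M"
  shows "D X Y p = D X' Y' p"
proof -
  let ?\<chi> = "\<lambda>q. if q \<in> points M then 0 else 1 :: real"
  note \<chi> = smooth_fun_complement_indicator[OF M]
  have zero: "smooth_field M (\<lambda>q. X' q - X q)" "smooth_field M (\<lambda>q. Y' q - Y q)"
    by (rule smooth_field_cong[OF M smooth_field_zero[OF M]], simp add: eqX eqY)+
  \<comment> \<open>The differences vanish on the manifold, so the factor changes nothing, while the
    scaling rules pull it out at \<open>p\<close>, where it is 0. In the second argument the Leibniz
    term vanishes with \<open>Y' p - Y p\<close>.\<close>
  have ext: "(\<lambda>q. ?\<chi> q *\<^sub>R (X' q - X q)) = (\<lambda>q. X' q - X q)" "(\<lambda>q. ?\<chi> q *\<^sub>R (Y' q - Y q)) = (\<lambda>q. Y' q - Y q)"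
    using eqX eqY by auto
  have X': "smooth_field M X'" by (rule smooth_field_cong[OF M X eqX])
  have "D (\<lambda>q. X' q - X q) Y p = 0"
    using connection_scale_left[OF D \<chi> zero(1) Y p] p unfolding ext by simp
  then have 1: "D X Y p = D X' Y p"
    using connection_add_left[OF D X zero(1) Y p] by simp
  have "D X' (\<lambda>q. Y' q - Y q) p = 0"
    using connection_scale_right[OF D \<chi> X' zero(2) p] p eqY[OF p] unfolding ext by simp
  then show ?thesis
    using connection_add_right[OF D X' Y zero(2) p] 1 by simp
qed

lemma connection_sum_left:
  assumes M: "atlas M" and D: "affine_connection M D" and I: "finite I"
    and f: "\<And>i. i \<in> I \<Longrightarrow> smooth_fun M (f i)" "\<And>i. i \<in> I \<Longrightarrow> smooth_field M (E i)"
    and Y: "smooth_field M Y" and p: "p \<in> points M"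
  shows "D (\<lambda>q. \<Sum>i\<in>I. f i q *\<^sub>R E i q) Y p = (\<Sum>i\<in>I. f i p *\<^sub>R D (E i) Y p)"
  using I f
proof (induction I)
  case empty
  show ?case
    using connection_scale_left[OF D smooth_fun_const[OF M, of 0] smooth_field_zero[OF M] Y p] by simp
next
  case (insert i I)
  then show ?case
    by (simp add: connection_add_left[OF D smooth_field_scaleR[OF M] smooth_field_sum[OF M] Y p]
        connection_scale_left[OF D _ _ Y p])
qed

lemma connection_sum_right:
  assumes M: "atlas M" and D: "affine_connection M D" and I: "finite I"
    and f: "\<And>i. i \<in> I \<Longrightarrow> smooth_fun M (f i)" "\<And>i. i \<in> I \<Longrightarrow> smooth_field M (E i)"
    and X: "smooth_field M X" and p: "p \<in> points M"
  shows "D X (\<lambda>q. \<Sum>i\<in>I. f i q *\<^sub>R E i q) p =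
    (\<Sum>i\<in>I. f i p *\<^sub>R D X (E i) p) + (\<Sum>i\<in>I. fun_differential M (f i) p (X p) *\<^sub>R E i p)"
  using I f
proof (induction I)
  case empty
  show ?case
    using connection_scale_right[OF D smooth_fun_const[OF M, of 0] X smooth_field_zero[OF M] p] by simp
next
  case (insert i I)
  then show ?case
    by (simp add: connection_add_right[OF D X smooth_field_scaleR[OF M] smooth_field_sum[OF M] p]
        connection_scale_right[OF D _ X _ p])
qed

text \<open>Metric compatibility along \<open>X\<close>, \<open>Y\<close> and \<open>Z\<close>, the
  last with a minus sign; vanishing torsion turns the differences of swapped derivatives into
  brackets.\<close>

lemma koszul:
  assumes M: "riemannian_metric M g" and D: "levi_civita M g D"
    and X: "smooth_field M X" and Y: "smooth_field M Y" and Z: "smooth_field M Z" and p: "p \<in> points M"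
  shows "2 * g p (D X Y p) (Z p) =
    fun_differential M (\<lambda>q. g q (Y q) (Z q)) p (X p) + fun_differential M (\<lambda>q. g q (X q) (Z q)) p (Y p) -
    fun_differential M (\<lambda>q. g q (X q) (Y q)) p (Z p) + g p (field_bracket M X Y p) (Z p) -
    g p (field_bracket M X Z p) (Y p) - g p (field_bracket M Y Z p) (X p)"
proof -
  note g = inner_formD[OF riemannian_metric_inner_form[OF M p]]
  have tors: "field_bracket M X Y p = D X Y p - D Y X p" if "smooth_field M X" "smooth_field M Y" for X Y
    using D that p unfolding levi_civita_def by metis
  have met: "fun_differential M (\<lambda>q. g q (Y q) (Z q)) p (X p) = g p (D X Y p) (Z p) + g p (Y p) (D X Z p)"
    if "smooth_field M X" "smooth_field M Y" "smooth_field M Z" for X Y Z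
    using D that p unfolding levi_civita_def by blast
  show ?thesis
    using g(2)[of "Y p" "D X Z p"] g(2)[of "X p" "D Y Z p"] g(2)[of "X p" "D Z Y p"]
    by (simp add: tors met X Y Z bilinear_lsub[OF g(1)])
qed

subsection \<open>Curves\<close>

lemma chart_inv_line: "chart_inv (UNIV, \<lambda>t::real. t) = (\<lambda>t. t)"
  using inv_into_f_f[of "\<lambda>t::real. t" UNIV] by auto

lemma atlas_real_line: "atlas real_line"
proof -
  have "chart_of euclideanreal (UNIV, \<lambda>t::real. t)"
    by (simp add: chart_of_def homeomorphic_map_id[unfolded id_def])
  moreover have "smooth_on UNIV (\<lambda>t::real. t)" by (simp add: smooth_on_id)
  ultimately show ?thesis
    by (simp add: atlas_def real_line_def finite_dimensional_real chart_inv_line o_def)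
qed

lemma real_line_chart: "(UNIV, \<lambda>t. t) \<in> charts real_line"
  by (simp add: real_line_def)

lemma curve_point: "smooth_map real_line M \<gamma> \<Longrightarrow> \<gamma> t \<in> points M"
  by (erule smooth_map_point) (simp add: real_line_def)

text \<open>\<open>f\<close> need only be differentiable at the one point. The rule serves the
  one-parameter groups as well as the given function along an arbitrary geodesic.\<close>

lemma has_vector_derivative_along_curve:
  fixes f :: "'a \<Rightarrow> 'v::real_normed_vector"
  assumes M: "atlas M" and \<gamma>: "smooth_map real_line M \<gamma>"
    and f: "((\<lambda>y. f (chart_inv (chart_at M (\<gamma> t)) y)) has_derivative f') (at (coord_at M (\<gamma> t) (\<gamma> t)))"
  shows "((\<lambda>s. f (\<gamma> s)) has_vector_derivative f' (velocity M \<gamma> t)) (at t)"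
proof -
  let ?L = "(UNIV, \<lambda>t::real. t)" and ?c = "chart_at M (\<gamma> t)"
  have c: "?c \<in> charts M" "\<gamma> t \<in> fst ?c" using chart_at[OF M curve_point[OF \<gamma>]] by auto
  have r: "rep ?L ?c \<gamma> = (\<lambda>s. snd ?c (\<gamma> s))" by (simp add: rep_def chart_inv_line fun_eq_iff)
  have "(rep ?L ?c \<gamma> has_derivative dch ?L ?c \<gamma> t) (at (snd ?L t))"
    using rep_has_derivative[OF \<gamma> real_line_chart c(1), of t] c(2) by simp
  then have diff: "(\<lambda>s. snd ?c (\<gamma> s)) differentiable (at t)" by (auto simp: r differentiable_def)
  have "dch ?L ?c \<gamma> t = (\<lambda>r. r *\<^sub>R velocity M \<gamma> t)"
    unfolding dch_def r velocity_def snd_conv by (rule frechet_derivative_eq_vector_derivative[OF diff])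
  with has_derivative_chart_compose[OF atlas_real_line M \<gamma> real_line_chart _ c f]
  have "((\<lambda>s. f (\<gamma> s)) has_derivative (\<lambda>r. f' (r *\<^sub>R velocity M \<gamma> t))) (at t)" by (simp add: chart_inv_line)
  then show ?thesis
    using has_derivative_linear[OF f] by (simp add: has_vector_derivative_def linear_cmul)
qed

lemma chart_has_derivative_id:
  assumes M: "atlas M" and c: "c \<in> charts M" "p \<in> fst c"
  shows "((\<lambda>y. snd c (chart_inv c y)) has_derivative (\<lambda>v. v)) (at (snd c p))"
  using rep_has_derivative[OF smooth_map_id[OF M] c(1) c(1) c(2) c(2)] dch_id[OF M c] by (simp add: rep_def[abs_def])

section \<open>Orbits\<close>

locale orbit_space =
  fixes S :: "('g, 'e::real_inner, 'm, 'f::real_inner, 'h::real_inner) orbit_data"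
  assumes setting: "orbit_setting S"
begin

abbreviation "G \<equiv> grp S"
abbreviation mult_G (infixl \<open>\<cdot>\<close> 70) where "P \<cdot> Q \<equiv> P \<otimes>\<^bsub>G\<^esub> Q"
abbreviation "MG \<equiv> grp_mf S"
abbreviation "B \<equiv> orb S"
abbreviation "b0 \<equiv> base S"
abbreviation "A b \<equiv> d_orbit_map S b (unit_elt S)"
abbreviation "g1 \<equiv> grp_metric S (unit_elt S)"
abbreviation "h \<equiv> orb_metric S"

lemma lie: "lie_group G MG" and riemannian_G: "riemannian_metric MG (grp_metric S)"
  and riemannian_B: "riemannian_metric B h" and embedded: "embedded_submanifold B (amb S)"
  and orbit_points: "points B = orbit G (act S) b0" and quotient: "carries_quotient_metric S"
  and bi_inv: "bi_invariant G MG (grp_metric S)" and action: "group_action G (points (amb S)) (act S)"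
  and base_point: "b0 \<in> points (amb S)"
  using setting by (auto simp: orbit_setting_def)

sublocale group G using lie by (simp add: lie_group_def)

sublocale action: group_action G "points (amb S)" "act S" by (rule action)

lemma carrier: "carrier G = points MG" using lie by (simp add: lie_group_def)

lemma atlas_G: "atlas MG" and atlas_B: "atlas B" and atlas_amb: "atlas (amb S)"
  using setting by (auto simp: orbit_setting_def lie_group_def embedded_submanifold_def intro: smooth_manifold_atlas)

lemma fd_G: "finite_dimensional TYPE('e)" and fd_B: "finite_dimensional TYPE('h)"
  using atlas_G atlas_B by (auto intro: fd_atlas)

lemma one_point: "unit_elt S \<in> points MG" using one_closed carrier by simp

lemma orbit_pointE:
  assumes "b \<in> points B" obtains Q where "Q \<in> carrier G" "b = act S Q b0"
  using assms by (auto simp: orbit_points orbit_def)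

lemma orbit_subset: "b \<in> points B \<Longrightarrow> b \<in> points (amb S)"
  using action.element_image[OF _ base_point] by (metis orbit_pointE)

lemma act_mult: "P \<in> carrier G \<Longrightarrow> Q \<in> carrier G \<Longrightarrow> b \<in> points B \<Longrightarrow> act S (P \<cdot> Q) b = act S P (act S Q b)"
  using action.composition_rule orbit_subset by blast

lemma act_one: "b \<in> points B \<Longrightarrow> act S (unit_elt S) b = b"
  using action.id_eq_one orbit_subset by (metis restrict_apply')

lemma act_base: "Q \<in> carrier G \<Longrightarrow> act S Q b0 \<in> points B"
  by (auto simp: orbit_points orbit_def)

lemma base_in_orbit: "b0 \<in> points B"
  using act_base[OF one_closed] action.id_eq_one base_point by (metis restrict_apply')

lemma act_closed: "Q \<in> carrier G \<Longrightarrow> b \<in> points B \<Longrightarrow> act S Q b \<in> points B"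
  by (metis orbit_pointE act_mult act_base base_in_orbit m_closed)

lemma act_inv: "Q \<in> carrier G \<Longrightarrow> b \<in> points B \<Longrightarrow> act S (inv\<^bsub>G\<^esub> Q) (act S Q b) = b"
  "Q \<in> carrier G \<Longrightarrow> b \<in> points B \<Longrightarrow> act S Q (act S (inv\<^bsub>G\<^esub> Q) b) = b"
  by (simp_all add: act_one flip: act_mult)

lemma mult_smooth: "smooth_map (product_manifold MG MG) MG (\<lambda>z. fst z \<cdot> snd z)"
  using lie by (simp add: lie_group_def case_prod_unfold)

lemma inv_smooth: "smooth_map MG MG (\<lambda>Q. inv\<^bsub>G\<^esub> Q)"
  using lie by (simp add: lie_group_def)

lemma action_smooth: "smooth_map (product_manifold MG B) B (\<lambda>z. act S (fst z) (snd z))"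
proof (rule smooth_map_into_embedded[OF atlas_product[OF atlas_G atlas_B] atlas_amb embedded])
  have amb: "smooth_map (product_manifold MG (amb S)) (amb S) (\<lambda>z. act S (fst z) (snd z))"
    using setting by (simp add: orbit_setting_def case_prod_unfold)
  have \<iota>: "smooth_map B (amb S) (\<lambda>b. b)" using embedded by (simp add: embedded_submanifold_def)
  note aP = atlas_product[OF atlas_G atlas_B]
  have "smooth_map (product_manifold MG B) (product_manifold MG (amb S)) (\<lambda>z. (fst z, snd z))"
    by (rule smooth_map_Pair[OF aP atlas_G atlas_amb smooth_map_fst[OF atlas_G atlas_B] smooth_map_compose[OF aP atlas_B atlas_amb smooth_map_snd[OF atlas_G atlas_B] \<iota>]])
  from smooth_map_compose[OF aP atlas_product[OF atlas_G atlas_amb] atlas_amb this amb]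
  show "smooth_map (product_manifold MG B) (amb S) (\<lambda>z. act S (fst z) (snd z))" by simp
  show "act S (fst z) (snd z) \<in> points B" if "z \<in> points (product_manifold MG B)" for z
    using that act_closed carrier unfolding prod_manifold_simps(2) by auto
qed

lemma orbit_map_smooth: "b \<in> points B \<Longrightarrow> smooth_map MG B (orbit_map S b)"
  using smooth_map_slice1[OF atlas_G atlas_B atlas_B action_smooth] by (simp add: orbit_map_def[abs_def])

lemma act_smooth: "Q \<in> carrier G \<Longrightarrow> smooth_map B B (act S Q)"
  using smooth_map_slice2[OF atlas_G atlas_B atlas_B action_smooth, of Q] by (simp add: carrier)

lemma left_smooth: "Q \<in> carrier G \<Longrightarrow> smooth_map MG MG (\<lambda>P. Q \<cdot> P)"
  using smooth_map_slice2[OF atlas_G atlas_G atlas_G mult_smooth, of Q] by (simp add: carrier)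

lemma right_smooth: "Q \<in> carrier G \<Longrightarrow> smooth_map MG MG (\<lambda>P. P \<cdot> Q)"
  using smooth_map_slice1[OF atlas_G atlas_G atlas_G mult_smooth, of Q] by (simp add: carrier)

section \<open>The adjoint action\<close>

definition conjugate :: "'g \<Rightarrow> 'g \<Rightarrow> 'g" where "conjugate Q P = Q \<cdot> P \<cdot> inv\<^bsub>G\<^esub> Q"

definition Ad :: "'g \<Rightarrow> 'e \<Rightarrow> 'e" where "Ad Q = differential MG MG (conjugate Q) (unit_elt S)"

lemma conjugate_closed: "Q \<in> carrier G \<Longrightarrow> P \<in> carrier G \<Longrightarrow> conjugate Q P \<in> carrier G"
  by (simp add: conjugate_def)

lemma conjugate_one: "Q \<in> carrier G \<Longrightarrow> conjugate Q (unit_elt S) = unit_elt S"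
  by (simp add: conjugate_def)

lemma conjugate_smooth: "Q \<in> carrier G \<Longrightarrow> smooth_map MG MG (conjugate Q)"
  unfolding conjugate_def[abs_def]
  by (rule smooth_map_compose[OF atlas_G atlas_G atlas_G left_smooth right_smooth]) auto

text \<open>Joint smoothness makes \<open>Ad\<close> of the inverse differentiable in the group
  variable. The inverse is taken because moving \<open>A\<close> from b to Q b brings in
  \<open>Ad (inv Q)\<close>.\<close>

lemma conjugate_inv_smooth: "smooth_map (product_manifold MG MG) MG (\<lambda>z. conjugate (inv\<^bsub>G\<^esub> (fst z)) (snd z))"
proof -
  note aP = atlas_product[OF atlas_G atlas_G]
  note f = smooth_map_fst[OF atlas_G atlas_G] and s = smooth_map_snd[OF atlas_G atlas_G]
  note 1 = smooth_map_compose[OF aP aP atlas_G smooth_map_Pair[OF aP atlas_G atlas_G smooth_map_compose[OF aP atlas_G atlas_G f inv_smooth] s] mult_smooth]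
  from smooth_map_compose[OF aP aP atlas_G smooth_map_Pair[OF aP atlas_G atlas_G 1 f] mult_smooth]
  have "smooth_map (product_manifold MG MG) MG (\<lambda>z. inv\<^bsub>G\<^esub> (fst z) \<cdot> snd z \<cdot> fst z)" by simp
  then show ?thesis
    by (rule smooth_map_cong[OF aP atlas_G]) (auto simp: conjugate_def prod_manifold_simps(2) simp flip: carrier)
qed

lemma Ad_linear: "Q \<in> carrier G \<Longrightarrow> linear (Ad Q)"
  unfolding Ad_def by (rule differential_linear[OF atlas_G atlas_G conjugate_smooth one_point])

lemma Ad_one: "Ad (unit_elt S) u = u"
  using differential_cong[OF atlas_G one_point, of "conjugate (unit_elt S)" "\<lambda>P. P" MG] differential_id[OF atlas_G one_point]
  by (simp add: Ad_def conjugate_def carrier)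

lemma Ad_mult:
  assumes Q: "Q \<in> carrier G" and P: "P \<in> carrier G"
  shows "Ad (Q \<cdot> P) u = Ad Q (Ad P u)"
proof -
  have "differential MG MG (conjugate (Q \<cdot> P)) (unit_elt S) = differential MG MG (\<lambda>R. conjugate Q (conjugate P R)) (unit_elt S)"
    by (rule differential_cong[OF atlas_G one_point]) (use Q P in \<open>simp add: conjugate_def carrier[symmetric] inv_mult_group m_assoc\<close>)
  then show ?thesis
    using differential_compose[OF atlas_G atlas_G atlas_G conjugate_smooth[OF P] conjugate_smooth[OF Q] one_point, of u]
    by (simp add: Ad_def conjugate_one[OF P])
qed

lemma Ad_inv:
  assumes "Q \<in> carrier G"
  shows "Ad Q (Ad (inv\<^bsub>G\<^esub> Q) u) = u" "Ad (inv\<^bsub>G\<^esub> Q) (Ad Q u) = u"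
  using assms by (simp_all add: Ad_one flip: Ad_mult)

text \<open>Differentiates \<open>Q P = (Q P inv Q) Q\<close> in P at the unit.\<close>

lemma right_Ad:
  assumes Q: "Q \<in> carrier G"
  shows "differential MG MG (\<lambda>P. P \<cdot> Q) (unit_elt S) (Ad Q u) = differential MG MG (\<lambda>P. Q \<cdot> P) (unit_elt S) u"
proof -
  have "differential MG MG (\<lambda>P. Q \<cdot> P) (unit_elt S) = differential MG MG (\<lambda>P. conjugate Q P \<cdot> Q) (unit_elt S)"
    by (rule differential_cong[OF atlas_G one_point]) (use Q in \<open>simp add: conjugate_def carrier[symmetric] m_assoc\<close>)
  then show ?thesis
    using differential_compose[OF atlas_G atlas_G atlas_G conjugate_smooth[OF Q] right_smooth[OF Q] one_point, of u]
    by (simp add: Ad_def conjugate_one[OF Q])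
qed

lemma left_isometry:
  assumes Q: "Q \<in> carrier G" and P: "P \<in> carrier G"
  shows "grp_metric S (Q \<cdot> P) (differential MG MG (\<lambda>P. Q \<cdot> P) P u) (differential MG MG (\<lambda>P. Q \<cdot> P) P v) = grp_metric S P u v"
  using bi_inv Q P by (simp add: bi_invariant_def isometry_def carrier)

lemma right_isometry:
  assumes Q: "Q \<in> carrier G" and P: "P \<in> carrier G"
  shows "grp_metric S (P \<cdot> Q) (d_right S Q P u) (d_right S Q P v) = grp_metric S P u v"
  using bi_inv Q P by (simp add: bi_invariant_def isometry_def carrier d_right_def)

text \<open>Bi-invariance: \<open>right_Ad\<close> expresses left translation as right translation
  after \<open>Ad Q\<close>, and both translations are isometries.\<close>

lemma Ad_isometry:
  assumes Q: "Q \<in> carrier G"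
  shows "g1 (Ad Q u) (Ad Q v) = g1 u v"
  using right_isometry[OF Q one_closed, of "Ad Q u" "Ad Q v"] left_isometry[OF Q one_closed, of u v]
  using Q by (simp add: d_right_def right_Ad)

lemma A_linear: "b \<in> points B \<Longrightarrow> linear (A b)"
  unfolding d_orbit_map_def by (rule differential_linear[OF atlas_G atlas_B orbit_map_smooth one_point])

lemma d_act_linear: "Q \<in> carrier G \<Longrightarrow> b \<in> points B \<Longrightarrow> linear (d_act S Q b)"
  unfolding d_act_def by (rule differential_linear[OF atlas_B atlas_B act_smooth])

lemma d_act_inv:
  assumes Q: "Q \<in> carrier G" and b: "b \<in> points B"
  shows "d_act S Q b (d_act S (inv\<^bsub>G\<^esub> Q) (act S Q b) v) = v" and "d_act S (inv\<^bsub>G\<^esub> Q) (act S Q b) (d_act S Q b v) = v"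
  unfolding d_act_def
  using differential_inverse[OF atlas_B atlas_B act_smooth[OF inv_closed[OF Q]] act_smooth[OF Q] act_closed[OF Q b], of v]
    differential_inverse[OF atlas_B atlas_B act_smooth[OF Q] act_smooth[OF inv_closed[OF Q]] b, of v] Q b
  by (simp_all add: act_inv)

text \<open>Differentiates \<open>Q (P b) = (Q P inv Q) (Q b)\<close> in P at the unit.\<close>

lemma d_act_A:
  assumes Q: "Q \<in> carrier G" and b: "b \<in> points B"
  shows "d_act S Q b (A b u) = A (act S Q b) (Ad Q u)"
proof -
  note Qb = act_closed[OF Q b]
  have "differential MG B (\<lambda>P. act S Q (orbit_map S b P)) (unit_elt S) =
      differential MG B (\<lambda>P. orbit_map S (act S Q b) (conjugate Q P)) (unit_elt S)"
    by (rule differential_cong[OF atlas_G one_point])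
      (use Q b in \<open>simp add: conjugate_def orbit_map_def carrier[symmetric] m_assoc flip: act_mult\<close>)
  then show ?thesis
    using differential_compose[OF atlas_G atlas_B atlas_B orbit_map_smooth[OF b] act_smooth[OF Q] one_point, of u]
      differential_compose[OF atlas_G atlas_G atlas_B conjugate_smooth[OF Q] orbit_map_smooth[OF Qb] one_point, of u]
    by (simp add: d_act_def d_orbit_map_def Ad_def conjugate_one[OF Q] orbit_map_def act_one[OF b])
qed

lemma A_act:
  assumes Q: "Q \<in> carrier G" and b: "b \<in> points B"
  shows "A (act S Q b) u = d_act S Q b (A b (Ad (inv\<^bsub>G\<^esub> Q) u))"
  by (simp add: d_act_A[OF Q b] Ad_inv[OF Q])

subsection \<open>The Lie bracket as the derivative of the adjoint action\<close>

abbreviation "c1 \<equiv> chart_at MG (unit_elt S)"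
abbreviation "x1 \<equiv> snd c1 (unit_elt S)"
abbreviation "bracket \<equiv> lie_bracket G MG"

lemma c1: "c1 \<in> charts MG" "unit_elt S \<in> fst c1"
  using chart_at[OF atlas_G one_point] by auto

lemma x1: "x1 \<in> snd c1 ` fst c1" using c1 by auto

lemmas c1_inv = atlas_inv[OF atlas_G c1(1)] and c1_open = atlas_chart_open[OF atlas_G c1(1)]

lemma c1_carrier: "Q \<in> fst c1 \<Longrightarrow> Q \<in> carrier G"
  using atlas_chart_subset[OF atlas_G c1(1)] carrier by simp

lemma bracket_antisym: "bracket u v = - bracket v u"
  by (simp add: lie_bracket_def field_bracket_def Let_def)

text \<open>In a chart, \<open>L Q (Ad (inv Q) z) = R Q z\<close> for the differentials of the translations at the unit;
  differentiate this in \<open>Q\<close> and use the symmetry of the second derivative of the multiplication.\<close>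

lemma Ad_inv_derivative:
  "((\<lambda>x. Ad (inv\<^bsub>G\<^esub> (chart_inv c1 x)) z) has_derivative (\<lambda>u. - bracket u z)) (at x1)"
proof -
  note op = c1_open
  let ?C = "snd c1 ` fst c1"
  define M where "M = rep (prod_chart c1 c1) c1 (\<lambda>z. fst z \<cdot> snd z)"
  define K where "K = rep (prod_chart c1 c1) c1 (\<lambda>z. conjugate (inv\<^bsub>G\<^esub> (fst z)) (snd z))"
  define DM where "DM w z = frechet_derivative M (at z) w" for w z
  \<comment> \<open>\<open>L x\<close> and \<open>R x\<close> are the differentials at the unit of
    left and right translation by the element with coordinates x, and \<open>N x\<close> is
    \<open>Ad\<close> of its inverse. All are partial derivatives of \<open>M\<close> and
    \<open>K\<close>.\<close>
  define L where "L x v = DM (0, v) (x, x1)" for x v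
  define R where "R x v = DM (v, 0) (x1, x)" for x v
  define N where "N x v = frechet_derivative K (at (x, x1)) (0, v)" for x v
  define D where "D = product_domain (\<lambda>z. fst z \<cdot> snd z) c1 c1 c1"
  define D' where "D' = product_domain (\<lambda>z. conjugate (inv\<^bsub>G\<^esub> (fst z)) (snd z)) c1 c1 c1"
  note mult = atlas_G atlas_G atlas_G mult_smooth c1(1) c1(1) c1(1)
  note cnj = atlas_G atlas_G atlas_G conjugate_inv_smooth c1(1) c1(1) c1(1)
  have D: "open D" "smooth_on D M" "(x1, x1) \<in> D"
    using product_domain_open[OF mult] product_rep_smooth[OF mult] product_domainI[OF mult c1(2) c1(2)] c1(2)
    by (auto simp: D_def M_def)
  have D': "open D'" "smooth_on D' K" "(x1, x1) \<in> D'"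
    using product_domain_open[OF cnj] product_rep_smooth[OF cnj] product_domainI[OF cnj c1(2) c1(2)] c1(2)
    by (auto simp: D'_def K_def conjugate_one)
  have L: "dch c1 c1 (\<lambda>P. Q \<cdot> P) (unit_elt S) v = L (snd c1 Q) v" if Q: "Q \<in> fst c1" for Q v
    using dch_slice2[OF mult Q c1(2), of v] Q c1_carrier[OF Q] by (simp add: L_def DM_def M_def)
  have R: "dch c1 c1 (\<lambda>P. P \<cdot> Q) (unit_elt S) v = R (snd c1 Q) v" if Q: "Q \<in> fst c1" for Q v
    using dch_slice1[OF mult c1(2) Q, of v] Q c1_carrier[OF Q] by (simp add: R_def DM_def M_def)
  have N: "dch c1 c1 (conjugate (inv\<^bsub>G\<^esub> Q)) (unit_elt S) v = N (snd c1 Q) v" if Q: "Q \<in> fst c1" for Q v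
    using dch_slice2[OF cnj Q c1(2), of v] c1_carrier[OF Q] c1(2) by (simp add: N_def K_def conjugate_one)
  have N_Ad: "N (snd c1 Q) v = Ad (inv\<^bsub>G\<^esub> Q) v" if Q: "Q \<in> fst c1" for Q v
    using N[OF Q, of v] c1_carrier[OF Q] by (simp add: Ad_def differential_dch conjugate_one)
  have lin: "linear (L x)" if x: "x \<in> ?C" for x
  proof -
    obtain Q where Q: "Q \<in> fst c1" "x = snd c1 Q" using x by auto
    have "linear (dch c1 c1 (\<lambda>P. Q \<cdot> P) (unit_elt S))"
      by (rule dch_linear[OF left_smooth[OF c1_carrier[OF Q(1)]] c1(1) c1(1) c1(2)]) (use Q c1_carrier[OF Q(1)] in simp)
    moreover have "dch c1 c1 (\<lambda>P. Q \<cdot> P) (unit_elt S) = L x" using L[OF Q(1)] Q(2) by auto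
    ultimately show ?thesis by simp
  qed
  have LN: "L x (N x v) = R x v" if x: "x \<in> ?C" for x v
  proof -
    obtain Q where Q: "Q \<in> fst c1" "x = snd c1 Q" using x by auto
    note Qc = c1_carrier[OF Q(1)]
    have "dch c1 c1 (\<lambda>P. P \<cdot> Q) (unit_elt S) = dch c1 c1 (\<lambda>P. Q \<cdot> conjugate (inv\<^bsub>G\<^esub> Q) P) (unit_elt S)"
      by (rule dch_cong[OF atlas_G c1]) (use Qc in \<open>simp add: conjugate_def carrier[symmetric] flip: m_assoc\<close>)
    then have "R x v = dch c1 c1 (\<lambda>P. Q \<cdot> conjugate (inv\<^bsub>G\<^esub> Q) P) (unit_elt S) v"
      using R[OF Q(1), of v] Q(2) by simp
    also have "\<dots> = L x (N x v)"
      using dch_compose[OF atlas_G atlas_G conjugate_smooth[OF inv_closed[OF Qc]] left_smooth[OF Qc] c1 c1(1) _ c1(1), of v]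
        Q Qc c1(2) by (simp add: conjugate_one L[OF Q(1)] N[OF Q(1)])
    finally show ?thesis ..
  qed
  have N1: "N x1 v = v" for v using N_Ad[OF c1(2), of v] by (simp add: Ad_one)
  \<comment> \<open>The mixed second derivative of the multiplication at the unit, first factor in
    direction u and second in direction v; its antisymmetric part is the bracket.\<close>
  define \<beta> where "\<beta> u v = frechet_derivative (DM (0, v)) (at (x1, x1)) (u, 0)" for u v
  have pair1: "((\<lambda>x. (x, x1)) has_derivative (\<lambda>u. (u, 0))) (at x1)"
    and pair2: "((\<lambda>x. (x1, x)) has_derivative (\<lambda>u. (0, u))) (at x1)"
    by (rule has_derivative_Pair[OF has_derivative_ident has_derivative_const]
        has_derivative_Pair[OF has_derivative_const has_derivative_ident])+
  have dDM: "(DM w has_derivative frechet_derivative (DM w) (at (x1, x1))) (at (x1, x1))" for w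
    unfolding DM_def[abs_def] by (rule smooth_on_has_derivative[OF smooth_on_derivative[OF D(2)] D(3)])
  have dL: "((\<lambda>x. L x v) has_derivative (\<lambda>u. \<beta> u v)) (at x1)" for v
    using has_derivative_compose[OF pair1 dDM] by (simp add: L_def \<beta>_def)
  \<comment> \<open>For right translation v sits in the first factor and u in the second; the
    symmetry of the second derivative turns this into a value of the same form \<beta>.\<close>
  have dR: "((\<lambda>x. R x v) has_derivative (\<lambda>u. \<beta> v u)) (at x1)" for v
  proof -
    have "frechet_derivative (DM (v, 0)) (at (x1, x1)) (0, u) = \<beta> v u" for u
      unfolding \<beta>_def DM_def[abs_def] by (rule mixed_derivatives_commute[OF D(1,3,2)])
    then show ?thesis using has_derivative_compose[OF pair2 dDM, of "(v, 0)"] by (simp add: R_def)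
  qed
  have dN: "\<exists>N'. ((\<lambda>x. N x v) has_derivative N') (at x1)" for v
  proof -
    have "((\<lambda>x. frechet_derivative K (at x) (0, v)) has_derivative
        frechet_derivative (\<lambda>x. frechet_derivative K (at x) (0, v)) (at (x1, x1))) (at (x1, x1))"
      by (rule smooth_on_has_derivative[OF smooth_on_derivative[OF D'(2)] D'(3)])
    from has_derivative_compose[OF pair1 this] show ?thesis by (auto simp: N_def)
  qed
  have L1: "L x1 v = v" for v using LN[OF x1, of v] N1 R[OF c1(2), of v]
      dch_cong[OF atlas_G c1, of "\<lambda>P. P \<cdot> unit_elt S" "\<lambda>P. P" c1] dch_id[OF atlas_G c1]
    by (simp add: carrier[symmetric])
  have br: "bracket u v = \<beta> u v - \<beta> v u" for u v
  proof -
    have rep: "field_rep MG c1 (left_invariant_field G MG v) x = L x v" if x: "x \<in> ?C" for x v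
    proof -
      obtain Q where Q: "Q \<in> fst c1" "x = snd c1 Q" using x by auto
      note Qc = c1_carrier[OF Q(1)]
      show ?thesis
        using to_chart_differential[OF atlas_G atlas_G left_smooth[OF Qc] one_point c1(1), of v] Q Qc L[OF Q(1), of v]
        by (simp add: field_rep_chart[OF atlas_G c1(1)] left_invariant_field_def)
    qed
    have "frechet_derivative (field_rep MG c1 (left_invariant_field G MG v)) (at x1) u = \<beta> u v" for u v
      using fun_cong[where x = u, OF frechet_derivative_cong_open[OF op x1 rep[of _ v]]]
        fun_cong[where x = u, OF frechet_derivative_at[OF dL[of v]]] by simp
    then show ?thesis by (simp add: lie_bracket_def field_bracket_def Let_def rep[OF x1] L1)
  qed
  obtain N' where N': "((\<lambda>x. N x z) has_derivative N') (at x1)" using dN by blast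
  have "((\<lambda>x. L x (N x z)) has_derivative (\<lambda>u. \<beta> u (N x1 z) + L x1 (N' u))) (at x1)"
    by (rule has_derivative_apply[OF fd_G op x1 lin dL N'])
  moreover have "((\<lambda>x. L x (N x z)) has_derivative (\<lambda>u. \<beta> z u)) (at x1)"
    by (rule has_derivative_transform_within_open[OF dR op x1]) (simp add: LN)
  \<comment> \<open>The product rule on one side, the derivative of \<open>R\<close> on the other.
    At the unit \<open>L\<close> and \<open>N\<close> are identities, so
    \<open>N' u = \<beta> z u - \<beta> u z\<close>.\<close>
  ultimately have "(\<lambda>u. \<beta> u (N x1 z) + L x1 (N' u)) = \<beta> z" by (rule has_derivative_unique)
  from fun_cong[OF this] have "\<beta> u z + N' u = \<beta> z u" for u by (simp add: N1 L1)
  then have "N' u = - bracket u z" for u by (simp add: br algebra_simps)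
  then have "N' = (\<lambda>u. - bracket u z)" by (rule ext)
  with N' have "((\<lambda>x. N x z) has_derivative (\<lambda>u. - bracket u z)) (at x1)" by simp
  then show ?thesis
    by (rule has_derivative_transform_within_open[OF _ op x1]) (auto simp: N_Ad c1_inv)
qed

lemma inner_form_g1: "inner_form g1" by (rule riemannian_metric_inner_form[OF riemannian_G one_point])

lemma Ad_inv_at_one: "Ad (inv\<^bsub>G\<^esub> (chart_inv c1 x1)) v = v"
  using c1 by (simp add: c1_inv Ad_one)

text \<open>The derivative of \<open>Ad_isometry\<close> at the unit; the minus sign from the
  inverse occurs in both terms.\<close>

lemma ad_invariance: "g1 (bracket u z) w = - g1 z (bracket u w)"
proof -
  have "((\<lambda>x. g1 (Ad (inv\<^bsub>G\<^esub> (chart_inv c1 x)) z) (Ad (inv\<^bsub>G\<^esub> (chart_inv c1 x)) w)) has_derivative (\<lambda>u. 0)) (at x1)"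
    by (rule has_derivative_transform_within_open[OF has_derivative_const[of "g1 z w"] c1_open x1])
      (auto simp: c1_inv Ad_isometry c1_carrier)
  from fun_cong[OF has_derivative_unique[OF has_derivative_bilinear[OF fd_G inner_form_g1 Ad_inv_derivative[of z] Ad_inv_derivative[of w]] this], of u]
  show ?thesis
    by (simp add: Ad_inv_at_one linear_neg[OF inner_formD(4)[OF inner_form_g1]] linear_neg[OF inner_formD(5)[OF inner_form_g1]])
qed

text \<open>Differentiates \<open>Ad (inv (Q P inv Q)) (Ad Q z) = Ad Q (Ad (inv P) z)\<close> in P
  at the unit, where both sides are governed by \<open>Ad_inv_derivative\<close>.\<close>

lemma Ad_bracket:
  assumes Q: "Q \<in> carrier G"
  shows "Ad Q (bracket u z) = bracket (Ad Q u) (Ad Q z)"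
proof -
  note op = c1_open
  have conj1: "conjugate Q (unit_elt S) \<in> fst c1" using c1 conjugate_one[OF Q] by simp
  have AdQ: "dch c1 c1 (conjugate Q) (unit_elt S) u = Ad Q u" for u
    by (simp add: Ad_def differential_dch conjugate_one[OF Q])
  have "((\<lambda>x. Ad (inv\<^bsub>G\<^esub> (conjugate Q (chart_inv c1 x))) (Ad Q z)) has_derivative (\<lambda>u. - bracket (Ad Q u) (Ad Q z))) (at x1)"
    using has_derivative_chart_compose[where f = "\<lambda>P. Ad (inv\<^bsub>G\<^esub> P) (Ad Q z)", OF atlas_G atlas_G conjugate_smooth[OF Q] c1 c1(1) conj1]
      Ad_inv_derivative[of "Ad Q z"] by (simp add: conjugate_one[OF Q] AdQ)
  moreover have "((\<lambda>x. Ad (inv\<^bsub>G\<^esub> (conjugate Q (chart_inv c1 x))) (Ad Q z)) has_derivative (\<lambda>u. Ad Q (- bracket u z))) (at x1)"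
  proof (rule has_derivative_transform_within_open[OF bounded_linear.has_derivative[OF
        fd_bounded_linear[OF fd_G Ad_linear[OF Q]] Ad_inv_derivative] op x1])
    fix x assume "x \<in> snd c1 ` fst c1"
    then obtain P where "P \<in> fst c1" "x = snd c1 P" by auto
    then have P: "P \<in> carrier G" "chart_inv c1 x = P" using c1_carrier by (auto simp: c1_inv)
    have "inv\<^bsub>G\<^esub> (conjugate Q P) \<cdot> Q = Q \<cdot> inv\<^bsub>G\<^esub> P"
      using P Q by (simp add: conjugate_def inv_mult_group m_assoc)
    then show "Ad Q (Ad (inv\<^bsub>G\<^esub> (chart_inv c1 x)) z) = Ad (inv\<^bsub>G\<^esub> (conjugate Q (chart_inv c1 x))) (Ad Q z)"
      using P Q conjugate_closed[OF Q P(1)] by (simp flip: Ad_mult)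
  qed
  ultimately have "- bracket (Ad Q u) (Ad Q z) = Ad Q (- bracket u z)"
    using has_derivative_unique by metis
  then show ?thesis by (simp add: linear_neg[OF Ad_linear[OF Q]])
qed

subsection \<open>Fundamental vector fields\<close>

abbreviation fundamental :: "'e \<Rightarrow> 'm \<Rightarrow> 'h" where "fundamental u \<equiv> \<lambda>b. A b u"

lemma action_chart:
  assumes "c \<in> charts B"
  shows "atlas MG" "atlas B" "atlas B" "smooth_map (product_manifold MG B) B (\<lambda>z. act S (fst z) (snd z))"
    "c1 \<in> charts MG" "c \<in> charts B" "c \<in> charts B"
  using atlas_G atlas_B action_smooth c1 assms by auto

lemma fundamental_rep:
  assumes c: "c \<in> charts B" "b \<in> fst c"
  shows "field_rep B c (fundamental u) (snd c b) =
    frechet_derivative (rep (prod_chart c1 c) c (\<lambda>z. act S (fst z) (snd z))) (at (x1, snd c b)) (u, 0)"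
proof -
  have b: "b \<in> points B" using atlas_chart_subset[OF atlas_B c] .
  have ob: "orbit_map S b (unit_elt S) = b" by (simp add: orbit_map_def act_one b)
  have "to_chart B c b (A b u) = dch c1 c (orbit_map S b) (unit_elt S) u"
    using to_chart_differential[OF atlas_G atlas_B orbit_map_smooth[OF b] one_point c(1), of u] c
    by (simp add: d_orbit_map_def ob)
  then show ?thesis
    using dch_slice1[OF action_chart[OF c(1)] c1(2) c(2), of u] c
    by (simp add: field_rep_chart[OF atlas_B c] act_one b orbit_map_def[abs_def])
qed

lemma fundamental_smooth: "smooth_field B (fundamental u)"
proof (rule smooth_fieldI)
  fix c assume c: "c \<in> charts B"
  note op = atlas_chart_open[OF atlas_B c]
  show "smooth_on (snd c ` fst c) (field_rep B c (fundamental u))"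
  proof (rule smooth_on_cong[OF op slice_derivative_smooth2[OF action_chart[OF c] c1(2) op, where w = "(u, 0)"]])
    fix y assume "y \<in> snd c ` fst c"
    then obtain b where b: "b \<in> fst c" "y = snd c b" by auto
    show "(x1, y) \<in> product_domain (\<lambda>z. act S (fst z) (snd z)) c1 c c"
      unfolding b(2) by (rule product_domainI[OF action_chart[OF c] c1(2) b(1)])
        (simp add: b(1) act_one atlas_chart_subset[OF atlas_B c b(1)])
    show "frechet_derivative (rep (prod_chart c1 c) c (\<lambda>z. act S (fst z) (snd z))) (at (x1, y)) (u, 0) =
        field_rep B c (fundamental u) y"
      by (simp add: b fundamental_rep[OF c b(1)])
  qed
qed

lemma orbit_map_dch:
  assumes b: "b \<in> points B"
  shows "dch c1 (chart_at B b) (orbit_map S b) (unit_elt S) u = A b u"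
  by (simp add: d_orbit_map_def differential_dch orbit_map_def act_one b)

text \<open>Differentiates \<open>A_act\<close> in the group variable; the mixed second derivatives of the action are
  symmetric and produce the derivative of the other field.\<close>

lemma fundamental_derivative:
  assumes b: "b \<in> points B"
  defines "c \<equiv> chart_at B b"
  defines "y \<equiv> snd c b"
  shows "frechet_derivative (field_rep B c (fundamental w)) (at y) (A b u) =
    frechet_derivative (field_rep B c (fundamental u)) (at y) (A b w) - A b (bracket u w)"
proof -
  have c: "c \<in> charts B" "b \<in> fst c" using chart_at[OF atlas_B b] by (auto simp: c_def)
  note op = atlas_chart_open[OF atlas_B c(1)]
  note ac = action_chart[OF c(1)]
  have y: "y \<in> snd c ` fst c" using c by (simp add: y_def)
  have ob: "orbit_map S b (unit_elt S) = b" by (simp add: orbit_map_def act_one b)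
  define F where "F = rep (prod_chart c1 c) c (\<lambda>z. act S (fst z) (snd z))"
  define DF where "DF w z = frechet_derivative F (at z) w" for w z
  define D where "D = product_domain (\<lambda>z. act S (fst z) (snd z)) c1 c c"
  have D: "open D" "smooth_on D F" "(x1, y) \<in> D"
    using product_domain_open[OF ac] product_rep_smooth[OF ac] product_domainI[OF ac c1(2) c(2)] c(2)
    by (auto simp: D_def F_def y_def act_one b)
  \<comment> \<open>The differential at b, in the chart \<open>c\<close>, of the action of the group
    element with coordinates x.\<close>
  define T where "T x v = DF (0, v) (x, y)" for x v
  let ?U = "\<lambda>w. field_rep B c (fundamental w)"
  have dDF: "(DF w has_derivative frechet_derivative (DF w) (at (x1, y))) (at (x1, y))" for w
    unfolding DF_def[abs_def] by (rule smooth_on_has_derivative[OF smooth_on_derivative[OF D(2)] D(3)])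
  have pair1: "((\<lambda>x. (x, y)) has_derivative (\<lambda>u. (u, 0))) (at x1)"
    and pair2: "((\<lambda>y'. (x1, y')) has_derivative (\<lambda>u. (0, u))) (at y)"
    by (rule has_derivative_Pair[OF has_derivative_ident has_derivative_const]
        has_derivative_Pair[OF has_derivative_const has_derivative_ident])+
  have dT: "((\<lambda>x. T x v) has_derivative (\<lambda>u. frechet_derivative (DF (0, v)) (at (x1, y)) (u, 0))) (at x1)" for v
    using has_derivative_compose[OF pair1 dDF] by (simp add: T_def)
  have U: "?U w y' = DF (w, 0) (x1, y')" if "y' \<in> snd c ` fst c" for w y'
    using that fundamental_rep[OF c(1), of _ w] by (auto simp: DF_def F_def)
  \<comment> \<open>The derivative of a fundamental field along v is a mixed second derivative of
    the action; by symmetry it is also the derivative of \<open>T\<close> in the group direction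
    u.\<close>
  have dU: "frechet_derivative (?U u) (at y) v = frechet_derivative (DF (0, v)) (at (x1, y)) (u, 0)" for u v
  proof -
    have "((\<lambda>y'. DF (u, 0) (x1, y')) has_derivative (\<lambda>v. frechet_derivative (DF (u, 0)) (at (x1, y)) (0, v))) (at y)"
      by (rule has_derivative_compose[OF pair2 dDF])
    from fun_cong[OF frechet_derivative_at[OF this], of v]
    have "frechet_derivative (?U u) (at y) v = frechet_derivative (DF (u, 0)) (at (x1, y)) (0, v)"
      using fun_cong[where x = v, OF frechet_derivative_cong_open[OF op y U[of _ u]]] by simp
    also have "\<dots> = frechet_derivative (DF (0, v)) (at (x1, y)) (u, 0)"
      unfolding DF_def[abs_def] by (rule mixed_derivatives_commute[OF D(1,3,2)])
    finally show ?thesis .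
  qed
  let ?C = "snd c1 ` {Q \<in> fst c1. orbit_map S b Q \<in> fst c}"
  have C: "open ?C" "x1 \<in> ?C"
    using smooth_map_rep_open[OF atlas_G atlas_B orbit_map_smooth[OF b] c1(1) c(1)] c1 c ob by auto
  have T: "dch c c (act S Q) b v = T (snd c1 Q) v" if "Q \<in> fst c1" "act S Q b \<in> fst c" for Q v
    using dch_slice2[OF ac that(1) c(2), of v] that by (simp add: T_def DF_def F_def y_def)
  have lin: "linear (T x)" if x: "x \<in> ?C" for x
  proof -
    obtain Q where Q: "Q \<in> fst c1" "act S Q b \<in> fst c" "x = snd c1 Q" using x by (auto simp: orbit_map_def)
    have "linear (dch c c (act S Q) b)" by (rule dch_linear[OF act_smooth[OF c1_carrier[OF Q(1)]] c(1) c(1) c(2) Q(2)])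
    moreover have "dch c c (act S Q) b = T x" using T Q by auto
    ultimately show ?thesis by simp
  qed
  have T1: "T x1 v = v" for v
  proof -
    have "dch c c (act S (unit_elt S)) b = dch c c (\<lambda>b. b) b"
      by (rule dch_cong[OF atlas_B c]) (rule act_one)
    then show ?thesis using T[OF c1(2), of v] dch_id[OF atlas_B c] c by (simp add: act_one b)
  qed
  \<comment> \<open>\<open>A_act\<close> in coordinates. Below, the right side is differentiated at
    the unit by the product rule, the left side by the chain rule along the orbit map of b.\<close>
  have rel: "?U w (snd c (orbit_map S b (chart_inv c1 x))) = T x (A b (Ad (inv\<^bsub>G\<^esub> (chart_inv c1 x)) w))" if x: "x \<in> ?C" for x
  proof -
    obtain Q where Q: "Q \<in> fst c1" "act S Q b \<in> fst c" "x = snd c1 Q" using x by (auto simp: orbit_map_def)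
    note Qc = c1_carrier[OF Q(1)]
    have "?U w (snd c (act S Q b)) = to_chart B c (act S Q b) (d_act S Q b (A b (Ad (inv\<^bsub>G\<^esub> Q) w)))"
      by (simp add: field_rep_chart[OF atlas_B c(1) Q(2)] A_act[OF Qc b])
    also have "\<dots> = dch c c (act S Q) b (A b (Ad (inv\<^bsub>G\<^esub> Q) w))"
      using to_chart_differential[OF atlas_B atlas_B act_smooth[OF Qc] b c(1) Q(2)] by (simp add: d_act_def c_def)
    finally show ?thesis using T Q by (simp add: c1_inv orbit_map_def)
  qed
  have "((\<lambda>x. T x (A b (Ad (inv\<^bsub>G\<^esub> (chart_inv c1 x)) w))) has_derivative
      (\<lambda>u. frechet_derivative (DF (0, A b w)) (at (x1, y)) (u, 0) + A b (- bracket u w))) (at x1)"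
    using has_derivative_apply[OF fd_B C lin dT bounded_linear.has_derivative[OF fd_bounded_linear[OF fd_G
          A_linear[OF b]] Ad_inv_derivative[of w]]] by (simp add: T1 Ad_inv_at_one)
  moreover have "((\<lambda>x. T x (A b (Ad (inv\<^bsub>G\<^esub> (chart_inv c1 x)) w))) has_derivative
      (\<lambda>u. frechet_derivative (?U w) (at y) (A b u))) (at x1)"
  proof (rule has_derivative_transform_within_open[OF _ C rel])
    have "((\<lambda>x. ?U w (snd c (orbit_map S b (chart_inv c1 x)))) has_derivative
        (\<lambda>u. frechet_derivative (?U w) (at y) (dch c1 c (orbit_map S b) (unit_elt S) u))) (at x1)"
    proof (rule has_derivative_chart_compose[where f = "\<lambda>b. ?U w (snd c b)", OF atlas_G atlas_B orbit_map_smooth[OF b] c1 c(1)])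
      show "orbit_map S b (unit_elt S) \<in> fst c" using c ob by simp
      have "(?U w has_derivative frechet_derivative (?U w) (at y)) (at y)"
        by (rule smooth_on_has_derivative[OF smooth_field_rep[OF fundamental_smooth c(1)] y])
      then have "((\<lambda>y. ?U w (snd c (chart_inv c y))) has_derivative frechet_derivative (?U w) (at y)) (at y)"
        by (rule has_derivative_transform_within_open[OF _ op y]) (simp add: chart_inv_right)
      then show "((\<lambda>y. ?U w (snd c (chart_inv c y))) has_derivative frechet_derivative (?U w) (at y))
          (at (snd c (orbit_map S b (unit_elt S))))" by (simp add: ob y_def)
    qed
    then show "((\<lambda>x. ?U w (snd c (orbit_map S b (chart_inv c1 x)))) has_derivative
        (\<lambda>u. frechet_derivative (?U w) (at y) (A b u))) (at x1)"
      using orbit_map_dch[OF b] by (simp add: c_def)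
  qed simp
  ultimately have "(\<lambda>u. frechet_derivative (DF (0, A b w)) (at (x1, y)) (u, 0) + A b (- bracket u w)) =
      (\<lambda>u. frechet_derivative (?U w) (at y) (A b u))" by (rule has_derivative_unique)
  from fun_cong[where x = u, OF this]
  have "frechet_derivative (?U w) (at y) (A b u) =
      frechet_derivative (DF (0, A b w)) (at (x1, y)) (u, 0) + A b (- bracket u w)" by simp
  then show ?thesis by (simp add: dU linear_neg[OF A_linear[OF b]])
qed

text \<open>For a left action, passing to fundamental fields reverses the bracket, hence the
  sign.\<close>

lemma fundamental_bracket:
  assumes b: "b \<in> points B"
  shows "field_bracket B (fundamental u) (fundamental w) b = - A b (bracket u w)"
proof -
  have "field_rep B (chart_at B b) (fundamental u) (coord_at B b b) = A b u" for u
    using field_rep_chart[OF atlas_B chart_at[OF atlas_B b]] to_chart_self[OF atlas_B b] by simp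
  then show ?thesis by (simp add: field_bracket_def Let_def fundamental_derivative[OF b, of w u])
qed

subsection \<open>The orbit map as a Riemannian submersion\<close>

abbreviation "hor Q \<equiv> horizontal MG (grp_metric S) B (orbit_map S b0) Q"

text \<open>The orbit map is the projection to cosets followed by an isometry. The differential of
  the isometry is invertible, so surjectivity and the horizontal spaces carry over from the
  projection.\<close>

lemma orbit_map_submersion:
  assumes Q: "Q \<in> carrier G"
  shows "surj (d_orbit_map S b0 Q)"
    and "\<lbrakk>u \<in> hor Q; v \<in> hor Q\<rbrakk> \<Longrightarrow>
      h (act S Q b0) (d_orbit_map S b0 Q u) (d_orbit_map S b0 Q v) = grp_metric S Q u v"
proof -
  let ?K = "isotropy S" and ?\<Phi> = "\<lambda>C. the_elem ((\<lambda>Q. act S Q b0) ` C)"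
  obtain N :: "('g set, 'h) manifold" and hN where N: "smooth_manifold N"
    and pr: "riemannian_submersion MG (grp_metric S) N hN (\<lambda>Q. Q <#\<^bsub>G\<^esub> ?K)"
    and iso: "isometry N hN B h ?\<Phi>"
    using quotient unfolding carries_quotient_metric_def by blast
  let ?pr = "\<lambda>Q. Q <#\<^bsub>G\<^esub> ?K"
  have aN: "atlas N" using N by (rule smooth_manifold_atlas)
  have prs: "smooth_map MG N ?pr" using pr by (simp add: riemannian_submersion_def)
  have \<Phi>s: "smooth_map N B ?\<Phi>" using iso by (simp add: isometry_def diffeomorphism_def)
  have "diffeomorphism N B ?\<Phi>" using iso by (simp add: isometry_def)
  then obtain \<Psi> where \<Psi>': "smooth_map B N \<Psi> \<and> (\<forall>p\<in>points N. \<Psi> (?\<Phi> p) = p) \<and> (\<forall>b\<in>points B. ?\<Phi> (\<Psi> b) = b)"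
    unfolding diffeomorphism_def by (elim conjE exE) (rule that, intro conjI)
  have \<Psi>: "smooth_map B N \<Psi>" "\<And>p. p \<in> points N \<Longrightarrow> \<Psi> (?\<Phi> p) = p" "\<And>b. b \<in> points B \<Longrightarrow> ?\<Phi> (\<Psi> b) = b"
    using \<Psi>' by simp_all
  have eq: "orbit_map S b0 P = ?\<Phi> (?pr P)" if P: "P \<in> carrier G" for P
  proof -
    have "unit_elt S \<in> ?K" using act_one[OF base_in_orbit] by (simp add: stabilizer_def)
    moreover have "act S (P \<cdot> k) b0 = act S P b0" if "k \<in> ?K" for k
      using that P by (simp add: stabilizer_def act_mult base_in_orbit)
    ultimately have "(\<lambda>Q. act S Q b0) ` ?pr P = {act S P b0}"
      by (auto simp: l_coset_def image_iff)
    then show ?thesis by (simp add: orbit_map_def)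
  qed
  have QM: "Q \<in> points MG" using Q carrier by simp
  have pQ: "?pr Q \<in> points N" by (rule smooth_map_point[OF prs QM])
  have \<Phi>Q: "?\<Phi> (?pr Q) = act S Q b0" using eq[OF Q] by (simp add: orbit_map_def)
  let ?d = "differential N B ?\<Phi> (?pr Q)" and ?p = "differential MG N ?pr Q"
  have d: "d_orbit_map S b0 Q u = ?d (?p u)" for u
    using differential_compose[OF atlas_G aN atlas_B prs \<Phi>s QM, of u]
      differential_cong[OF atlas_G QM, of "orbit_map S b0" "\<lambda>P. ?\<Phi> (?pr P)" B] eq
    by (simp add: d_orbit_map_def carrier)
  \<comment> \<open>This identifies the vertical, and hence the horizontal, vectors of the orbit map
    with those of the projection to cosets.\<close>
  have inj: "?d u = 0 \<longleftrightarrow> u = 0" for u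
    using differential_inverse[OF aN atlas_B \<Phi>s \<Psi>(1) pQ \<Psi>(2), of u] linear_0[OF differential_linear[OF aN atlas_B \<Phi>s pQ]]
      linear_0[OF differential_linear[OF atlas_B aN \<Psi>(1) smooth_map_point[OF \<Phi>s pQ]]] by auto
  have "\<exists>u. v = d_orbit_map S b0 Q u" for v
  proof -
    have "surj ?p" using pr QM by (simp add: riemannian_submersion_def)
    then have "differential B N \<Psi> (?\<Phi> (?pr Q)) v \<in> range ?p" by (simp only: UNIV_I)
    then obtain u where u: "differential B N \<Psi> (?\<Phi> (?pr Q)) v = ?p u" by (rule imageE)
    have "?d (?p u) = v"
      unfolding u[symmetric]
      using differential_inverse[OF atlas_B aN \<Psi>(1) \<Phi>s smooth_map_point[OF \<Phi>s pQ] \<Psi>(3), of v]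
      unfolding \<Psi>(2)[OF pQ] .
    then show ?thesis by (intro exI[of _ u]) (simp only: d)
  qed
  then show "surj (d_orbit_map S b0 Q)" unfolding surj_def by (rule allI)
  have "hor Q = horizontal MG (grp_metric S) N ?pr Q"
    using d inj by (auto simp: horizontal_def d_orbit_map_def)
  moreover have "hN (?pr Q) (?p u) (?p v) = grp_metric S Q u v"
    if "u \<in> horizontal MG (grp_metric S) N ?pr Q" "v \<in> horizontal MG (grp_metric S) N ?pr Q"
    using that pr QM by (simp add: riemannian_submersion_def)
  moreover have "h (act S Q b0) (?d u) (?d v) = hN (?pr Q) u v" for u v
    using iso pQ unfolding isometry_def by (subst \<Phi>Q[symmetric]) blast
  ultimately show "h (act S Q b0) (d_orbit_map S b0 Q u) (d_orbit_map S b0 Q v) = grp_metric S Q u v"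
    if "u \<in> hor Q" "v \<in> hor Q"
    using that d by simp
qed

lemma d_orbit_map_linear: "Q \<in> carrier G \<Longrightarrow> linear (d_orbit_map S b0 Q)"
  unfolding d_orbit_map_def by (rule differential_linear[OF atlas_G atlas_B orbit_map_smooth[OF base_in_orbit]]) (simp add: carrier)

lemma inner_form_G: "Q \<in> carrier G \<Longrightarrow> inner_form (grp_metric S Q)"
  by (rule riemannian_metric_inner_form[OF riemannian_G]) (simp add: carrier)

lemma horizontal_part:
  assumes Q: "Q \<in> carrier G"
  obtains \<xi> where "\<xi> \<in> hor Q" "d_orbit_map S b0 Q \<xi> = d_orbit_map S b0 Q \<eta>"
    "\<And>\<zeta>. \<zeta> \<in> hor Q \<Longrightarrow> grp_metric S Q \<zeta> \<eta> = grp_metric S Q \<zeta> \<xi>"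
proof -
  note l = d_orbit_map_linear[OF Q] and g = inner_formD[OF inner_form_G[OF Q]]
  have "subspace {w. d_orbit_map S b0 Q w = 0}"
    using l by (auto intro!: subspaceI simp: linear_add linear_cmul linear_0)
  then obtain w where w: "d_orbit_map S b0 Q w = 0"
    "\<And>z. d_orbit_map S b0 Q z = 0 \<Longrightarrow> grp_metric S Q (\<eta> - w) z = 0"
    by (rule orthogonal_decomposition[OF inner_form_G[OF Q] fd_G, of _ \<eta>]) (rule that, auto)
  show ?thesis
  proof (rule that[of "\<eta> - w"])
    show "\<eta> - w \<in> hor Q" using w by (simp add: horizontal_def d_orbit_map_def)
    show "d_orbit_map S b0 Q (\<eta> - w) = d_orbit_map S b0 Q \<eta>" using w by (simp add: linear_diff[OF l])
    show "grp_metric S Q \<zeta> \<eta> = grp_metric S Q \<zeta> (\<eta> - w)" if "\<zeta> \<in> hor Q" for \<zeta>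
      using that w(1) by (simp add: horizontal_def d_orbit_map_def linear_diff[OF g(4)])
  qed
qed

text \<open>One horizontal argument suffices: replacing \<eta> by its horizontal part changes
  neither side.\<close>

lemma horizontal_isometry:
  assumes Q: "Q \<in> carrier G" and \<xi>: "\<xi> \<in> hor Q"
  shows "h (act S Q b0) (d_orbit_map S b0 Q \<xi>) (d_orbit_map S b0 Q \<eta>) = grp_metric S Q \<xi> \<eta>"
  by (rule horizontal_part[OF Q, of \<eta>]) (metis orbit_map_submersion(2)[OF Q \<xi>] \<xi>)

lemma hor_lift:
  assumes Q: "Q \<in> carrier G"
  shows "hor_lift S Q W \<in> hor Q" "d_orbit_map S b0 Q (hor_lift S Q W) = W"
proof -
  obtain \<eta> where \<eta>: "W = d_orbit_map S b0 Q \<eta>" using orbit_map_submersion(1)[OF Q] by (metis surjD)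
  obtain \<xi> where "\<xi> \<in> hor Q" "d_orbit_map S b0 Q \<xi> = W" using horizontal_part[OF Q, of \<eta>] \<eta> by metis
  then have "W \<in> d_orbit_map S b0 Q ` hor Q" by blast
  then show "hor_lift S Q W \<in> hor Q" "d_orbit_map S b0 Q (hor_lift S Q W) = W"
    unfolding hor_lift_def by (rule inv_into_into, rule f_inv_into_f)
qed

text \<open>Differentiates \<open>P (Q b0) = (P Q) b0\<close> in P at the unit; it ties
  \<open>A\<close> at any point of the orbit to the orbit map of the base point.\<close>

lemma A_right:
  assumes Q: "Q \<in> carrier G"
  shows "A (act S Q b0) u = d_orbit_map S b0 Q (d_right S Q (unit_elt S) u)"
proof -
  have "differential MG B (orbit_map S (act S Q b0)) (unit_elt S) =
      differential MG B (\<lambda>P. orbit_map S b0 (P \<cdot> Q)) (unit_elt S)"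
    by (rule differential_cong[OF atlas_G one_point]) (simp add: orbit_map_def carrier[symmetric] Q act_mult base_in_orbit)
  then show ?thesis
    using differential_compose[OF atlas_G atlas_G atlas_B right_smooth[OF Q] orbit_map_smooth[OF base_in_orbit] one_point, of u] Q
    by (simp add: d_orbit_map_def d_right_def)
qed

lemma d_right_inv:
  assumes Q: "Q \<in> carrier G"
  shows "d_right S Q (unit_elt S) (d_right S (inv\<^bsub>G\<^esub> Q) Q \<xi>) = \<xi>"
  using differential_inverse[OF atlas_G atlas_G right_smooth[OF inv_closed[OF Q]] right_smooth[OF Q], of Q \<xi>] Q
  by (simp add: d_right_def m_assoc flip: carrier)

text \<open>Hence \<^const>\<open>V_fun\<close> does not depend on the choice of \<open>Q\<^sub>b\<close> in the fibre over \<open>b\<close>, and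
  its smoothness needs no smooth section of the orbit map.\<close>

lemma right_translated_lift:
  assumes Q: "Q \<in> carrier G" and b: "b = act S Q b0"
  shows "g1 (d_right S (inv\<^bsub>G\<^esub> Q) Q (hor_lift S Q W)) u = h b W (A b u)"
    and "A b (d_right S (inv\<^bsub>G\<^esub> Q) Q (hor_lift S Q W)) = W"
proof -
  let ?v = "d_right S (inv\<^bsub>G\<^esub> Q) Q (hor_lift S Q W)"
  have "g1 ?v u = grp_metric S Q (hor_lift S Q W) (d_right S Q (unit_elt S) u)"
    using right_isometry[OF Q one_closed, of ?v u] Q by (simp add: d_right_inv)
  also have "\<dots> = h b W (A b u)"
    using horizontal_isometry[OF Q hor_lift(1)[OF Q, of W], of "d_right S Q (unit_elt S) u"]
    by (simp add: hor_lift(2)[OF Q] b A_right[OF Q])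
  finally show "g1 ?v u = h b W (A b u)" .
  show "A b ?v = W" by (simp add: b A_right[OF Q] d_right_inv[OF Q] hor_lift(2)[OF Q])
qed

text \<open>The right inverse of \<open>A b\<close> with values in \<open>m_at S b\<close>; it is also the adjoint of \<open>A b\<close>.\<close>

definition m_rep :: "'m \<Rightarrow> 'h \<Rightarrow> 'e" where "m_rep b W = inv_into (m_at S b) (A b) W"

lemma inner_form_h: "b \<in> points B \<Longrightarrow> inner_form (h b)"
  by (rule riemannian_metric_inner_form[OF riemannian_B])

lemma m_at_representative:
  assumes b: "b \<in> points B"
  shows "\<exists>v\<in>m_at S b. A b v = W \<and> (\<forall>u. g1 v u = h b W (A b u))"
proof -
  obtain Q where Q: "Q \<in> carrier G" "b = act S Q b0" using orbit_pointE[OF b] .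
  note r = right_translated_lift[OF Q, of W]
  have "d_right S (inv\<^bsub>G\<^esub> Q) Q (hor_lift S Q W) \<in> m_at S b"
    using r(1) linear_0[OF inner_formD(4)[OF inner_form_h[OF b]]] by (simp add: m_at_def k_at_def)
  with r show ?thesis by (intro bexI conjI allI)
qed

lemma A_inj_on_m_at:
  assumes b: "b \<in> points B" and v: "v \<in> m_at S b" "v' \<in> m_at S b" and eq: "A b v = A b v'"
  shows "v = v'"
proof (rule ccontr)
  assume "v \<noteq> v'"
  note g = inner_formD[OF inner_form_g1]
  have "A b (v - v') = 0" using eq by (simp add: linear_diff[OF A_linear[OF b]])
  then have "g1 v (v - v') = 0" "g1 v' (v - v') = 0" using v by (auto simp: m_at_def k_at_def)
  then have "g1 (v - v') (v - v') = 0" by (simp add: linear_diff[OF g(5)])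
  then show False using g(3)[of "v - v'"] \<open>v \<noteq> v'\<close> by simp
qed

text \<open>The representative of \<open>A b v\<close> in \<open>m_at S b\<close> is
  \<open>v\<close> itself by injectivity, and its adjoint property is the claim. Hence
  \<open>u\<close> may be arbitrary.\<close>

lemma A_isometry:
  assumes b: "b \<in> points B" and v: "v \<in> m_at S b"
  shows "h b (A b v) (A b u) = g1 v u"
proof -
  obtain v' where v': "v' \<in> m_at S b" "A b v' = A b v" "\<forall>u. g1 v' u = h b (A b v) (A b u)"
    using m_at_representative[OF b] by meson
  have "v' = v" by (rule A_inj_on_m_at[OF b v'(1) v v'(2)])
  with v'(3) show ?thesis by simp
qed

lemma m_rep:
  assumes b: "b \<in> points B"
  shows "m_rep b W \<in> m_at S b" "A b (m_rep b W) = W" "g1 (m_rep b W) u = h b W (A b u)"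
proof -
  have "W \<in> A b ` m_at S b" using m_at_representative[OF b, of W] by blast
  then show 1: "m_rep b W \<in> m_at S b" "A b (m_rep b W) = W"
    unfolding m_rep_def by (rule inv_into_into, rule f_inv_into_f)
  show "g1 (m_rep b W) u = h b W (A b u)" using A_isometry[OF b 1(1), of u] 1(2) by simp
qed

lemma m_rep_unique:
  assumes b: "b \<in> points B" and v: "\<And>u. g1 v u = h b W (A b u)"
  shows "v = m_rep b W"
  by (rule inner_form_eqI[OF inner_form_g1]) (simp add: v m_rep(3)[OF b])

text \<open>\<open>Ad (inv Q)\<close> takes the kernel of \<open>A\<close> at Q b into the kernel at
  b, and \<open>Ad Q\<close> preserves the inner product.\<close>

lemma Ad_m_at:
  assumes Q: "Q \<in> carrier G" and b: "b \<in> points B" and v: "v \<in> m_at S b"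
  shows "Ad Q v \<in> m_at S (act S Q b)"
proof -
  note Qb = act_closed[OF Q b]
  have "g1 (Ad Q v) z = 0" if z: "A (act S Q b) z = 0" for z
  proof -
    have "d_act S Q b (A b (Ad (inv\<^bsub>G\<^esub> Q) z)) = 0" using z by (simp add: A_act[OF Q b])
    then have "A b (Ad (inv\<^bsub>G\<^esub> Q) z) = 0"
      using d_act_inv(2)[OF Q b, of "A b (Ad (inv\<^bsub>G\<^esub> Q) z)"] linear_0[OF d_act_linear[OF inv_closed[OF Q] Qb]]
      by simp
    then have "g1 v (Ad (inv\<^bsub>G\<^esub> Q) z) = 0" using v by (simp add: m_at_def k_at_def)
    then show ?thesis using Ad_isometry[OF Q, of v "Ad (inv\<^bsub>G\<^esub> Q) z"] by (simp add: Ad_inv[OF Q])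
  qed
  then show ?thesis by (simp add: m_at_def k_at_def)
qed

text \<open>Invariance of the orbit metric, inherited from the invariance of \<open>g1\<close> under
  \<open>Ad\<close>, since \<open>A\<close> is isometric on \<open>m_at\<close> at b and at Q
  b.\<close>

lemma d_act_isometry:
  assumes Q: "Q \<in> carrier G" and b: "b \<in> points B"
  shows "h (act S Q b) (d_act S Q b v) (d_act S Q b w) = h b v w"
proof -
  let ?v = "m_rep b v" and ?w = "m_rep b w"
  have "h (act S Q b) (A (act S Q b) (Ad Q ?v)) (A (act S Q b) (Ad Q ?w)) = g1 (Ad Q ?v) (Ad Q ?w)"
    by (rule A_isometry[OF act_closed[OF Q b] Ad_m_at[OF Q b m_rep(1)[OF b]]])
  also have "\<dots> = h b (A b ?v) (A b ?w)" by (simp add: Ad_isometry[OF Q] A_isometry[OF b m_rep(1)[OF b]])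
  finally show ?thesis by (simp add: m_rep(2)[OF b] flip: d_act_A[OF Q b])
qed

lemma m_rep_act:
  assumes Q: "Q \<in> carrier G" and b: "b \<in> points B"
  shows "m_rep (act S Q b) (d_act S Q b W) = Ad Q (m_rep b W)"
proof (rule m_rep_unique[OF act_closed[OF Q b], symmetric])
  fix u
  have "g1 (Ad Q (m_rep b W)) u = g1 (m_rep b W) (Ad (inv\<^bsub>G\<^esub> Q) u)"
    using Ad_isometry[OF Q, of "m_rep b W" "Ad (inv\<^bsub>G\<^esub> Q) u"] by (simp add: Ad_inv[OF Q])
  then show "g1 (Ad Q (m_rep b W)) u = h (act S Q b) (d_act S Q b W) (A (act S Q b) u)"
    by (simp add: m_rep(3)[OF b] A_act[OF Q b] d_act_isometry[OF Q b])
qed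

subsection \<open>The Levi-Civita connection and the Killing equation\<close>

text \<open>By \<open>A_act\<close> and invariance of the metric, the function pulled back along P b
  is the fixed form \<open>h b\<close> applied to \<open>A b (Ad (inv P) w)\<close> and
  \<open>A b (Ad (inv P) z)\<close>, so only \<open>Ad\<close> is differentiated.\<close>

lemma metric_fundamental_derivative:
  assumes b: "b \<in> points B"
  shows "fun_differential B (\<lambda>b. h b (A b w) (A b z)) b (A b u) =
    - h b (A b (bracket u w)) (A b z) - h b (A b w) (A b (bracket u z))"
proof -
  note op = c1_open and hb = inner_formD[OF inner_form_h[OF b]]
  have ob: "orbit_map S b (unit_elt S) = b" by (simp add: orbit_map_def act_one b)
  let ?f = "\<lambda>b. h b (A b w) (A b z)"
  have 1: "((\<lambda>x. ?f (orbit_map S b (chart_inv c1 x))) has_derivative (\<lambda>u. fun_differential B ?f b (A b u))) (at x1)"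
    using fun_differential_compose[OF atlas_G atlas_B orbit_map_smooth[OF b] c1 smooth_fun_metric[OF atlas_B riemannian_B fundamental_smooth fundamental_smooth, of w z]]
      orbit_map_dch[OF b] by (simp add: ob)
  have dA: "((\<lambda>x. A b (Ad (inv\<^bsub>G\<^esub> (chart_inv c1 x)) v)) has_derivative (\<lambda>u. A b (- bracket u v))) (at x1)" for v
    by (rule bounded_linear.has_derivative[OF fd_bounded_linear[OF fd_G A_linear[OF b]] Ad_inv_derivative])
  have "((\<lambda>x. ?f (orbit_map S b (chart_inv c1 x))) has_derivative
      (\<lambda>u. h b (A b (- bracket u w)) (A b z) + h b (A b w) (A b (- bracket u z)))) (at x1)"
  proof (rule has_derivative_transform_within_open[OF _ op x1])
    show "((\<lambda>x. h b (A b (Ad (inv\<^bsub>G\<^esub> (chart_inv c1 x)) w)) (A b (Ad (inv\<^bsub>G\<^esub> (chart_inv c1 x)) z))) has_derivative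
      (\<lambda>u. h b (A b (- bracket u w)) (A b z) + h b (A b w) (A b (- bracket u z)))) (at x1)"
      using has_derivative_bilinear[OF fd_B inner_form_h[OF b] dA[of w] dA[of z]] by (simp add: Ad_inv_at_one)
    fix x assume "x \<in> snd c1 ` fst c1"
    then obtain Q where Q: "Q \<in> fst c1" "x = snd c1 Q" by auto
    note Qc = c1_carrier[OF Q(1)]
    show "h b (A b (Ad (inv\<^bsub>G\<^esub> (chart_inv c1 x)) w)) (A b (Ad (inv\<^bsub>G\<^esub> (chart_inv c1 x)) z)) = ?f (orbit_map S b (chart_inv c1 x))"
      by (simp add: Q c1_inv orbit_map_def A_act[OF Qc b] d_act_isometry[OF Qc b])
  qed
  from fun_cong[where x = u, OF has_derivative_unique[OF 1 this]] show ?thesis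
    by (simp add: linear_neg[OF A_linear[OF b]] linear_neg[OF hb(4)] linear_neg[OF hb(5)])
qed

text \<open>Membership in \<open>m_at S b\<close> lets every pairing in the Koszul formula be
  computed as \<open>g1\<close> on the Lie algebra. All three metric derivatives vanish at b, and
  the bracket terms leave a single term, whence the factor 1/2.\<close>

lemma nabla_fundamental:
  assumes nabla: "levi_civita B h nabla" and b: "b \<in> points B" and u: "u \<in> m_at S b" and w: "w \<in> m_at S b"
  shows "nabla (fundamental u) (fundamental w) b = - (1 / 2) *\<^sub>R A b (bracket u w)"
proof (rule inner_form_eqI[OF inner_form_h[OF b]])
  fix W
  note hb = inner_formD[OF inner_form_h[OF b]]
  obtain z where z: "z \<in> m_at S b" "W = A b z" using m_rep[OF b, of W] by metis
  have sym: "g1 v v' = g1 v' v" for v v' by (rule inner_formD(2)[OF inner_form_g1])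
  have iso: "h b (A b x) (A b v) = g1 x v" "h b (A b v) (A b x) = g1 x v" if "v \<in> m_at S b" for x v
    using A_isometry[OF b that, of x] sym hb(2)[of "A b x" "A b v"] by simp_all
  have neg: "h b (- v) v' = - h b v v'" for v v' by (rule linear_neg[OF hb(5)])
  have gneg: "g1 (- v) v' = - g1 v v'" for v v' by (rule linear_neg[OF inner_formD(5)[OF inner_form_g1]])
  \<comment> \<open>Ad-invariance makes this trilinear form alternating, so every permutation of its
    arguments gives \<open>a\<close> or \<open>- a\<close>.\<close>
  define a where "a = g1 (bracket u w) z"
  have 1: "g1 (bracket w u) z = - a" using bracket_antisym[of w u] by (simp add: a_def gneg)
  have 2: "g1 (bracket u z) w = - a" using ad_invariance[of u z w] sym[of z] by (simp add: a_def)
  have 3: "g1 (bracket z u) w = a" using bracket_antisym[of z u] 2 by (simp add: gneg)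
  have 4: "g1 (bracket w z) u = a" using ad_invariance[of w z u] sym[of z] 1 by simp
  have 5: "g1 (bracket z w) u = - a" using bracket_antisym[of z w] 4 by (simp add: gneg)
  \<comment> \<open>Each metric derivative contributes two opposite multiples of \<open>a\<close>;
    the brackets contribute \<open>- a - a + a\<close>.\<close>
  have "2 * h b (nabla (fundamental u) (fundamental w) b) (A b z) = - a"
    using koszul[OF riemannian_B nabla fundamental_smooth[of u] fundamental_smooth[of w] fundamental_smooth[of z] b]
    by (simp add: metric_fundamental_derivative[OF b] fundamental_bracket[OF b] iso[OF u] iso[OF w] iso[OF z(1)] neg
        1 2 3 4 5 a_def[symmetric])
  then show "h b (nabla (fundamental u) (fundamental w) b) W = h b (- (1 / 2) *\<^sub>R A b (bracket u w)) W"
    by (simp add: z(2) linear_cmul[OF hb(5)] neg iso[OF z(1)] a_def)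
qed

text \<open>In coordinates, the covariant derivative of the fundamental field of \<open>u\<close>
  along itself vanishes at a point where \<open>u\<close> is orthogonal to the isotropy algebra.
  Since \<open>christoffel\<close> is a definite description, the candidate is checked against its
  defining equation.\<close>

lemma killing_christoffel:
  assumes b: "b \<in> points B" and u: "u \<in> m_at S b"
  defines "c \<equiv> chart_at B b"
  defines "y \<equiv> snd c b"
  shows "christoffel B h c y (A b u) (A b u) = - frechet_derivative (field_rep B c (fundamental u)) (at y) (A b u)"
proof -
  have c: "c \<in> charts B" "b \<in> fst c" using chart_at[OF atlas_B b] by (auto simp: c_def)
  note hb = inner_formD[OF inner_form_h[OF b]]
  let ?D = "\<lambda>z. frechet_derivative (field_rep B c (fundamental z)) (at y)"
  let ?G = "\<lambda>v w. frechet_derivative (\<lambda>x. metric_rep B h c x v w) (at y)"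
  have G: "metric_rep B h c y v w = h b v w" for v w
    using from_chart_self[OF atlas_B b] c by (simp add: metric_rep_def y_def c_def atlas_inv[OF atlas_B])
  note der = metric_fields_derivative[OF atlas_B riemannian_B fundamental_smooth fundamental_smooth b, folded c_def, folded y_def]
  have uu: "bracket u u = 0" by (simp add: lie_bracket_def field_bracket_def Let_def)
  have *: "h b (- ?D u (A b u)) w = (?G (A b u) w (A b u) + ?G (A b u) w (A b u) - ?G (A b u) (A b u) w) / 2" for w
  proof -
    obtain z where z: "w = A b z" using m_rep(2)[OF b, of w] by metis
    \<comment> \<open>Trades the derivative of the field of \<open>z\<close> for that of the field
      of \<open>u\<close>; the bracket cancels the one from
      \<open>metric_fundamental_derivative\<close>.\<close>
    have D: "?D z (A b u) = ?D u w - A b (bracket u z)"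
      using fundamental_derivative[OF b, of z u] by (simp add: c_def y_def z)
    have 1: "?G (A b u) w (A b u) = - h b (?D u (A b u)) w - h b (A b u) (?D u w)"
      using der[of u z "A b u"] metric_fundamental_derivative[OF b, of u z u]
      by (simp add: D uu linear_0[OF A_linear[OF b]] linear_0[OF hb(5)] linear_diff[OF hb(4)] flip: z)
    \<comment> \<open>Hence the squared length of the fundamental field of \<open>u\<close> is
      stationary at b.\<close>
    have "g1 (bracket z u) u = 0"
      using ad_invariance[of z u u] inner_formD(2)[OF inner_form_g1, of u "bracket z u"] by simp
    then have "h b (A b u) (A b (bracket z u)) = 0"
      using A_isometry[OF b u, of "bracket z u"] inner_formD(2)[OF inner_form_g1] by simp
    then have 2: "?G (A b u) (A b u) w = - 2 * h b (A b u) (?D u w)"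
      using der[of u u w] metric_fundamental_derivative[OF b, of u u z] hb(2)[of "A b u"] by (simp flip: z)
    show ?thesis by (simp add: 1 2 linear_neg[OF hb(5)])
  qed
  show ?thesis
    unfolding christoffel_def G
  proof (rule the_equality)
    show "\<forall>w. h b (- ?D u (A b u)) w = (?G (A b u) w (A b u) + ?G (A b u) w (A b u) - ?G (A b u) (A b u) w) / 2"
      using * by blast
    show "v = - ?D u (A b u)"
      if "\<forall>w. h b v w = (?G (A b u) w (A b u) + ?G (A b u) w (A b u) - ?G (A b u) (A b u) w) / 2" for v
      by (rule inner_form_eqI[OF inner_form_h[OF b]]) (simp only: that[rule_format] *)
  qed
qed

text \<open>The curve is an integral curve of the fundamental field of \<open>u\<close>, and
  \<open>u\<close> stays in \<open>m_at\<close> of every point on it because the one-parameter group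
  fixes \<open>u\<close> under \<open>Ad\<close>. So \<open>killing_christoffel\<close> gives the
  geodesic equation at all times.\<close>

lemma one_parameter_geodesic:
  assumes expo: "lie_exponential G MG expo" and u: "u \<in> m_alg S"
  shows "geodesic_from B h b0 (A b0 u) (\<lambda>t. orbit_map S b0 (expo (t *\<^sub>R u)))"
proof -
  define \<eta> where "\<eta> t = expo (t *\<^sub>R u)" for t
  have \<eta>s: "smooth_map real_line MG \<eta>" and \<eta>_add: "\<And>s t. \<eta> (s + t) = \<eta> s \<cdot> \<eta> t" and \<eta>v: "velocity MG \<eta> 0 = u"
    using expo by (auto simp: lie_exponential_def \<eta>_def[abs_def])
  have \<eta>c: "\<eta> t \<in> carrier G" for t using curve_point[OF \<eta>s] carrier by simp
  have \<eta>0: "\<eta> 0 = unit_elt S" using \<eta>_add[of 0 0] \<eta>c[of 0] by (metis add_0 l_cancel_one')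
  have along: "((\<lambda>s. f (\<eta> s)) has_vector_derivative f' u) (at 0)"
    if "((\<lambda>y. f (chart_inv c1 y)) has_derivative f') (at x1)" for f :: "'g \<Rightarrow> 'v::real_normed_vector" and f'
    using has_vector_derivative_along_curve[OF atlas_G \<eta>s, of f 0 f'] that by (simp add: \<eta>0 \<eta>v)
  \<comment> \<open>Conjugation by \<open>\<eta> t\<close> fixes the commutative curve \<eta>
    pointwise, hence also its velocity at 0.\<close>
  have Ad_\<eta>: "Ad (\<eta> t) u = u" for t
  proof -
    have 1: "((\<lambda>s. snd c1 (\<eta> s)) has_vector_derivative u) (at 0)"
      by (rule along[OF chart_has_derivative_id[OF atlas_G c1]])
    have "conjugate (\<eta> t) (\<eta> s) = \<eta> s" for s
    proof -
      have "\<eta> t \<cdot> \<eta> s = \<eta> s \<cdot> \<eta> t" by (metis \<eta>_add add.commute)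
      then show ?thesis using \<eta>c by (simp add: conjugate_def m_assoc)
    qed
    moreover have "((\<lambda>s. snd c1 (conjugate (\<eta> t) (\<eta> s))) has_vector_derivative Ad (\<eta> t) u) (at 0)"
    proof (rule along)
      show "((\<lambda>y. snd c1 (conjugate (\<eta> t) (chart_inv c1 y))) has_derivative Ad (\<eta> t)) (at x1)"
        using rep_has_derivative[OF conjugate_smooth[OF \<eta>c[of t]] c1(1) c1(1) c1(2)] c1(2)
        by (simp add: conjugate_one[OF \<eta>c] rep_def[abs_def] Ad_def differential_dch)
    qed
    ultimately have "((\<lambda>s. snd c1 (\<eta> s)) has_vector_derivative Ad (\<eta> t) u) (at 0)" by simp
    from vector_derivative_unique_at[OF this 1] show ?thesis .
  qed
  define \<gamma> where "\<gamma> t = orbit_map S b0 (\<eta> t)" for t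
  have \<gamma>s: "smooth_map real_line B \<gamma>"
    unfolding \<gamma>_def by (rule smooth_map_compose[OF atlas_real_line atlas_G atlas_B \<eta>s orbit_map_smooth[OF base_in_orbit]])
  note \<gamma>p = curve_point[OF \<gamma>s]
  have \<gamma>0: "\<gamma> 0 = b0" by (simp add: \<gamma>_def \<eta>0 orbit_map_def act_one base_in_orbit)
  have \<gamma>_shift: "\<gamma> (s + t) = orbit_map S (\<gamma> t) (\<eta> s)" for s t
    by (simp add: \<gamma>_def orbit_map_def \<eta>_add act_mult \<eta>c base_in_orbit)
  have u\<gamma>: "u \<in> m_at S (\<gamma> t)" for t
    using Ad_m_at[OF \<eta>c base_in_orbit u, of t] by (simp add: Ad_\<eta> \<gamma>_def orbit_map_def)
  \<comment> \<open>The semigroup property reduces time t to time 0: near t, \<gamma> is the orbit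
    of \<open>\<gamma> t\<close> under \<eta> started at 0.\<close>
  have d\<gamma>: "((\<lambda>s. snd c (\<gamma> s)) has_vector_derivative field_rep B c (fundamental u) (snd c (\<gamma> t))) (at t)"
    if c: "c \<in> charts B" "\<gamma> t \<in> fst c" for c t
  proof -
    have ot: "orbit_map S (\<gamma> t) (unit_elt S) = \<gamma> t" by (simp add: orbit_map_def act_one \<gamma>p)
    have "((\<lambda>s. snd c (orbit_map S (\<gamma> t) (\<eta> s))) has_vector_derivative dch c1 c (orbit_map S (\<gamma> t)) (unit_elt S) u) (at 0)"
    proof (rule along)
      show "((\<lambda>y. snd c (orbit_map S (\<gamma> t) (chart_inv c1 y))) has_derivative dch c1 c (orbit_map S (\<gamma> t)) (unit_elt S)) (at x1)"
        using rep_has_derivative[OF orbit_map_smooth[OF \<gamma>p] c1(1) c(1) c1(2)] c(2) by (simp add: ot rep_def[abs_def])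
    qed
    moreover have "dch c1 c (orbit_map S (\<gamma> t)) (unit_elt S) u = field_rep B c (fundamental u) (snd c (\<gamma> t))"
      using to_chart_differential[OF atlas_G atlas_B orbit_map_smooth[OF \<gamma>p[of t]] one_point c(1), of u] c
      by (simp add: ot field_rep_chart[OF atlas_B c] d_orbit_map_def)
    ultimately have "((\<lambda>s. snd c (\<gamma> (s + t))) has_vector_derivative field_rep B c (fundamental u) (snd c (\<gamma> t))) (at 0)"
      by (simp add: \<gamma>_shift)
    then have "((\<lambda>r. snd c (\<gamma> (r + t))) has_derivative (\<lambda>r. r *\<^sub>R field_rep B c (fundamental u) (snd c (\<gamma> t)))) (at (t - t))"
      by (simp add: has_vector_derivative_def)
    from has_derivative_compose[OF has_derivative_diff[OF has_derivative_ident has_derivative_const[of t]] this]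
    show ?thesis by (simp add: has_vector_derivative_def)
  qed
  have "geodesic B h \<gamma>"
    unfolding geodesic_def Let_def
  proof (intro conjI allI \<gamma>s)
    fix t
    define c where "c = chart_at B (\<gamma> t)"
    have c: "c \<in> charts B" "\<gamma> t \<in> fst c" using chart_at[OF atlas_B \<gamma>p] by (auto simp: c_def)
    let ?x = "\<lambda>s. snd c (\<gamma> s)" and ?U = "field_rep B c (fundamental u)"
    \<comment> \<open>Off the chart the coordinate function is arbitrary, so the velocity is known
      only for these s; openness suffices for the second derivative at t.\<close>
    have op: "open {s. \<gamma> s \<in> fst c}"
      using smooth_map_open_domain[OF atlas_real_line real_line_chart smooth_map_continuous[OF \<gamma>s] atlas_chart_openin[OF atlas_B c(1)]]
      by simp
    have x': "vector_derivative ?x (at s) = ?U (?x s)" if "\<gamma> s \<in> fst c" for s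
      by (rule vector_derivative_at[OF d\<gamma>[OF c(1) that]])
    have Ut: "?U (?x t) = A (\<gamma> t) u"
      using field_rep_chart[OF atlas_B c] to_chart_self[OF atlas_B \<gamma>p] by (simp add: c_def)
    have "(?U has_derivative frechet_derivative ?U (at (?x t))) (at (?x t))"
      by (rule smooth_on_has_derivative[OF smooth_field_rep[OF fundamental_smooth c(1)]]) (use c in auto)
    from has_derivative_compose[OF d\<gamma>[OF c, unfolded has_vector_derivative_def] this]
    have "((\<lambda>s. ?U (?x s)) has_vector_derivative frechet_derivative ?U (at (?x t)) (?U (?x t))) (at t)"
      using has_derivative_linear[OF \<open>(?U has_derivative frechet_derivative ?U (at (?x t))) (at (?x t))\<close>]
      by (simp add: has_vector_derivative_def linear_cmul)
    then have "((\<lambda>s. vector_derivative ?x (at s)) has_vector_derivative frechet_derivative ?U (at (?x t)) (?U (?x t))) (at t)"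
      by (rule has_vector_derivative_transform_within_open[OF _ op]) (use c x' in auto)
    from vector_derivative_at[OF this] killing_christoffel[OF \<gamma>p u\<gamma>, of t]
    show "vector_derivative (\<lambda>s. vector_derivative (\<lambda>s. coord_at B (\<gamma> t) (\<gamma> s)) (at s)) (at t) +
        christoffel B h (chart_at B (\<gamma> t)) (coord_at B (\<gamma> t) (\<gamma> t))
          (vector_derivative (\<lambda>s. coord_at B (\<gamma> t) (\<gamma> s)) (at t))
          (vector_derivative (\<lambda>s. coord_at B (\<gamma> t) (\<gamma> s)) (at t)) = 0"
      using x'[OF c(2)] Ut by (simp add: c_def)
  qed
  moreover have "velocity B \<gamma> 0 = A b0 u"
    unfolding velocity_def
    by (rule vector_derivative_at)
      (use d\<gamma>[OF chart_at[OF atlas_B \<gamma>p], of 0] field_rep_chart[OF atlas_B chart_at[OF atlas_B \<gamma>p[of 0]]] to_chart_self[OF atlas_B \<gamma>p[of 0]]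
        in \<open>simp add: \<gamma>0\<close>)
  ultimately show ?thesis by (simp add: geodesic_from_def \<gamma>0 flip: \<gamma>_def[abs_def, unfolded \<eta>_def])
qed

subsection \<open>The connection in terms of fundamental fields\<close>

text \<open>The coefficients of \<open>m_rep b W\<close> in the basis are pairings with
  \<open>W\<close> by the adjoint property. Applying \<open>A b\<close> expands \<open>W\<close> in
  the possibly dependent vectors \<open>A b e\<close>.\<close>

lemma m_rep_expand:
  assumes b: "b \<in> points B" and E: "\<And>v. v = (\<Sum>e\<in>E. g1 v e *\<^sub>R e)"
  shows "m_rep b W = (\<Sum>e\<in>E. h b W (A b e) *\<^sub>R e)" "W = (\<Sum>e\<in>E. h b W (A b e) *\<^sub>R A b e)"
proof -
  show 1: "m_rep b W = (\<Sum>e\<in>E. h b W (A b e) *\<^sub>R e)" by (subst E) (simp add: m_rep(3)[OF b])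
  have "W = A b (m_rep b W)" by (simp add: m_rep(2)[OF b])
  also have "\<dots> = (\<Sum>e\<in>E. h b W (A b e) *\<^sub>R A b e)"
    unfolding 1 by (simp add: linear_sum[OF A_linear[OF b]] linear_cmul[OF A_linear[OF b]])
  finally show "W = (\<Sum>e\<in>E. h b W (A b e) *\<^sub>R A b e)" .
qed

lemma nabla_formula:
  assumes nabla: "levi_civita B h nabla" and X: "smooth_field B X" and Y: "smooth_field B Y" and b: "b \<in> points B"
    and E: "finite E" "\<And>v. v = (\<Sum>e\<in>E. g1 v e *\<^sub>R e)"
  shows "nabla X Y b = (\<Sum>e\<in>E. fun_differential B (\<lambda>q. h q (Y q) (A q e)) b (X b) *\<^sub>R A b e) -
    (1 / 2) *\<^sub>R A b (bracket (m_rep b (X b)) (m_rep b (Y b)))"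
proof -
  have D: "affine_connection B nabla" using nabla by (simp add: levi_civita_def)
  note co = smooth_fun_metric[OF atlas_B riemannian_B _ fundamental_smooth]
  note Al = linear_sum[OF A_linear] linear_cmul[OF A_linear]
  let ?u = "m_rep b (X b)" and ?w = "m_rep b (Y b)"
  have "nabla X Y b = nabla X (\<lambda>q. \<Sum>e\<in>E. h q (Y q) (A q e) *\<^sub>R fundamental e q) b"
    by (rule connection_cong[OF atlas_B D X Y refl m_rep_expand(2)[OF _ E(2)] b])
  also have "\<dots> = (\<Sum>e\<in>E. h b (Y b) (A b e) *\<^sub>R nabla X (fundamental e) b) +
      (\<Sum>e\<in>E. fun_differential B (\<lambda>q. h q (Y q) (A q e)) b (X b) *\<^sub>R A b e)"
    by (rule connection_sum_right[OF atlas_B D E(1) co[OF Y] fundamental_smooth X b])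
  \<comment> \<open>The coefficients are now numbers, taken at b. Read as constant functions they go
    back inside \<open>nabla\<close> without a Leibniz term, and the sum becomes one fundamental
    field. The same is then done in the first argument.\<close>
  also have "(\<Sum>e\<in>E. h b (Y b) (A b e) *\<^sub>R nabla X (fundamental e) b) =
      nabla X (\<lambda>q. \<Sum>e\<in>E. h b (Y b) (A b e) *\<^sub>R fundamental e q) b"
    using connection_sum_right[OF atlas_B D E(1) smooth_fun_const[OF atlas_B] fundamental_smooth X b, of "\<lambda>e. h b (Y b) (A b e)" "\<lambda>e. e"]
    by (simp add: fun_differential_const)
  also have "\<dots> = nabla X (fundamental ?w) b"
    by (rule connection_cong[OF atlas_B D X _ refl _ b, symmetric, OF fundamental_smooth])
      (simp add: m_rep_expand(1)[OF b E(2)] Al)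
  also have "\<dots> = nabla (\<lambda>q. \<Sum>e\<in>E. h q (X q) (A q e) *\<^sub>R fundamental e q) (fundamental ?w) b"
    by (rule connection_cong[OF atlas_B D X fundamental_smooth m_rep_expand(2)[OF _ E(2)] refl b])
  also have "\<dots> = (\<Sum>e\<in>E. h b (X b) (A b e) *\<^sub>R nabla (fundamental e) (fundamental ?w) b)"
    by (rule connection_sum_left[OF atlas_B D E(1) co[OF X] fundamental_smooth fundamental_smooth b])
  also have "\<dots> = nabla (\<lambda>q. \<Sum>e\<in>E. h b (X b) (A b e) *\<^sub>R fundamental e q) (fundamental ?w) b"
    using connection_sum_left[OF atlas_B D E(1) smooth_fun_const[OF atlas_B] fundamental_smooth fundamental_smooth b,
        of "\<lambda>e. h b (X b) (A b e)" "\<lambda>e. e" ?w] by simp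
  also have "\<dots> = nabla (fundamental ?u) (fundamental ?w) b"
    by (rule connection_cong[OF atlas_B D _ fundamental_smooth _ refl b, symmetric, OF fundamental_smooth])
      (simp add: m_rep_expand(1)[OF b E(2)] Al)
  finally show ?thesis by (simp add: nabla_fundamental[OF nabla b m_rep(1)[OF b] m_rep(1)[OF b]])
qed

text \<open>At the unit, horizontal means orthogonal to the isotropy algebra, as the geodesic lemma
  requires of its generator.\<close>

lemma initial_lift:
  "hor_lift S (unit_elt S) W \<in> m_alg S" "A b0 (hor_lift S (unit_elt S) W) = W"
  using hor_lift[OF one_closed, of W] by (auto simp: horizontal_def m_at_def k_at_def d_orbit_map_def)

section \<open>The pulled-back fields, compared at the base point and at \<beta>\<close>

context
  fixes q :: "'m \<Rightarrow> 'g" and \<beta> :: 'm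
  assumes lift: "admissible_lift S q" and \<beta>: "\<beta> \<in> points B"
begin

lemma lift_point: "b \<in> points B \<Longrightarrow> q b \<in> carrier G" "b \<in> points B \<Longrightarrow> act S (q b) b0 = b"
  using lift by (auto simp: admissible_lift_def)

lemma V_fun_m_rep:
  assumes b: "b \<in> points B"
  shows "V_fun S q \<beta> Y b = m_rep b (pulled_field S q \<beta> Y b)"
  unfolding V_fun_def
  by (rule m_rep_unique[OF b right_translated_lift(1)[OF lift_point(1)[OF b] lift_point(2)[OF b, symmetric]]])

lemma d_act_pulled_field:
  "b \<in> points B \<Longrightarrow> d_act S (q \<beta>) b (pulled_field S q \<beta> Y b) = Y (act S (q \<beta>) b)"
  unfolding pulled_field_def by (rule d_act_inv(1)[OF lift_point(1)[OF \<beta>]])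

lemma phi_map_Ad: "phi_map S q \<beta> u = A \<beta> (Ad (q \<beta>) u)"
  using d_act_A[OF lift_point(1)[OF \<beta>] base_in_orbit] by (simp add: phi_map_def lift_point(2)[OF \<beta>])

text \<open>Equivariance of \<open>m_rep\<close> moves the base point from b to its image under
  \<open>q \<beta>\<close>, where the pull-back is undone.\<close>

lemma Ad_m_rep_pulled_field:
  assumes b: "b \<in> points B"
  shows "Ad (q \<beta>) (m_rep b (pulled_field S q \<beta> Y b)) = m_rep (act S (q \<beta>) b) (Y (act S (q \<beta>) b))"
  by (simp add: d_act_pulled_field[OF b] flip: m_rep_act[OF lift_point(1)[OF \<beta>] b])

lemma phi_V_fun:
  assumes b: "b \<in> points B" and E: "\<And>v. v = (\<Sum>e\<in>E. g1 v e *\<^sub>R e)"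
  shows "(phi_map S q \<beta> \<circ> V_fun S q \<beta> Y) b =
    (\<Sum>e\<in>E. h (act S (q \<beta>) b) (Y (act S (q \<beta>) b)) (A (act S (q \<beta>) b) e) *\<^sub>R A \<beta> e)"
  using m_rep_expand(1)[OF act_closed[OF lift_point(1)[OF \<beta>] b] E, of "Y (act S (q \<beta>) b)"]
  by (simp add: V_fun_m_rep[OF b] phi_map_Ad Ad_m_rep_pulled_field[OF b] linear_sum[OF A_linear[OF \<beta>]] linear_cmul[OF A_linear[OF \<beta>]])

text \<open>At the base point the m-lift is \<open>m_rep\<close>; \<open>Ad (q \<beta>)\<close>
  respects brackets and carries both arguments to \<beta>.\<close>

lemma phi_U0_vec: "phi_map S q \<beta> (U0_vec S q \<beta> X Y) = A \<beta> (bracket (m_rep \<beta> (X \<beta>)) (m_rep \<beta> (Y \<beta>)))"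
proof -
  have "m_lift S Z b0 = m_rep b0 (Z b0)" for Z by (simp add: m_lift_def m_rep_def)
  then show ?thesis
    by (simp add: U0_vec_def phi_map_Ad Ad_bracket[OF lift_point(1)[OF \<beta>]] Ad_m_rep_pulled_field[OF base_in_orbit] lift_point(2)[OF \<beta>])
qed

lemma phi_V_fun_derivative:
  assumes Y: "smooth_field B Y" and E: "\<And>v. v = (\<Sum>e\<in>E. g1 v e *\<^sub>R e)"
  shows "(((phi_map S q \<beta> \<circ> V_fun S q \<beta> Y) \<circ> chart_inv (chart_at B b0)) has_derivative
    (\<lambda>\<xi>. \<Sum>e\<in>E. fun_differential B (\<lambda>b. h b (Y b) (A b e)) \<beta> (d_act S (q \<beta>) b0 \<xi>) *\<^sub>R A \<beta> e))
    (at (coord_at B b0 b0))"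
proof -
  let ?c = "chart_at B b0" and ?Q = "q \<beta>"
  note Q = lift_point[OF \<beta>]
  note c = chart_at[OF atlas_B base_in_orbit]
  have "((\<lambda>x. \<Sum>e\<in>E. (\<lambda>b. h b (Y b) (A b e)) (act S ?Q (chart_inv ?c x)) *\<^sub>R A \<beta> e) has_derivative
      (\<lambda>\<xi>. \<Sum>e\<in>E. fun_differential B (\<lambda>b. h b (Y b) (A b e)) \<beta> (d_act S ?Q b0 \<xi>) *\<^sub>R A \<beta> e)) (at (snd ?c b0))"
  proof (intro has_derivative_sum has_derivative_scaleR_left)
    fix e
    show "((\<lambda>x. (\<lambda>b. h b (Y b) (A b e)) (act S ?Q (chart_inv ?c x))) has_derivative
        (\<lambda>\<xi>. fun_differential B (\<lambda>b. h b (Y b) (A b e)) \<beta> (d_act S ?Q b0 \<xi>))) (at (snd ?c b0))"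
      using fun_differential_compose[OF atlas_B atlas_B act_smooth[OF Q(1)] c smooth_fun_metric[OF atlas_B riemannian_B Y fundamental_smooth, of e]]
      by (simp add: Q(2) d_act_def differential_dch)
  qed
  then show ?thesis
    by (rule has_derivative_transform_within_open[OF _ atlas_chart_open[OF atlas_B c(1)]])
      (use c phi_V_fun[OF atlas_chart_subset[OF atlas_B c(1)] E] in \<open>auto simp: atlas_inv[OF atlas_B c(1)]\<close>)
qed

lemma covariant_derivative_formula:
  assumes nabla: "levi_civita B h nabla" and X: "smooth_field B X" and Y: "smooth_field B Y"
  obtains D where "(((phi_map S q \<beta> \<circ> V_fun S q \<beta> Y) \<circ> chart_inv (chart_at B b0)) has_derivative D) (at (coord_at B b0 b0))"
    "nabla X Y \<beta> = D (pulled_field S q \<beta> X b0) - (1 / 2) *\<^sub>R phi_map S q \<beta> (U0_vec S q \<beta> X Y)"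
proof -
  obtain E where E: "finite E" "\<And>v. v = (\<Sum>e\<in>E. g1 v e *\<^sub>R e)" using orthonormal_basis[OF inner_form_g1 fd_G] by metis
  show ?thesis
    by (rule that[OF phi_V_fun_derivative[OF Y E(2)]])
      (simp add: nabla_formula[OF nabla X Y \<beta> E] phi_U0_vec d_act_pulled_field[OF base_in_orbit] lift_point(2)[OF \<beta>])
qed

lemma U0_vec_in_k:
  assumes "\<And>u v. u \<in> m_alg S \<Longrightarrow> v \<in> m_alg S \<Longrightarrow> bracket u v \<in> k_alg S"
  shows "U0_vec S q \<beta> X Y \<in> k_alg S" and "phi_map S q \<beta> (U0_vec S q \<beta> X Y) = 0"
proof -
  show k: "U0_vec S q \<beta> X Y \<in> k_alg S"
    unfolding U0_vec_def m_lift_def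
    by (intro assms m_rep(1)[OF base_in_orbit, unfolded m_rep_def])
  then show "phi_map S q \<beta> (U0_vec S q \<beta> X Y) = 0"
    by (simp add: k_at_def phi_map_def linear_0[OF d_act_linear[OF lift_point(1)[OF \<beta>] base_in_orbit]])
qed

end

end

theorem theorem1:
  fixes S :: "('g, 'e::real_inner, 'm, 'f::real_inner, 'h::real_inner) orbit_data"
    and q :: "'m \<Rightarrow> 'g"
    and expo :: "'e \<Rightarrow> 'g"
    and nabla :: "('m \<Rightarrow> 'h) \<Rightarrow> ('m \<Rightarrow> 'h) \<Rightarrow> 'm \<Rightarrow> 'h"
    and X Y :: "'m \<Rightarrow> 'h"
    and \<beta> :: 'm
  assumes setting: "orbit_setting S"
    and lift: "admissible_lift S q"
    and expo: "lie_exponential (grp S) (grp_mf S) expo"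
    and nabla: "levi_civita (orb S) (orb_metric S) nabla"
    and X: "smooth_field (orb S) X"
    and Y: "smooth_field (orb S) Y"
    and \<beta>: "\<beta> \<in> points (orb S)"
  shows
    \<comment> \<open>The second differential, along the whole orbit, pins \<open>D\<close> down without appeal to the
      openness of \<open>V_nbhd S\<close>.\<close>
    "(\<exists>D. has_differential_on (orb S) (V_nbhd S) (phi_map S q \<beta> \<circ> V_fun S q \<beta> Y) (base S) D \<and>
          has_differential_on (orb S) (points (orb S)) (phi_map S q \<beta> \<circ> V_fun S q \<beta> Y) (base S) D \<and>
          nabla X Y \<beta> = D (pulled_field S q \<beta> X (base S)) -
            (1/2) *\<^sub>R phi_map S q \<beta> (U0_vec S q \<beta> X Y)) \<and>
     geodesic_from (orb S) (orb_metric S) (base S) (pulled_field S q \<beta> X (base S))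
       (\<lambda>t. orbit_map S (base S)
          (expo (t *\<^sub>R hor_lift S (unit_elt S) (pulled_field S q \<beta> X (base S))))) \<and>
     (\<forall>\<gamma>. geodesic_from (orb S) (orb_metric S) (base S) (pulled_field S q \<beta> X (base S)) \<gamma> \<longrightarrow>
        (\<exists>w. ((\<lambda>t. (phi_map S q \<beta> \<circ> V_fun S q \<beta> Y) (\<gamma> t)) has_vector_derivative w) (at 0) \<and>
             nabla X Y \<beta> = w - (1/2) *\<^sub>R phi_map S q \<beta> (U0_vec S q \<beta> X Y))) \<and>
     ((\<forall>u\<in>m_alg S. \<forall>v\<in>m_alg S. lie_bracket (grp S) (grp_mf S) u v \<in> k_alg S) \<longrightarrow>
        U0_vec S q \<beta> X Y \<in> k_alg S \<and> phi_map S q \<beta> (U0_vec S q \<beta> X Y) = 0)"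
proof -
  interpret orbit_space S by unfold_locales (rule setting)
  let ?F = "phi_map S q \<beta> \<circ> V_fun S q \<beta> Y" and ?X = "pulled_field S q \<beta> X (base S)"
  obtain D where D: "((?F \<circ> chart_inv (chart_at (orb S) (base S))) has_derivative D) (at (coord_at (orb S) (base S) (base S)))"
    and nabla_D: "nabla X Y \<beta> = D ?X - (1/2) *\<^sub>R phi_map S q \<beta> (U0_vec S q \<beta> X Y)"
    by (rule covariant_derivative_formula[OF lift \<beta> nabla X Y])
  \<comment> \<open>\<open>D\<close> is a derivative on a full coordinate neighbourhood and
    therefore restricts to any set, in particular to the two in the claim.\<close>
  have "has_differential_on (orb S) N ?F (base S) D" for N
    unfolding has_differential_on_def by (rule has_derivative_at_withinI[OF D])
  moreover have "geodesic_from (orb S) (orb_metric S) (base S) ?X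
      (\<lambda>t. orbit_map S (base S) (expo (t *\<^sub>R hor_lift S (unit_elt S) ?X)))"
    using one_parameter_geodesic[OF expo initial_lift(1)[of ?X]] by (simp only: initial_lift(2))
  \<comment> \<open>By the chain rule the derivative depends on \<gamma> only through its initial
    point and velocity, so it is the same for every such geodesic.\<close>
  moreover have "((\<lambda>t. ?F (\<gamma> t)) has_vector_derivative D ?X) (at 0)"
    if \<gamma>: "geodesic_from (orb S) (orb_metric S) (base S) ?X \<gamma>" for \<gamma>
  proof -
    have \<gamma>': "smooth_map real_line (orb S) \<gamma>" "\<gamma> 0 = base S" "velocity (orb S) \<gamma> 0 = ?X"
      using \<gamma> by (auto simp: geodesic_from_def geodesic_def)
    show ?thesis
      using has_vector_derivative_along_curve[OF atlas_B \<gamma>'(1), of ?F 0 D] D by (simp add: \<gamma>'(2,3) o_def)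
  qed
  moreover have "U0_vec S q \<beta> X Y \<in> k_alg S \<and> phi_map S q \<beta> (U0_vec S q \<beta> X Y) = 0"
    if "\<forall>u\<in>m_alg S. \<forall>v\<in>m_alg S. lie_bracket (grp S) (grp_mf S) u v \<in> k_alg S"
    using U0_vec_in_k[OF lift \<beta>] that by blast
  ultimately show ?thesis using nabla_D by blast
qed

end
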